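(* Let $H$ be a finitely generated group (equipped with the word length metric) with equivariant Hilbert space compression $\alpha_1$. Let $F$ be a finite subgroup of $H$ and let $\theta:F\to H$ be a group monomorphism such that the subgroup of $H$ generated by $\theta(F)\cup F$ is finite. Let $G=\mathrm{HNN}(H,F,\theta)=\langle H,t\mid t^{-1}ft=\theta(f)\ \forall f\in F\rangle$, equipped with the word length metric. Then the equivariant Hilbert space compression $\alpha$ of $G$ satisfies: 1. $\alpha=1$ whenever $F=H$; 2. $\alpha=\min(\alpha_1,1/2)$ otherwise.
   Context: Word length metrics are taken relative to a finite symmetric generating subset and are left-invariant, $d(x,y)=l(x^{-1}y)$ with $l$ the word length; the quantities below do not depend on the choice of finite symmetric generating subset. A map $f:(G,d)\to\mathcal{H}$ to a Hilbert space is a uniform embedding if there are non-decreasing functions $\rho_-,\rho_+:[0,\infty)\to[0,\infty)$ with $\lim_{t\to\infty}\rho_-(t)=+\infty$ and $\rho_-(d(x,y))\le\|f(x)-f(y)\|\le\rho_+(d(x,y))$ for all $x,y\in G$. It is Lipschitz if $\rho_+$ can be taken of the form $\rho_+(t)=Ct$ with $C>0$. It is $G$-equivariant if there is an affine isometric action $\mathcal{A}$ of $G$ on $\mathcal{H}$ with $f(xy)=x\cdot_{\mathcal{A}}f(y)$ for all $x,y\in G$; an affine isometric action is one of the form $x\cdot v=\pi(x)v+b(x)$ with $\pi:G\to\mathcal{O}(\mathcal{H})$ a homomorphism to the orthogonal group and $b(xy)=\pi(x)b(y)+b(x)$. The compression $R(f)$ of a uniform embedding $f$ is the supremum of all $\epsilon\in[0,1]$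 for which there exist $C>0$, $D\ge 0$ with $\|f(x)-f(y)\|\ge (1/C)\,d(x,y)^{\epsilon}-D$ for all $x,y\in G$. The equivariant Hilbert space compression of $(G,d)$ is the supremum of $R(f)$ over all Hilbert spaces $\mathcal{H}$ and all $G$-equivariant Lipschitz uniform embeddings $f:G\to\mathcal{H}$ (for a finitely generated group with the word length metric, the Lipschitz condition is automatic). The supremum of the empty set is $0$. *)

theory Defs
  imports "HOL-Analysis.Analysis" "HOL-Algebra.Generated_Groups"
begin

section \<open>Word length metrics\<close>

definition finite_symmetric_generating_set :: "('a, 'b) monoid_scheme \<Rightarrow> 'a set \<Rightarrow> bool" where
  "finite_symmetric_generating_set G S \<longleftrightarrow>
     finite S \<and> S \<subseteq> carrier G \<and> (\<forall>s\<in>S. inv\<^bsub>G\<^esub> s \<in> S) \<and> generate G S = carrier G"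

definition word_prod :: "('a, 'b) monoid_scheme \<Rightarrow> 'a list \<Rightarrow> 'a" where
  "word_prod G ws = foldr (mult G) ws \<one>\<^bsub>G\<^esub>"

definition word_length :: "('a, 'b) monoid_scheme \<Rightarrow> 'a set \<Rightarrow> 'a \<Rightarrow> nat" where
  "word_length G S x = (LEAST n. \<exists>ws\<in>lists S. length ws = n \<and> word_prod G ws = x)"

definition word_dist :: "('a, 'b) monoid_scheme \<Rightarrow> 'a set \<Rightarrow> 'a \<Rightarrow> 'a \<Rightarrow> real" where
  "word_dist G S x y = real (word_length G S (inv\<^bsub>G\<^esub> x \<otimes>\<^bsub>G\<^esub> y))"


section \<open>Equivariant embeddings into a real Hilbert space\<close>

text \<open>Here \<open>'h\<close> always ranges over real Hilbert spaces, that is, over types of the sort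
  \<open>{real_inner, banach}\<close>; maps on a group only matter on its carrier.\<close>

definition uniform_embedding_with ::
  "('a, 'b) monoid_scheme \<Rightarrow> 'a set \<Rightarrow> ('a \<Rightarrow> 'h::{real_inner, banach})
     \<Rightarrow> (real \<Rightarrow> real) \<Rightarrow> (real \<Rightarrow> real) \<Rightarrow> bool" where
  "uniform_embedding_with G S f \<rho>m \<rho>p \<longleftrightarrow>
     mono_on {0..} \<rho>m \<and> mono_on {0..} \<rho>p \<and> \<rho>m ` {0..} \<subseteq> {0..} \<and> \<rho>p ` {0..} \<subseteq> {0..} \<and>
     filterlim \<rho>m at_top at_top \<and>
     (\<forall>x\<in>carrier G. \<forall>y\<in>carrier G.
        \<rho>m (word_dist G S x y) \<le> norm (f x - f y) \<and> norm (f x - f y) \<le> \<rho>p (word_dist G S x y))"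

definition uniform_embedding ::
  "('a, 'b) monoid_scheme \<Rightarrow> 'a set \<Rightarrow> ('a \<Rightarrow> 'h::{real_inner, banach}) \<Rightarrow> bool" where
  "uniform_embedding G S f \<longleftrightarrow> (\<exists>\<rho>m \<rho>p. uniform_embedding_with G S f \<rho>m \<rho>p)"

definition lipschitz_uniform_embedding ::
  "('a, 'b) monoid_scheme \<Rightarrow> 'a set \<Rightarrow> ('a \<Rightarrow> 'h::{real_inner, banach}) \<Rightarrow> bool" where
  "lipschitz_uniform_embedding G S f \<longleftrightarrow>
     (\<exists>\<rho>m. \<exists>C>0. uniform_embedding_with G S f \<rho>m (\<lambda>t. C * t))"

definition orthogonal_group :: "('h::real_inner \<Rightarrow> 'h) monoid" where
  "orthogonal_group =
     \<lparr>carrier = {T. orthogonal_transformation T \<and> surj T}, mult = (\<circ>), one = id\<rparr>"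

definition affine_isometric_action ::
  "('a, 'b) monoid_scheme \<Rightarrow> ('a \<Rightarrow> 'h \<Rightarrow> 'h) \<Rightarrow> ('a \<Rightarrow> 'h::{real_inner, banach}) \<Rightarrow> bool"
  where
  "affine_isometric_action G \<pi> b \<longleftrightarrow>
     \<pi> \<in> hom G orthogonal_group \<and>
     (\<forall>x\<in>carrier G. \<forall>y\<in>carrier G. b (x \<otimes>\<^bsub>G\<^esub> y) = \<pi> x (b y) + b x)"

definition equivariant ::
  "('a, 'b) monoid_scheme \<Rightarrow> ('a \<Rightarrow> 'h::{real_inner, banach}) \<Rightarrow> bool" where
  "equivariant G f \<longleftrightarrow>
     (\<exists>\<pi> b. affine_isometric_action G \<pi> b \<and>
        (\<forall>x\<in>carrier G. \<forall>y\<in>carrier G. f (x \<otimes>\<^bsub>G\<^esub> y) = \<pi> x (f y) + b x))"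

text \<open>At distance \<open>0\<close> one has \<open>0 powr \<epsilon> = 0\<close> even for \<open>\<epsilon> = 0\<close>; the constant \<open>D\<close> makes this
  convention immaterial.\<close>

definition compression ::
  "('a, 'b) monoid_scheme \<Rightarrow> 'a set \<Rightarrow> ('a \<Rightarrow> 'h::{real_inner, banach}) \<Rightarrow> real" where
  "compression G S f = Sup {\<epsilon>\<in>{0..1}. \<exists>C>0. \<exists>D\<ge>0. \<forall>x\<in>carrier G. \<forall>y\<in>carrier G.
     norm (f x - f y) \<ge> (1 / C) * word_dist G S x y powr \<epsilon> - D}"

lemma compression_bounds: "0 \<le> compression G S f" "compression G S f \<le> 1"
proof -
  let ?E = "{\<epsilon>\<in>{0..1}. \<exists>C>0. \<exists>D\<ge>0. \<forall>x\<in>carrier G. \<forall>y\<in>carrier G.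
     norm (f x - f y) \<ge> (1 / C) * word_dist G S x y powr \<epsilon> - D}"
  have "1 / 1 * word_dist G S x y powr 0 - 1 \<le> norm (f x - f y)" for x y
    by (rule order_trans[of _ 0]) (auto simp: powr_def)
  then have *: "\<exists>C>0. \<exists>D\<ge>0. \<forall>x\<in>carrier G. \<forall>y\<in>carrier G.
      norm (f x - f y) \<ge> (1 / C) * word_dist G S x y powr 0 - D"
    by (intro exI[of _ "1::real"] conjI ballI) auto
  have 0: "0 \<in> ?E"
    by (rule CollectI, rule conjI[OF _ *]) simp
  have "bdd_above ?E" by (rule bdd_aboveI[of _ 1]) auto
  then show "0 \<le> compression G S f" unfolding compression_def using 0 by (rule cSup_upper[rotated])
  show "compression G S f \<le> 1" unfolding compression_def 
  proof (rule cSup_least)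
    show "?E \<noteq> {}" using 0 by blast
  qed auto
qed


section \<open>The sequence space \<open>\<ell>\<^sup>2\<close>\<close>

typedef ell2 = "{a :: nat \<Rightarrow> real. summable (\<lambda>n. (a n)\<^sup>2)}"
  morphisms coord Abs_ell2
  by (intro exI[of _ "\<lambda>_. 0"]) simp

setup_lifting type_definition_ell2

lemma summable_mult_ell2:
  assumes "summable (\<lambda>n. (a n)\<^sup>2)" "summable (\<lambda>n. (b n)\<^sup>2)"
  shows "summable (\<lambda>n. a n * b n :: real)"
proof (rule summable_comparison_test')
  show "summable (\<lambda>n. (a n)\<^sup>2 + (b n)\<^sup>2)" using assms by (rule summable_add)
  show "norm (a n * b n) \<le> (a n)\<^sup>2 + (b n)\<^sup>2" for n
  proof -
    have "2 * (\<bar>a n\<bar> * \<bar>b n\<bar>) \<le> (a n)\<^sup>2 + (b n)\<^sup>2"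
      using sum_squares_bound[of "\<bar>a n\<bar>" "\<bar>b n\<bar>"] by simp
    moreover have "0 \<le> \<bar>a n\<bar> * \<bar>b n\<bar>" by simp
    ultimately show ?thesis unfolding real_norm_def abs_mult by linarith
  qed
qed

lemma summable_add_ell2:
  assumes "summable (\<lambda>n. (a n)\<^sup>2)" "summable (\<lambda>n. (b n)\<^sup>2)"
  shows "summable (\<lambda>n. (a n + b n :: real)\<^sup>2)"
proof -
  have "summable (\<lambda>n. (a n)\<^sup>2 + (b n)\<^sup>2 + 2 * (a n * b n))"
    by (intro summable_add assms summable_mult summable_mult_ell2)
  then show ?thesis by (simp add: power2_sum mult.assoc)
qed

lemma summable_scale_ell2:
  "summable (\<lambda>n. (a n)\<^sup>2) \<Longrightarrow> summable (\<lambda>n. (r * a n :: real)\<^sup>2)"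
  by (simp add: power_mult_distrib summable_mult)

lemma summable_minus_ell2:
  assumes "summable (\<lambda>n. (a n)\<^sup>2)" "summable (\<lambda>n. (b n)\<^sup>2)"
  shows "summable (\<lambda>n. (a n - b n :: real)\<^sup>2)"
  using summable_add_ell2[OF assms(1) summable_scale_ell2[OF assms(2), of "-1"]] by simp

lemma summable_coord [simp]: "summable (\<lambda>n. (coord a n)\<^sup>2)"
  using coord[of a] by simp

lemma coord_Abs_ell2: "summable (\<lambda>n. (a n)\<^sup>2) \<Longrightarrow> coord (Abs_ell2 a) n = a n"
  by (simp add: Abs_ell2_inverse)

lemma ell2_eqI: "(\<And>n. coord a n = coord b n) \<Longrightarrow> a = b"
  by (simp add: coord_inject[symmetric] fun_eq_iff)

instantiation ell2 :: real_inner
begin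

lift_definition zero_ell2 :: ell2 is "\<lambda>_. 0" by simp
lift_definition plus_ell2 :: "ell2 \<Rightarrow> ell2 \<Rightarrow> ell2" is "\<lambda>a b n. a n + b n"
  by (rule summable_add_ell2)
lift_definition minus_ell2 :: "ell2 \<Rightarrow> ell2 \<Rightarrow> ell2" is "\<lambda>a b n. a n - b n"
  by (rule summable_minus_ell2)
lift_definition uminus_ell2 :: "ell2 \<Rightarrow> ell2" is "\<lambda>a n. - a n" by simp
lift_definition scaleR_ell2 :: "real \<Rightarrow> ell2 \<Rightarrow> ell2" is "\<lambda>r a n. r * a n"
  by (rule summable_scale_ell2)
definition inner_ell2 :: "ell2 \<Rightarrow> ell2 \<Rightarrow> real" where
  "inner_ell2 a b = (\<Sum>n. coord a n * coord b n)"
definition norm_ell2 :: "ell2 \<Rightarrow> real" where "norm_ell2 a = sqrt (inner a a)"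
definition dist_ell2 :: "ell2 \<Rightarrow> ell2 \<Rightarrow> real" where "dist_ell2 a b = norm (a - b)"
definition sgn_ell2 :: "ell2 \<Rightarrow> ell2" where "sgn_ell2 a = inverse (norm a) *\<^sub>R a"
definition uniformity_ell2 :: "(ell2 \<times> ell2) filter" where
  "uniformity_ell2 = (INF e\<in>{0<..}. principal {(x, y). dist x y < e})"
definition open_ell2 :: "ell2 set \<Rightarrow> bool" where
  "open_ell2 U \<longleftrightarrow> (\<forall>x\<in>U. eventually (\<lambda>(x', y). x' = x \<longrightarrow> y \<in> U) uniformity)"

instance
proof
  fix a b c :: ell2 and r s :: real
  note smm = summable_mult_ell2[OF summable_coord summable_coord]
  show "a + b + c = a + (b + c)" "a + b = b + a" "0 + a = a" "- a + a = 0" "a - b = a + - b"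
    "r *\<^sub>R (a + b) = r *\<^sub>R a + r *\<^sub>R b" "(r + s) *\<^sub>R a = r *\<^sub>R a + s *\<^sub>R a"
    "r *\<^sub>R s *\<^sub>R a = (r * s) *\<^sub>R a" "1 *\<^sub>R a = a"
    by (rule ell2_eqI; simp add: plus_ell2.rep_eq minus_ell2.rep_eq uminus_ell2.rep_eq
        zero_ell2.rep_eq scaleR_ell2.rep_eq algebra_simps)+
  show "dist a b = norm (a - b)" by (simp add: dist_ell2_def)
  show "sgn a = inverse (norm a) *\<^sub>R a" by (simp add: sgn_ell2_def)
  show "uniformity = (INF e\<in>{0<..}. principal {(x :: ell2, y). dist x y < e})"
    by (simp add: uniformity_ell2_def)
  show "open U \<longleftrightarrow> (\<forall>x\<in>U. eventually (\<lambda>(x', y). x' = x \<longrightarrow> y \<in> U) uniformity)" for U :: "ell2 set"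
    by (simp add: open_ell2_def)
  show "inner a b = inner b a" by (simp add: inner_ell2_def mult.commute)
  show "inner (a + b) c = inner a c + inner b c"
    by (simp add: inner_ell2_def plus_ell2.rep_eq distrib_right suminf_add[OF smm smm])
  show "inner (r *\<^sub>R a) b = r * inner a b"
    by (simp add: inner_ell2_def scaleR_ell2.rep_eq mult.assoc suminf_mult[OF smm])
  show "0 \<le> inner a a"
    unfolding inner_ell2_def by (intro suminf_nonneg smm) simp
  show "inner a a = 0 \<longleftrightarrow> a = 0"
  proof
    assume "inner a a = 0"
    then have "\<forall>n. coord a n * coord a n = 0"
      unfolding inner_ell2_def by (subst (asm) suminf_eq_zero_iff[OF smm]) auto
    then show "a = 0" by (intro ell2_eqI) (simp add: zero_ell2.rep_eq)
  qed (simp add: inner_ell2_def zero_ell2.rep_eq)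
  show "norm a = sqrt (inner a a)" by (simp add: norm_ell2_def)
qed

end

lemmas coord_simps [simp] = zero_ell2.rep_eq plus_ell2.rep_eq minus_ell2.rep_eq
  uminus_ell2.rep_eq scaleR_ell2.rep_eq

lemma norm_ell2_sq: "(norm a)\<^sup>2 = (\<Sum>n. (coord a n)\<^sup>2)" for a :: ell2
  unfolding power2_norm_eq_inner inner_ell2_def by (simp add: power2_eq_square)

lemma sum_coord_le: "(\<Sum>n<N. (coord a n)\<^sup>2) \<le> (norm a)\<^sup>2"
  unfolding norm_ell2_sq by (rule sum_le_suminf) auto

lemma coord_le_norm: "\<bar>coord a n\<bar> \<le> norm a"
proof -
  have "(coord a n)\<^sup>2 \<le> (\<Sum>k<Suc n. (coord a k)\<^sup>2)"
    by (rule member_le_sum) auto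
  also have "\<dots> \<le> (norm a)\<^sup>2" by (rule sum_coord_le)
  finally show ?thesis by (rule abs_le_square_iff[THEN iffD2, THEN order_trans]) simp
qed

instance ell2 :: complete_space
proof
  fix X :: "nat \<Rightarrow> ell2"
  assume X: "Cauchy X"
  have "Cauchy (\<lambda>m. coord (X m) n)" for n
  proof (rule metric_CauchyI)
    fix e :: real assume "0 < e"
    then obtain M where M: "\<forall>m\<ge>M. \<forall>k\<ge>M. dist (X m) (X k) < e"
      using X by (metis metric_CauchyD)
    have "dist (coord (X m) n) (coord (X k) n) \<le> dist (X m) (X k)" for m k
      using coord_le_norm[of "X m - X k" n] by (simp add: dist_norm dist_real_def)
    then show "\<exists>M. \<forall>m\<ge>M. \<forall>k\<ge>M. dist (coord (X m) n) (coord (X k) n) < e"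
      using M by (meson le_less_trans)
  qed
  then have "\<forall>n. \<exists>l. (\<lambda>m. coord (X m) n) \<longlonglongrightarrow> l"
    by (simp add: Cauchy_convergent_iff convergent_def)
  then obtain a where a: "\<And>n. (\<lambda>m. coord (X m) n) \<longlonglongrightarrow> a n" by metis
  have key: "\<exists>M. \<forall>m\<ge>M. \<forall>N. (\<Sum>n<N. (coord (X m) n - a n)\<^sup>2) \<le> e\<^sup>2" if e: "e > 0" for e
  proof -
    obtain M where M: "\<And>m k. m \<ge> M \<Longrightarrow> k \<ge> M \<Longrightarrow> dist (X m) (X k) < e"
      using metric_CauchyD[OF X e] by blast
    have "(\<Sum>n<N. (coord (X m) n - a n)\<^sup>2) \<le> e\<^sup>2" if m: "m \<ge> M" for m N
    proof (rule Lim_bounded[where M = M])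
      show "(\<lambda>k. \<Sum>n<N. (coord (X m) n - coord (X k) n)\<^sup>2) \<longlonglongrightarrow> (\<Sum>n<N. (coord (X m) n - a n)\<^sup>2)"
        by (intro tendsto_intros a)
      show "\<forall>k\<ge>M. (\<Sum>n<N. (coord (X m) n - coord (X k) n)\<^sup>2) \<le> e\<^sup>2"
      proof (intro allI impI)
        fix k assume "k \<ge> M"
        have "(\<Sum>n<N. (coord (X m) n - coord (X k) n)\<^sup>2) \<le> (norm (X m - X k))\<^sup>2"
          using sum_coord_le[of "X m - X k" N] by simp
        also have "\<dots> \<le> e\<^sup>2"
          using M[OF m \<open>k \<ge> M\<close>] by (intro power_mono) (auto simp: dist_norm)
        finally show "(\<Sum>n<N. (coord (X m) n - coord (X k) n)\<^sup>2) \<le> e\<^sup>2" .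
      qed
    qed
    then show ?thesis by blast
  qed
  have sm: "summable (\<lambda>n. (f n)\<^sup>2)" if "\<And>N. (\<Sum>n<N. (f n)\<^sup>2) \<le> c" for f :: "nat \<Rightarrow> real" and c
    by (rule bounded_imp_summable[where B = c])
       (use that[of "Suc _"] in \<open>auto simp: lessThan_Suc_atMost\<close>)
  obtain M where "\<And>N. (\<Sum>n<N. (coord (X M) n - a n)\<^sup>2) \<le> 1\<^sup>2"
    using key[of 1] by auto
  then have "summable (\<lambda>n. (coord (X M) n - a n)\<^sup>2)" by (rule sm)
  then have sa: "summable (\<lambda>n. (a n)\<^sup>2)"
    using summable_minus_ell2[OF summable_coord[of "X M"], of "\<lambda>n. coord (X M) n - a n"] by simp
  have "X \<longlonglongrightarrow> Abs_ell2 a"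
  proof (rule metric_LIMSEQ_I)
    fix e :: real assume e: "0 < e"
    obtain M where M: "\<And>m N. m \<ge> M \<Longrightarrow> (\<Sum>n<N. (coord (X m) n - a n)\<^sup>2) \<le> (e / 2)\<^sup>2"
      using key[of "e / 2"] e by auto
    have "dist (X m) (Abs_ell2 a) < e" if "m \<ge> M" for m
    proof -
      have "(norm (X m - Abs_ell2 a))\<^sup>2 \<le> (e / 2)\<^sup>2"
        unfolding norm_ell2_sq
        by (rule suminf_le_const[OF summable_coord]) (simp add: coord_Abs_ell2[OF sa] M[OF that])
      then have "norm (X m - Abs_ell2 a) \<le> e / 2" using e by (simp add: power2_le_iff_abs_le)
      then show ?thesis using e by (simp add: dist_norm)
    qed
    then show "\<exists>M. \<forall>m\<ge>M. dist (X m) (Abs_ell2 a) < e" by blast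
  qed
  then show "convergent X" by (auto simp: convergent_def)
qed

instance ell2 :: banach ..


section \<open>The equivariant Hilbert space compression\<close>

text \<open>A supremum over all Hilbert spaces cannot be written as a quantification over types. The
  supremum is taken over maps into the separable space \<^typ>\<open>ell2\<close> instead; lemma
  \<open>compression_le_equivariant_compression\<close> below shows that no equivariant Lipschitz uniform
  embedding of a finitely generated group into any real Hilbert space whatsoever has larger
  compression, so the value is the supremum over all Hilbert spaces. The supremum of the empty
  set is \<open>0\<close> by convention.\<close>

definition equivariant_compression :: "('a, 'b) monoid_scheme \<Rightarrow> 'a set \<Rightarrow> real" where
  "equivariant_compression G S =
     (let R = {compression G S f | f :: 'a \<Rightarrow> ell2.
                 equivariant G f \<and> lipschitz_uniform_embedding G S f}
      in if R = {} then 0 else Sup R)"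

lemma group_orthogonal_group: "group (orthogonal_group :: ('h::real_inner \<Rightarrow> 'h) monoid)"
proof (rule groupI)
  fix T :: "'h \<Rightarrow> 'h"
  assume T: "T \<in> carrier orthogonal_group"
  then have ot: "orthogonal_transformation T" and sj: "surj T"
    by (auto simp: orthogonal_group_def)
  have "inj T"
    using ot by (rule orthogonal_transformation_inj)
  then have bij: "bij T" using sj by (simp add: bij_def)
  have "orthogonal_transformation (inv_into UNIV T)"
    unfolding orthogonal_transformation_def
  proof
    show "linear (inv_into UNIV T)"
    proof (rule linearI)
      have lin: "linear T" using ot by (rule orthogonal_transformation_linear)
      show "inv_into UNIV T (x + y) = inv_into UNIV T x + inv_into UNIV T y" for x y
        by (rule inv_f_eq[OF \<open>inj T\<close>]) (simp add: linear_add[OF lin] surj_f_inv_f[OF sj])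
      show "inv_into UNIV T (r *\<^sub>R x) = r *\<^sub>R inv_into UNIV T x" for r x
        by (rule inv_f_eq[OF \<open>inj T\<close>]) (simp add: linear_scale[OF lin] surj_f_inv_f[OF sj])
    qed
    show "\<forall>v w. inv_into UNIV T v \<bullet> inv_into UNIV T w = v \<bullet> w"
    proof (intro allI)
      fix v w
      have "inv_into UNIV T v \<bullet> inv_into UNIV T w = T (inv_into UNIV T v) \<bullet> T (inv_into UNIV T w)"
        using ot by (simp add: orthogonal_transformation_def)
      then show "inv_into UNIV T v \<bullet> inv_into UNIV T w = v \<bullet> w"
        by (simp add: surj_f_inv_f[OF sj])
    qed
  qed
  moreover have "surj (inv_into UNIV T)" using bij by (simp add: bij_imp_bij_inv bij_is_surj)
  moreover have "inv_into UNIV T \<circ> T = id" using bij by (simp add: bij_is_inj)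
  ultimately show "\<exists>T'\<in>carrier orthogonal_group. T' \<otimes>\<^bsub>orthogonal_group\<^esub> T = \<one>\<^bsub>orthogonal_group\<^esub>"
    by (auto simp: orthogonal_group_def)
next
  fix S T :: "'h \<Rightarrow> 'h"
  assume "S \<in> carrier orthogonal_group" "T \<in> carrier orthogonal_group"
  then have ot: "orthogonal_transformation S" "orthogonal_transformation T"
    and sj: "surj S" "surj T"
    by (auto simp: orthogonal_group_def)
  have "orthogonal_transformation (S \<circ> T)" "surj (S \<circ> T)"
    using orthogonal_transformation_compose[OF ot] comp_surj[OF sj(2,1)] by blast+
  then show "S \<otimes>\<^bsub>orthogonal_group\<^esub> T \<in> carrier orthogonal_group"
    by (simp add: orthogonal_group_def del: comp_apply)
qed (simp_all add: orthogonal_group_def comp_assoc orthogonal_transformation_def linear_id)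

lemma countable_finitely_generated:
  assumes "group G" and S: "finite_symmetric_generating_set G S"
  shows "countable (carrier G)"
proof -
  interpret group G by fact
  have SG: "S \<subseteq> carrier G" using S by (simp add: finite_symmetric_generating_set_def)
  have app: "word_prod G (u @ v) = word_prod G u \<otimes>\<^bsub>G\<^esub> word_prod G v \<and> word_prod G u \<in> carrier G"
    if "u \<in> lists S" "v \<in> lists S" for u v
  proof -
    have cl: "word_prod G w \<in> carrier G" if "w \<in> lists S" for w
      using that SG by (induction w) (auto simp: word_prod_def)
    note v = cl[OF that(2)]
    show ?thesis
      using that(1)
    proof induction
      case Nil
      then show ?case using v by (simp add: word_prod_def)
    next
      case (Cons s u)
      then have "s \<in> carrier G" "word_prod G u \<in> carrier G" using SG by auto
      then show ?case using Cons v by (simp add: word_prod_def m_assoc)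
    qed
  qed
  have "g \<in> word_prod G ` lists S" if "g \<in> generate G S" for g
    using that
  proof induction
    case one
    show ?case by (rule image_eqI[of _ _ "[]"]) (auto simp: word_prod_def)
  next
    case (incl h)
    then show ?case using SG by (intro image_eqI[of _ _ "[h]"]) (auto simp: word_prod_def)
  next
    case (inv h)
    then show ?case using S SG
      by (intro image_eqI[of _ _ "[inv\<^bsub>G\<^esub> h]"])
         (auto simp: word_prod_def finite_symmetric_generating_set_def)
  next
    case (eng h1 h2)
    then obtain u v where "u \<in> lists S" "v \<in> lists S" "h1 = word_prod G u" "h2 = word_prod G v"
      by auto
    then show ?case using app[of u v] by (intro image_eqI[of _ _ "u @ v"]) auto
  qed
  then have "carrier G \<subseteq> word_prod G ` lists S"
    using S by (auto simp: finite_symmetric_generating_set_def)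
  moreover have "countable (lists S)"
    using S by (intro countable_lists) (simp add: finite_symmetric_generating_set_def countable_finite)
  ultimately show ?thesis by (meson countable_image countable_subset)
qed

function gram_schmidt :: "(nat \<Rightarrow> 'h::real_inner) \<Rightarrow> nat \<Rightarrow> 'h" where
  "gram_schmidt c n =
     sgn (c n - (\<Sum>i\<in>{..<n}. (c n \<bullet> gram_schmidt c i) *\<^sub>R gram_schmidt c i))"
  by auto
termination by (relation "inv_image less_than snd") auto

declare gram_schmidt.simps [simp del]

lemma gram_schmidt_norm: "gram_schmidt c n = 0 \<or> norm (gram_schmidt c n) = 1"
  by (subst (1 2) gram_schmidt.simps) (auto simp: norm_sgn)

lemma gram_schmidt_orth_less: "i < n \<Longrightarrow> gram_schmidt c i \<bullet> gram_schmidt c n = 0"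
proof (induction n arbitrary: i rule: less_induct)
  case (less n)
  let ?g = "gram_schmidt c"
  have 0: "?g i \<bullet> ?g k = 0" if "k < n" "k \<noteq> i" for k
    using less.IH[of k i] less.IH[of i k] that less.prems by (metis inner_commute nat_neq_iff)
  have "?g i \<bullet> (\<Sum>k<n. (c n \<bullet> ?g k) *\<^sub>R ?g k) = (\<Sum>k<n. (c n \<bullet> ?g k) * (?g i \<bullet> ?g k))"
    by (simp add: inner_sum_right)
  also have "\<dots> = (\<Sum>k<n. if k = i then (c n \<bullet> ?g i) * (?g i \<bullet> ?g i) else 0)"
    by (rule sum.cong) (auto simp: 0)
  also have "\<dots> = (c n \<bullet> ?g i) * (?g i \<bullet> ?g i)"
    using less.prems by simp
  also have "\<dots> = ?g i \<bullet> c n"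
    using gram_schmidt_norm[of c i] by (auto simp: inner_commute dot_square_norm)
  finally have "?g i \<bullet> (c n - (\<Sum>k<n. (c n \<bullet> ?g k) *\<^sub>R ?g k)) = 0"
    by (simp add: inner_diff_right)
  then show ?case
    by (subst gram_schmidt.simps[of c n]) (simp add: sgn_div_norm)
qed

lemma gram_schmidt_orth: "i \<noteq> j \<Longrightarrow> gram_schmidt c i \<bullet> gram_schmidt c j = 0"
  by (metis gram_schmidt_orth_less inner_commute nat_neq_iff)

lemma gram_schmidt_span:
  shows "c n \<in> span (range (gram_schmidt c))" "gram_schmidt c n \<in> span (range c)"
proof -
  let ?g = "gram_schmidt c"
  define w where "w n = c n - (\<Sum>i<n. (c n \<bullet> ?g i) *\<^sub>R ?g i)" for n
  have g: "?g n = sgn (w n)" for n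
    unfolding w_def by (rule gram_schmidt.simps)
  have "c n = norm (w n) *\<^sub>R ?g n + (\<Sum>i<n. (c n \<bullet> ?g i) *\<^sub>R ?g i)"
  proof -
    have "norm (w n) *\<^sub>R ?g n = w n" unfolding g[of n] by (cases "w n = 0") (simp_all add: sgn_div_norm)
    then show ?thesis by (simp add: w_def)
  qed
  also have "\<dots> \<in> span (range ?g)"
    by (intro span_add span_sum span_scale span_base rangeI)
  finally show "c n \<in> span (range ?g)" .
  show "?g n \<in> span (range c)"
  proof (induction n rule: less_induct)
    case (less n)
    show ?case unfolding g[of n] sgn_div_norm w_def
      by (intro span_diff span_sum span_scale span_base rangeI less) simp
  qed
qed

context
  fixes e :: "nat \<Rightarrow> 'h::{real_inner, banach}"
  assumes orth: "\<And>i j. i \<noteq> j \<Longrightarrow> e i \<bullet> e j = 0"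
    and nrm: "\<And>i. e i = 0 \<or> norm (e i) = 1"
begin

lemma norm_sum_orth:
  assumes "finite I"
  shows "(norm (\<Sum>i\<in>I. a i *\<^sub>R e i))\<^sup>2 = (\<Sum>i\<in>I. (a i)\<^sup>2 * (e i \<bullet> e i))"
proof -
  have "(norm (\<Sum>i\<in>I. a i *\<^sub>R e i))\<^sup>2 = (\<Sum>i\<in>I. (norm (a i *\<^sub>R e i))\<^sup>2)"
    using assms by (intro norm_sum_Pythagorean) (auto simp: pairwise_def orthogonal_def orth)
  also have "\<dots> = (\<Sum>i\<in>I. (a i)\<^sup>2 * (e i \<bullet> e i))"
    by (simp add: power_mult_distrib power2_norm_eq_inner)
  finally show ?thesis .
qed

lemma e_self: "e i \<bullet> e i = (if e i = 0 then 0 else 1)"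
  using nrm[of i] by (auto simp: dot_square_norm)

lemma bessel: "(\<Sum>n<N. (v \<bullet> e n)\<^sup>2) \<le> (norm v)\<^sup>2"
proof -
  let ?p = "\<Sum>n<N. (v \<bullet> e n) *\<^sub>R e n"
  have "(v \<bullet> e n)\<^sup>2 * (e n \<bullet> e n) = (v \<bullet> e n)\<^sup>2" for n
    by (simp add: e_self)
  then have "?p \<bullet> ?p = (\<Sum>n<N. (v \<bullet> e n)\<^sup>2)"
    using norm_sum_orth[of "{..<N}" "\<lambda>n. v \<bullet> e n"] unfolding power2_norm_eq_inner
    by (simp only: finite_lessThan)
  moreover have "v \<bullet> ?p = (\<Sum>n<N. (v \<bullet> e n)\<^sup>2)"
    by (simp add: inner_sum_right power2_eq_square)
  moreover have "0 \<le> (v - ?p) \<bullet> (v - ?p)" by simp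
  ultimately show ?thesis
    by (simp add: inner_diff_left inner_diff_right inner_commute power2_norm_eq_inner)
qed

definition coeffs :: "'h \<Rightarrow> ell2" where "coeffs v = Abs_ell2 (\<lambda>n. v \<bullet> e n)"

definition synth :: "ell2 \<Rightarrow> 'h" where "synth a = (\<Sum>n. coord a n *\<^sub>R e n)"

lemma summable_bessel: "summable (\<lambda>n. (v \<bullet> e n)\<^sup>2)"
  by (rule bounded_imp_summable[where B = "(norm v)\<^sup>2"])
     (use bessel[of v "Suc _"] in \<open>auto simp: lessThan_Suc_atMost\<close>)

lemma coord_coeffs: "coord (coeffs v) n = v \<bullet> e n"
  unfolding coeffs_def by (rule coord_Abs_ell2[OF summable_bessel])

lemma linear_coeffs: "linear coeffs"
  by (intro linearI ell2_eqI) (auto simp: coord_coeffs inner_add_left)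

lemma norm_coeffs_le: "norm (coeffs v) \<le> norm v"
proof -
  have "(norm (coeffs v))\<^sup>2 \<le> (norm v)\<^sup>2"
    unfolding norm_ell2_sq by (rule suminf_le_const) (auto simp: coord_coeffs bessel summable_bessel)
  then show ?thesis by (rule power2_le_imp_le) simp
qed

lemma summable_synth: "summable (\<lambda>n. coord a n *\<^sub>R e n)"
  unfolding summable_Cauchy
proof (intro allI impI)
  fix d :: real assume d: "0 < d"
  have "summable (\<lambda>n. (coord a n)\<^sup>2)" by simp
  then obtain N where N: "\<And>m n. m \<ge> N \<Longrightarrow> norm (\<Sum>k\<in>{m..<n}. (coord a k)\<^sup>2) < d\<^sup>2"
    unfolding summable_Cauchy using d by (meson zero_less_power)
  have "norm (\<Sum>k\<in>{m..<n}. coord a k *\<^sub>R e k) < d" if "m \<ge> N" for m n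
  proof -
    have "(norm (\<Sum>k\<in>{m..<n}. coord a k *\<^sub>R e k))\<^sup>2 \<le> (\<Sum>k\<in>{m..<n}. (coord a k)\<^sup>2)"
      by (subst norm_sum_orth) (auto intro!: sum_mono simp: e_self)
    also have "\<dots> < d\<^sup>2" using N[OF that, of n] by simp
    finally show ?thesis using d by (simp add: power_less_imp_less_base)
  qed
  then show "\<exists>N. \<forall>m\<ge>N. \<forall>n. norm (\<Sum>k\<in>{m..<n}. coord a k *\<^sub>R e k) < d" by blast
qed

lemma linear_synth: "linear synth"
proof (rule linearI)
  show "synth (a + b) = synth a + synth b" for a b
    unfolding synth_def by (simp add: scaleR_add_left suminf_add[OF summable_synth summable_synth])
  show "synth (r *\<^sub>R a) = r *\<^sub>R synth a" for r a
    unfolding synth_def using suminf_scaleR_right[OF summable_synth, of r a] by simp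
qed

lemma inner_synth: "synth a \<bullet> v = a \<bullet> coeffs v"
proof -
  have "synth a \<bullet> v = (\<Sum>n. (coord a n *\<^sub>R e n) \<bullet> v)"
    unfolding synth_def
    by (rule bounded_linear.suminf[OF bounded_linear_inner_left summable_synth])
  then show ?thesis by (simp add: inner_ell2_def coord_coeffs inner_commute)
qed

lemma norm_synth_le: "norm (synth a) \<le> norm a"
proof -
  have "norm (synth a) * norm (synth a) = a \<bullet> coeffs (synth a)"
    by (metis inner_synth dot_square_norm power2_eq_square)
  also have "\<dots> \<le> norm a * norm (coeffs (synth a))" by (rule norm_cauchy_schwarz)
  also have "\<dots> \<le> norm a * norm (synth a)"
    by (intro mult_left_mono norm_coeffs_le) simp
  finally show ?thesis
    by (cases "synth a = 0") auto
qed

lemma bounded_linear_coeffs: "bounded_linear coeffs"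
  using linear_coeffs norm_coeffs_le
  by (intro bounded_linear_intro[where K = 1]) (auto simp: linear_add linear_scale)

lemma bounded_linear_synth: "bounded_linear synth"
  using linear_synth norm_synth_le
  by (intro bounded_linear_intro[where K = 1]) (auto simp: linear_add linear_scale)

lemma inner_synth_e: "synth a \<bullet> e k = coord a k * (e k \<bullet> e k)"
proof -
  have "synth a \<bullet> e k = (\<Sum>n. (coord a n *\<^sub>R e n) \<bullet> e k)"
    unfolding synth_def
    by (rule bounded_linear.suminf[OF bounded_linear_inner_left summable_synth])
  also have "\<dots> = (\<Sum>n\<in>{k}. (coord a n *\<^sub>R e n) \<bullet> e k)"
    by (rule suminf_finite) (auto simp: orth)
  finally show ?thesis by simp
qed

definition closed_span :: "'h set" where "closed_span = {v. synth (coeffs v) = v}"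

lemma closed_spanD: "v \<in> closed_span \<Longrightarrow> synth (coeffs v) = v"
  by (simp add: closed_span_def)

lemma synth_coeffs_synth: "synth (coeffs (synth a)) = synth a"
proof -
  have "coord (coeffs (synth a)) n *\<^sub>R e n = coord a n *\<^sub>R e n" for n
    by (simp add: coord_coeffs inner_synth_e e_self)
  then have "(\<lambda>n. coord (coeffs (synth a)) n *\<^sub>R e n) = (\<lambda>n. coord a n *\<^sub>R e n)"
    by (rule ext)
  then show ?thesis unfolding synth_def[of "coeffs _"] synth_def[of a, symmetric]
    by (simp only: synth_def[symmetric])
qed

lemma synth_in: "synth a \<in> closed_span"
  by (simp add: closed_span_def synth_coeffs_synth)

lemma subspace_closed_span: "subspace closed_span"
  unfolding closed_span_def subspace_def
  using linear_coeffs linear_synth by (simp add: linear_add linear_scale linear_0)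

lemma closed_closed_span: "closed closed_span"
  unfolding closed_span_def
  by (intro closed_Collect_eq continuous_intros
        bounded_linear.continuous_on[OF bounded_linear_synth]
        bounded_linear.continuous_on[OF bounded_linear_coeffs])

lemma e_in: "e k \<in> closed_span"
proof -
  have "synth (coeffs (e k)) = (\<Sum>n\<in>{k}. coord (coeffs (e k)) n *\<^sub>R e n)"
    unfolding synth_def
    by (rule suminf_finite) (auto simp: coord_coeffs orth)
  also have "\<dots> = e k" by (simp add: coord_coeffs e_self)
  finally show ?thesis by (simp add: closed_span_def)
qed

lemma span_subset: "span (range e) \<subseteq> closed_span"
  by (rule span_minimal) (use e_in subspace_closed_span in auto)

lemma inner_coeffs: "v \<in> closed_span \<Longrightarrow> coeffs v \<bullet> coeffs w = v \<bullet> w"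
  by (metis (mono_tags, lifting) closed_span_def inner_synth mem_Collect_eq)

lemma norm_coeffs: "v \<in> closed_span \<Longrightarrow> norm (coeffs v) = norm v"
  by (simp add: norm_eq_sqrt_inner inner_coeffs)

lemma transformation_synth_in:
  assumes "orthogonal_transformation T" and T: "\<And>k. T (e k) \<in> closed_span"
  shows "T (synth a) \<in> closed_span"
proof -
  have lin: "linear T" and nT: "\<And>v. norm (T v) = norm v"
    using assms(1) by (auto simp: orthogonal_transformation)
  have bl: "bounded_linear T"
    using lin nT by (intro bounded_linear_intro[where K = 1]) (auto simp: linear_add linear_scale)
  have 1: "(\<lambda>n. T (\<Sum>k<n. coord a k *\<^sub>R e k)) \<longlonglongrightarrow> T (synth a)"
    unfolding synth_def
    by (intro bounded_linear.tendsto[OF bl] summable_LIMSEQ summable_synth)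
  have 2: "T (\<Sum>k<n. coord a k *\<^sub>R e k) \<in> closed_span" for n
    unfolding linear_sum[OF lin] linear_scale[OF lin]
    by (intro subspace_sum subspace_scale subspace_closed_span T)
  show ?thesis by (rule closed_sequentially[OF closed_closed_span 2 1])
qed

definition extend :: "('h \<Rightarrow> 'h) \<Rightarrow> ell2 \<Rightarrow> ell2" where
  "extend T a = coeffs (T (synth a)) + (a - coeffs (synth a))"

lemma synth_extend:
  assumes "orthogonal_transformation T" "\<And>k. T (e k) \<in> closed_span"
  shows "synth (extend T a) = T (synth a)"
  using transformation_synth_in[OF assms, of a] linear_synth
  by (simp add: extend_def linear_add linear_diff synth_coeffs_synth) (simp add: closed_span_def)

lemma extend_comp:
  assumes "orthogonal_transformation T" "\<And>k. T (e k) \<in> closed_span"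
  shows "extend S (extend T a) = extend (S \<circ> T) a"
  unfolding extend_def[of S "extend T a"] synth_extend[OF assms]
  by (simp add: extend_def)

lemma extend_id: "extend id = id"
  by (auto simp: extend_def)

lemma orthogonal_transformation_extend:
  assumes T: "orthogonal_transformation T" "\<And>k. T (e k) \<in> closed_span"
  shows "orthogonal_transformation (extend T)"
proof -
  have lin: "linear T" and nT: "\<And>v. norm (T v) = norm v"
    using T(1) by (auto simp: orthogonal_transformation)
  have "linear (extend T)"
    using lin linear_coeffs linear_synth
    by (intro linearI) (auto simp: extend_def linear_add linear_scale algebra_simps)
  moreover have "norm (extend T a) = norm a" for a
  proof -
    let ?r = "a - coeffs (synth a)"
    have r: "synth ?r = 0"
      using linear_synth by (simp add: linear_diff synth_coeffs_synth)
    have *: "(norm (coeffs v + ?r))\<^sup>2 = (norm v)\<^sup>2 + (norm ?r)\<^sup>2" if v: "v \<in> closed_span" for v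
    proof -
      have "coeffs v \<bullet> ?r = 0" by (metis inner_synth r inner_commute inner_zero_left)
      then have "orthogonal (coeffs v) ?r" by (simp add: orthogonal_def)
      then show ?thesis using norm_coeffs[OF v] by (simp add: norm_add_Pythagorean)
    qed
    have "(norm (extend T a))\<^sup>2 = (norm a)\<^sup>2"
      unfolding extend_def *[OF transformation_synth_in[OF T]] nT
      using *[OF synth_in, of a] by simp
    then show ?thesis by simp
  qed
  ultimately show ?thesis by (simp add: orthogonal_transformation)
qed

end

theorem equivariant_embedding_into_ell2:
  fixes f :: "'a \<Rightarrow> 'h::{real_inner, banach}"
  assumes "group G" and S: "finite_symmetric_generating_set G S" and f: "equivariant G f"
  obtains g :: "'a \<Rightarrow> ell2" where "equivariant G g"
    "\<And>x y. x \<in> carrier G \<Longrightarrow> y \<in> carrier G \<Longrightarrow> norm (g x - g y) = norm (f x - f y)"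
proof -
  interpret group G by fact
  obtain \<pi> b where act: "affine_isometric_action G \<pi> b"
    and eq: "\<And>x y. x \<in> carrier G \<Longrightarrow> y \<in> carrier G \<Longrightarrow> f (x \<otimes>\<^bsub>G\<^esub> y) = \<pi> x (f y) + b x"
    using f by (auto simp: equivariant_def)
  have hom: "\<pi> \<in> hom G orthogonal_group"
    using act by (simp add: affine_isometric_action_def)
  interpret h: group_hom G orthogonal_group \<pi>
    using hom group_orthogonal_group by (simp add: group_hom_def group_hom_axioms_def is_group)
  have ot: "orthogonal_transformation (\<pi> x)" if "x \<in> carrier G" for x
    using h.hom_closed[OF that] by (simp add: orthogonal_group_def)
  have \<pi>1: "\<pi> \<one>\<^bsub>G\<^esub> = id" using h.hom_one by (simp add: orthogonal_group_def)
  have \<pi>m: "\<pi> (x \<otimes>\<^bsub>G\<^esub> y) = \<pi> x \<circ> \<pi> y" if "x \<in> carrier G" "y \<in> carrier G" for x y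
    using h.hom_mult[OF that] by (simp add: orthogonal_group_def)
  have lin: "linear (\<pi> x)" if "x \<in> carrier G" for x
    using ot[OF that] by (rule orthogonal_transformation_linear)
  define c where "c x = f x - f \<one>\<^bsub>G\<^esub>" for x
  have c: "c (x \<otimes>\<^bsub>G\<^esub> y) = \<pi> x (c y) + c x" if "x \<in> carrier G" "y \<in> carrier G" for x y
    using eq[OF that] eq[OF that(1) one_closed] that lin[OF that(1)]
    by (simp add: c_def linear_diff)
  define en where "en = from_nat_into (carrier G)"
  have en: "range en = carrier G"
    unfolding en_def using countable_finitely_generated[OF \<open>group G\<close> S]
    by (intro range_from_nat_into) auto
  define e where "e = gram_schmidt (c \<circ> en)"
  have orth: "\<And>i j. i \<noteq> j \<Longrightarrow> e i \<bullet> e j = 0" and nrm: "\<And>i. e i = 0 \<or> norm (e i) = 1"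
    unfolding e_def by (rule gram_schmidt_orth gram_schmidt_norm; assumption?)+
  note facts = orth nrm
  have rng: "range (c \<circ> en) = c ` carrier G" using en by (metis image_comp)
  have spc: "span (c ` carrier G) \<subseteq> closed_span e"
  proof (rule span_minimal)
    show "subspace (closed_span e)" by (rule subspace_closed_span[where e = e, OF facts])
    have "(c \<circ> en) n \<in> closed_span e" for n
      using gram_schmidt_span(1)[of "c \<circ> en" n] span_subset[where e = e, OF facts] unfolding e_def by blast
    then show "c ` carrier G \<subseteq> closed_span e" unfolding rng[symmetric] by blast
  qed
  have cV: "c x \<in> closed_span e" if "x \<in> carrier G" for x
    using spc that span_base by blast
  have \<pi>e: "\<pi> x (e k) \<in> closed_span e" if x: "x \<in> carrier G" for x k
  proof -
    have "e k \<in> span (c ` carrier G)"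
      using gram_schmidt_span(2)[of "c \<circ> en" k] unfolding e_def rng .
    then have "\<pi> x (e k) \<in> \<pi> x ` span (c ` carrier G)" by blast
    also have "\<dots> = span (\<pi> x ` c ` carrier G)"
      by (rule linear_span_image[OF lin[OF x], symmetric])
    also have "\<dots> \<subseteq> span (c ` carrier G)"
    proof (rule span_minimal)
      show "\<pi> x ` c ` carrier G \<subseteq> span (c ` carrier G)"
      proof clarify
        fix y assume y: "y \<in> carrier G"
        have "\<pi> x (c y) = c (x \<otimes>\<^bsub>G\<^esub> y) - c x" using c[OF x y] by simp
        also have "\<dots> \<in> span (c ` carrier G)" using x y by (intro span_diff span_base) auto
        finally show "\<pi> x (c y) \<in> span (c ` carrier G)" .
      qed
    qed simp
    finally show ?thesis using spc by blast
  qed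
  define \<pi>' where "\<pi>' x = extend e (\<pi> x)" for x
  define g where "g x = coeffs e (c x)" for x
  have comp: "\<pi>' (x \<otimes>\<^bsub>G\<^esub> y) = \<pi>' x \<circ> \<pi>' y" if "x \<in> carrier G" "y \<in> carrier G" for x y
    unfolding \<pi>'_def \<pi>m[OF that] fun_eq_iff comp_apply
    using extend_comp[where e = e, OF facts ot[OF that(2)] \<pi>e[OF that(2)], of "\<pi> x"]
    by (simp add: comp_def)
  have "surj (\<pi>' x)" if x: "x \<in> carrier G" for x
  proof -
    have "\<pi>' x \<circ> \<pi>' (inv\<^bsub>G\<^esub> x) = id"
      using comp[OF x inv_closed[OF x]] x \<pi>1 extend_id[where e = e, OF facts] by (simp add: \<pi>'_def)
    from fun_cong[OF this] show ?thesis
      by (intro surjI[of _ "\<pi>' (inv\<^bsub>G\<^esub> x)"]) (simp only: comp_apply id_apply)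
  qed
  then have hom': "\<pi>' \<in> hom G orthogonal_group"
    using orthogonal_transformation_extend[where e = e, OF facts ot \<pi>e] comp
    unfolding hom_def orthogonal_group_def \<pi>'_def by simp
  have geq: "g (x \<otimes>\<^bsub>G\<^esub> y) = \<pi>' x (g y) + g x" if x: "x \<in> carrier G" and y: "y \<in> carrier G" for x y
  proof -
    have "synth e (g y) = c y" 
      unfolding g_def by (rule closed_spanD[where e = e, OF facts cV[OF y]])
    then show ?thesis
      using c[OF x y] linear_add[OF linear_coeffs[where e = e, OF facts], of "\<pi> x (c y)" "c x"]
      by (simp add: \<pi>'_def extend_def[where e = e, OF facts] g_def)
  qed
  show ?thesis
  proof
    show "equivariant G g"
      unfolding equivariant_def affine_isometric_action_def
      using hom' geq by blast
    show "norm (g x - g y) = norm (f x - f y)" if "x \<in> carrier G" "y \<in> carrier G" for x y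
    proof -
      have "c x - c y \<in> closed_span e"
        using cV that subspace_closed_span[where e = e, OF facts] by (intro subspace_diff) auto
      from norm_coeffs[where e = e, OF facts this]
      have "norm (coeffs e (c x - c y)) = norm (c x - c y)" .
      then show ?thesis
        using linear_diff[OF linear_coeffs[where e = e, OF facts], of "c x" "c y"] by (simp add: g_def c_def)
    qed
  qed
qed

theorem compression_le_equivariant_compression:
  fixes f :: "'a \<Rightarrow> 'h::{real_inner, banach}"
  assumes "group G" "finite_symmetric_generating_set G S"
    and "equivariant G f" "lipschitz_uniform_embedding G S f"
  shows "compression G S f \<le> equivariant_compression G S"
proof -
  obtain g :: "'a \<Rightarrow> ell2" where g: "equivariant G g"
    "\<And>x y. x \<in> carrier G \<Longrightarrow> y \<in> carrier G \<Longrightarrow> norm (g x - g y) = norm (f x - f y)"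
    using equivariant_embedding_into_ell2[OF assms(1-3)] by blast
  have "lipschitz_uniform_embedding G S g"
    using assms(4) g(2) by (simp add: lipschitz_uniform_embedding_def uniform_embedding_with_def)
  moreover have "compression G S g = compression G S f"
    using g(2) by (simp add: compression_def)
  ultimately have mem: "compression G S f \<in> {compression G S f | f :: 'a \<Rightarrow> ell2.
      equivariant G f \<and> lipschitz_uniform_embedding G S f}" (is "_ \<in> ?R")
    using g(1) by (intro CollectI exI[of _ g]) simp
  have "bdd_above ?R" using compression_bounds(2) by (intro bdd_aboveI[of _ 1]) auto
  moreover have "?R \<noteq> {}" using mem by blast
  ultimately show ?thesis
    using mem cSup_upper[OF mem] unfolding equivariant_compression_def Let_def by (simp only: if_False)
qed


section \<open>HNN extensions\<close>

text \<open>The group presented by \<open>\<langle>H, t | t\<inverse> f t = \<theta> f for f in F\<rangle>\<close>: words over \<open>carrier H\<close>, \<open>t\<close>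
  and \<open>t\<inverse>\<close>, modulo the congruence generated by the multiplication table of \<open>H\<close>, the free
  cancellation of \<open>t\<close>, and the relations \<open>t\<inverse> f t = \<theta> f\<close>.\<close>

datatype 'a hnn_letter = Base 'a | Stable | Stable_Inv

definition hnn_words :: "('a, 'b) monoid_scheme \<Rightarrow> 'a hnn_letter list set" where
  "hnn_words H = lists (Base ` carrier H \<union> {Stable, Stable_Inv})"

inductive_set hnn_relations ::
  "('a, 'b) monoid_scheme \<Rightarrow> 'a set \<Rightarrow> ('a \<Rightarrow> 'a) \<Rightarrow> ('a hnn_letter list \<times> 'a hnn_letter list) set"
  for H F \<theta> where
  base_mult: "x \<in> carrier H \<Longrightarrow> y \<in> carrier H \<Longrightarrow>
      ([Base x, Base y], [Base (x \<otimes>\<^bsub>H\<^esub> y)]) \<in> hnn_relations H F \<theta>"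
| base_one: "([Base \<one>\<^bsub>H\<^esub>], []) \<in> hnn_relations H F \<theta>"
| stable_cancel: "([Stable, Stable_Inv], []) \<in> hnn_relations H F \<theta>"
| stable_inv_cancel: "([Stable_Inv, Stable], []) \<in> hnn_relations H F \<theta>"
| conjugate: "f \<in> F \<Longrightarrow> ([Stable_Inv, Base f, Stable], [Base (\<theta> f)]) \<in> hnn_relations H F \<theta>"

inductive_set hnn_congruence ::
  "('a, 'b) monoid_scheme \<Rightarrow> 'a set \<Rightarrow> ('a \<Rightarrow> 'a) \<Rightarrow> ('a hnn_letter list \<times> 'a hnn_letter list) set"
  for H F \<theta> where
  rel: "(u, v) \<in> hnn_relations H F \<theta> \<Longrightarrow> p \<in> hnn_words H \<Longrightarrow> q \<in> hnn_words H \<Longrightarrow>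
      (p @ u @ q, p @ v @ q) \<in> hnn_congruence H F \<theta>"
| refl: "w \<in> hnn_words H \<Longrightarrow> (w, w) \<in> hnn_congruence H F \<theta>"
| sym: "(u, v) \<in> hnn_congruence H F \<theta> \<Longrightarrow> (v, u) \<in> hnn_congruence H F \<theta>"
| trans: "(u, v) \<in> hnn_congruence H F \<theta> \<Longrightarrow> (v, w) \<in> hnn_congruence H F \<theta> \<Longrightarrow>
      (u, w) \<in> hnn_congruence H F \<theta>"

definition HNN ::
  "('a, 'b) monoid_scheme \<Rightarrow> 'a set \<Rightarrow> ('a \<Rightarrow> 'a) \<Rightarrow> 'a hnn_letter list set monoid" where
  "HNN H F \<theta> =
     \<lparr>carrier = hnn_words H // hnn_congruence H F \<theta>,
      mult = (\<lambda>A B. \<Union>a\<in>A. \<Union>b\<in>B. hnn_congruence H F \<theta> `` {a @ b}),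
      one = hnn_congruence H F \<theta> `` {[]}\<rparr>"

context
  fixes H :: "('a, 'b) monoid_scheme" and F :: "'a set" and \<theta> :: "'a \<Rightarrow> 'a"
  assumes H: "group H" and F: "F \<subseteq> carrier H" and \<theta>: "\<theta> ` F \<subseteq> carrier H"
begin

interpretation H: group H by (rule H)

lemma hnn_words_append [simp]:
  "u @ v \<in> hnn_words H \<longleftrightarrow> u \<in> hnn_words H \<and> v \<in> hnn_words H"
  by (simp add: hnn_words_def)

lemma hnn_congruence_words:
  "(u, v) \<in> hnn_congruence H F \<theta> \<Longrightarrow> u \<in> hnn_words H \<and> v \<in> hnn_words H"
proof (induction rule: hnn_congruence.induct)
  case (rel u v p q)
  from rel(1) have "u \<in> hnn_words H \<and> v \<in> hnn_words H"
    by cases (use F \<theta> in \<open>auto simp: hnn_words_def\<close>)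
  then show ?case using rel by simp
qed auto

lemma equiv_hnn_congruence: "equiv (hnn_words H) (hnn_congruence H F \<theta>)"
proof (rule equivI)
  show "hnn_congruence H F \<theta> \<subseteq> hnn_words H \<times> hnn_words H"
    using hnn_congruence_words by auto
  show "refl_on (hnn_words H) (hnn_congruence H F \<theta>)"
    by (rule refl_onI) (rule hnn_congruence.refl)
  show "sym (hnn_congruence H F \<theta>)" by (rule symI) (rule hnn_congruence.sym)
  show "trans (hnn_congruence H F \<theta>)" by (rule transI) (rule hnn_congruence.trans)
qed

lemma hnn_congruence_context:
  assumes "(u, v) \<in> hnn_congruence H F \<theta>" "p \<in> hnn_words H" "q \<in> hnn_words H"
  shows "(p @ u @ q, p @ v @ q) \<in> hnn_congruence H F \<theta>"
  using assms
proof (induction rule: hnn_congruence.induct)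
  case (rel u v p' q')
  then show ?case using hnn_congruence.rel[of u v H F \<theta> "p @ p'" "q' @ q"] by simp
next
  case (refl w)
  then show ?case by (intro hnn_congruence.refl) simp
next
  case (sym u v)
  from sym.IH[OF sym.prems] show ?case by (rule hnn_congruence.sym)
next
  case (trans u v w)
  from trans.IH(1)[OF trans.prems] trans.IH(2)[OF trans.prems] show ?case
    by (rule hnn_congruence.trans)
qed

lemma hnn_congruence_append:
  assumes "(u, u') \<in> hnn_congruence H F \<theta>" "(v, v') \<in> hnn_congruence H F \<theta>"
  shows "(u @ v, u' @ v') \<in> hnn_congruence H F \<theta>"
proof (rule hnn_congruence.trans)
  have nil: "[] \<in> hnn_words H" by (simp add: hnn_words_def)
  show "(u @ v, u' @ v) \<in> hnn_congruence H F \<theta>"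
    using hnn_congruence_context[OF assms(1) nil, of v] hnn_congruence_words[OF assms(2)] by simp
  show "(u' @ v, u' @ v') \<in> hnn_congruence H F \<theta>"
    using hnn_congruence_context[OF assms(2) _ nil, of u'] hnn_congruence_words[OF assms(1)]
    by simp
qed

lemma HNN_mult_class:
  assumes "u \<in> hnn_words H" "v \<in> hnn_words H"
  shows "(hnn_congruence H F \<theta> `` {u}) \<otimes>\<^bsub>HNN H F \<theta>\<^esub> (hnn_congruence H F \<theta> `` {v}) =
    hnn_congruence H F \<theta> `` {u @ v}"
proof -
  have "congruent2 (hnn_congruence H F \<theta>) (hnn_congruence H F \<theta>)
      (\<lambda>a b. hnn_congruence H F \<theta> `` {a @ b})"
    by (rule congruent2I') (intro equiv_class_eq[OF equiv_hnn_congruence] hnn_congruence_append)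
  then show ?thesis
    using UN_equiv_class2[OF equiv_hnn_congruence equiv_hnn_congruence _ assms]
    by (simp add: HNN_def)
qed

lemma hnn_letter_inverse:
  assumes "l \<in> Base ` carrier H \<union> {Stable, Stable_Inv}"
  shows "\<exists>k. [k] \<in> hnn_words H \<and> ([k, l], []) \<in> hnn_congruence H F \<theta>"
proof -
  have nil: "[] \<in> hnn_words H" by (simp add: hnn_words_def)
  note R = hnn_congruence.rel[OF _ nil nil, simplified]
  consider (b) x where "x \<in> carrier H" "l = Base x" | (t) "l = Stable" | (i) "l = Stable_Inv"
    using assms by blast
  then show ?thesis
  proof cases
    case b
    have "([Base (inv\<^bsub>H\<^esub> x), Base x], [Base \<one>\<^bsub>H\<^esub>]) \<in> hnn_congruence H F \<theta>"
      using R[OF hnn_relations.base_mult[of "inv\<^bsub>H\<^esub> x" H x]] b by simp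
    then have "([Base (inv\<^bsub>H\<^esub> x), Base x], []) \<in> hnn_congruence H F \<theta>"
      by (rule hnn_congruence.trans) (rule R[OF hnn_relations.base_one])
    then show ?thesis using b by (intro exI[of _ "Base (inv\<^bsub>H\<^esub> x)"]) (auto simp: hnn_words_def)
  next
    case t
    then show ?thesis
      using R[OF hnn_relations.stable_inv_cancel] by (auto simp: hnn_words_def)
  next
    case i
    then show ?thesis
      using R[OF hnn_relations.stable_cancel] by (auto simp: hnn_words_def)
  qed
qed

lemma hnn_word_inverse:
  "w \<in> hnn_words H \<Longrightarrow> \<exists>w'\<in>hnn_words H. (w' @ w, []) \<in> hnn_congruence H F \<theta>"
proof (induction w)
  case Nil
  then show ?case by (intro bexI[of _ "[]"]) (auto intro: hnn_congruence.refl)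
next
  case (Cons l w)
  then have l: "l \<in> Base ` carrier H \<union> {Stable, Stable_Inv}" and w: "w \<in> hnn_words H"
    by (auto simp: hnn_words_def)
  obtain w' where w': "w' \<in> hnn_words H" "(w' @ w, []) \<in> hnn_congruence H F \<theta>"
    using Cons.IH[OF w] by blast
  obtain k where k: "[k] \<in> hnn_words H" "([k, l], []) \<in> hnn_congruence H F \<theta>"
    using hnn_letter_inverse[OF l] by blast
  have "((w' @ [k]) @ l # w, w' @ w) \<in> hnn_congruence H F \<theta>"
    using hnn_congruence_context[OF k(2) w'(1) w] by simp
  then have "((w' @ [k]) @ l # w, []) \<in> hnn_congruence H F \<theta>"
    by (rule hnn_congruence.trans[OF _ w'(2)])
  then show ?case using w' k by (intro bexI[of _ "w' @ [k]"]) auto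
qed

theorem group_HNN: "group (HNN H F \<theta>)"
proof (rule groupI)
  let ?c = "\<lambda>w. hnn_congruence H F \<theta> `` {w}"
  have nil: "[] \<in> hnn_words H" by (simp add: hnn_words_def)
  have carr: "carrier (HNN H F \<theta>) = ?c ` hnn_words H"
    by (auto simp: HNN_def quotient_def)
  have one: "\<one>\<^bsub>HNN H F \<theta>\<^esub> = ?c []" by (simp add: HNN_def)
  show "\<one>\<^bsub>HNN H F \<theta>\<^esub> \<in> carrier (HNN H F \<theta>)" using nil by (auto simp: one carr)
  fix x assume "x \<in> carrier (HNN H F \<theta>)"
  then obtain u where u: "u \<in> hnn_words H" "x = ?c u" by (auto simp: carr)
  show "\<one>\<^bsub>HNN H F \<theta>\<^esub> \<otimes>\<^bsub>HNN H F \<theta>\<^esub> x = x"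
    using HNN_mult_class[OF nil u(1)] by (simp add: one u)
  obtain u' where "u' \<in> hnn_words H" "(u' @ u, []) \<in> hnn_congruence H F \<theta>"
    using hnn_word_inverse[OF u(1)] by blast
  then have "?c u' \<in> carrier (HNN H F \<theta>)"
    "?c u' \<otimes>\<^bsub>HNN H F \<theta>\<^esub> x = \<one>\<^bsub>HNN H F \<theta>\<^esub>"
    using HNN_mult_class[of u' u] u(1) equiv_class_eq[OF equiv_hnn_congruence, of "u' @ u" "[]"]
    unfolding carr one u(2) by simp_all
  then show "\<exists>y\<in>carrier (HNN H F \<theta>). y \<otimes>\<^bsub>HNN H F \<theta>\<^esub> x = \<one>\<^bsub>HNN H F \<theta>\<^esub>" ..
  fix y assume "y \<in> carrier (HNN H F \<theta>)"
  then obtain v where v: "v \<in> hnn_words H" "y = ?c v" by (auto simp: carr)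
  show "x \<otimes>\<^bsub>HNN H F \<theta>\<^esub> y \<in> carrier (HNN H F \<theta>)"
    using u v HNN_mult_class[of u v] by (auto simp: carr)
  fix z assume "z \<in> carrier (HNN H F \<theta>)"
  then obtain w where w: "w \<in> hnn_words H" "z = ?c w" by (auto simp: carr)
  show "x \<otimes>\<^bsub>HNN H F \<theta>\<^esub> y \<otimes>\<^bsub>HNN H F \<theta>\<^esub> z = x \<otimes>\<^bsub>HNN H F \<theta>\<^esub> (y \<otimes>\<^bsub>HNN H F \<theta>\<^esub> z)"
    using u v w by (simp add: HNN_mult_class)
qed

end

end

theory Submission
  imports Defs "HOL-Real_Asymp.Real_Asymp"
begin

text \<open>Distances between values are all that the compression sees of an equivariant map, and a map into a
  Hilbert space is equivariant, up to a translation, as soon as these distances are left-invariant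
  (\<open>left_invariant_imp_equivariant\<close>). So both the construction of good maps and the obstructions to them can be phrased with
  left-invariant maps. Throughout, \<open>G\<close> is the HNN extension, and its Bass-Serre tree, whose vertices are the
  cosets \<open>g H\<close>, is present through reduced words: a reduced word \<open>h\<^sub>0 t\<^bsup>e\<^sub>1\<^esup> h\<^sub>1 \<dots> t\<^bsup>e\<^sub>n\<^esup> h\<^sub>n\<close> is a path with \<open>n\<close>
  edges. The first syllable \<open>h\<^sub>0\<close> is determined by the element up to the finite associated subgroups
  (Britton's lemma, \<open>nf_elem\<close>, which follows from an action of the words on normal forms).

  The compression of \<open>G\<close> is at most that of \<open>H\<close>, because taking the first syllable shows that \<open>H\<close> is
  undistorted in \<open>G\<close> (\<open>base_undistorted\<close>), so that equivariant maps can be restricted.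

  If the associated subgroups are proper, the compression of \<open>G\<close> is at most one half. A symmetric random
  walk on \<open>G\<close> whose four steps leave \<open>H\<close> through different edges of the tree has positive speed,
  whereas the mean squared displacement of a symmetric random walk under a left-invariant map into a
  Hilbert space at most doubles when the time is doubled (\<open>displacement_doubling\<close>). A map with exponent \<open>\<epsilon>\<close>
  therefore forces \<open>(2 ^ k) powr (2 * \<epsilon>)\<close> to be of the order of \<open>2 ^ k\<close> at most.

  Conversely, let \<open>f\<close> be an equivariant map on \<open>H\<close> with exponent \<open>\<epsilon>\<close>. The two associated subgroups
  generate a finite group \<open>K\<close>; averaging over it makes \<open>f\<close> constant on the left cosets of \<open>K\<close>
  (\<open>equivariant_average\<close>). Then \<open>f h\<^sub>0\<close> and the first edge depend only on the element, which gives a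
  map on \<open>G\<close> with \<open>H\<close>-invariant distances. Inducing it from \<open>H\<close> to \<open>G\<close> (\<open>induced_left_invariant\<close>)
  produces a left-invariant map \<open>B\<close> for which the squared displacement of the word above is at least
  \<open>n\<close> plus the sum of the squared displacements of the syllables \<open>h\<^sub>i\<close> under \<open>f\<close>
  (\<open>induced_displacement\<close>). The word length is at most of the order of \<open>n\<close> plus the sum of the lengths
  of the \<open>h\<^sub>i\<close>, and \<open>s powr (2 * \<epsilon>)\<close> is subadditive in \<open>s\<close> if \<open>2 * \<epsilon> \<le> 1\<close>, so \<open>B\<close> has exponent
  \<open>\<epsilon>\<close>.

  If \<open>F = H\<close>, then \<open>H\<close> is finite, all stable letters of a reduced word have the same exponent, and the
  exponent sum is an equivariant map to the real line with compression \<open>1\<close>.\<close>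


section \<open>Word lengths\<close>

context
  fixes G :: "('a, 'b) monoid_scheme" (structure) and S :: "'a set"
  assumes G: "group G" and S: "finite_symmetric_generating_set G S"
begin

interpretation group G by (rule G)

lemma generators_closed: "S \<subseteq> carrier G"
  using S by (simp add: finite_symmetric_generating_set_def)

lemma word_prod_append_closed:
  assumes "u \<in> lists S" "v \<in> lists S"
  shows "word_prod G u \<in> carrier G \<and>
    word_prod G (u @ v) = word_prod G u \<otimes> word_prod G v"
proof -
  have cl: "word_prod G w \<in> carrier G" if "w \<in> lists S" for w
    using that generators_closed by (induction w) (auto simp: word_prod_def)
  show ?thesis
    using assms(1)
  proof induction
    case Nil
    then show ?case using cl[OF assms(2)] by (simp add: word_prod_def)
  next
    case (Cons s u)
    then have "s \<in> carrier G" using generators_closed by auto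
    then show ?case using Cons cl[OF assms(2)] by (simp add: word_prod_def m_assoc)
  qed
qed

lemma word_prod_surj:
  assumes "x \<in> carrier G"
  obtains ws where "ws \<in> lists S" "word_prod G ws = x"
proof -
  have "x \<in> generate G S"
    using assms S by (simp add: finite_symmetric_generating_set_def)
  then have "\<exists>ws\<in>lists S. word_prod G ws = x"
  proof induction
    case one
    show ?case by (rule bexI[of _ "[]"]) (auto simp: word_prod_def)
  next
    case (incl h)
    then show ?case using generators_closed
      by (intro bexI[of _ "[h]"]) (auto simp: word_prod_def)
  next
    case (inv h)
    then have "inv h \<in> S" using S by (simp add: finite_symmetric_generating_set_def)
    then show ?case using generators_closed
      by (intro bexI[of _ "[inv h]"]) (auto simp: word_prod_def)
  next
    case (eng h1 h2)
    then obtain u v where "u \<in> lists S" "v \<in> lists S" "word_prod G u = h1" "word_prod G v = h2"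
      by blast
    then show ?case using word_prod_append_closed[of u v] by (intro bexI[of _ "u @ v"]) auto
  qed
  then show ?thesis using that by blast
qed

lemma word_length_le:
  assumes "ws \<in> lists S"
  shows "word_length G S (word_prod G ws) \<le> length ws"
  unfolding word_length_def by (rule Least_le) (use assms in blast)

lemma word_length_witness:
  assumes "x \<in> carrier G"
  obtains ws where "ws \<in> lists S" "length ws = word_length G S x" "word_prod G ws = x"
proof -
  obtain w where "w \<in> lists S" "word_prod G w = x" using word_prod_surj[OF assms] .
  then have "\<exists>ws\<in>lists S. length ws = length w \<and> word_prod G ws = x" by blast
  then have "\<exists>ws\<in>lists S. length ws = word_length G S x \<and> word_prod G ws = x"
    unfolding word_length_def by (rule LeastI)
  then show ?thesis using that by blast
qed

lemma word_length_one: "word_length G S \<one> = 0"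
  using word_length_le[of "[]"] by (simp add: word_prod_def)

lemma word_length_mult_le:
  assumes "x \<in> carrier G" "y \<in> carrier G"
  shows "word_length G S (x \<otimes> y) \<le> word_length G S x + word_length G S y"
proof -
  obtain u where u: "u \<in> lists S" "length u = word_length G S x" "word_prod G u = x"
    using word_length_witness[OF assms(1)] .
  obtain v where v: "v \<in> lists S" "length v = word_length G S y" "word_prod G v = y"
    using word_length_witness[OF assms(2)] .
  show ?thesis
    using word_length_le[of "u @ v"] word_prod_append_closed[OF u(1) v(1)] u v by auto
qed

text \<open>For a finite generating set the bounds for its elements have a common upper bound, which each
  letter of a word contributes at most once. This compares the number of stable letters and the length
  of the first syllable of an element of an HNN extension with its word length.\<close>

lemma word_length_dominates:
  fixes L :: "'a \<Rightarrow> real"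
  assumes "\<And>x. x \<in> carrier G \<Longrightarrow> \<exists>C. \<forall>y\<in>carrier G. L (y \<otimes> x) \<le> L y + C"
  obtains C where "C > 0" "\<And>x. x \<in> carrier G \<Longrightarrow> L x \<le> L \<one> + C * real (word_length G S x)"
proof -
  have "\<forall>x\<in>S. \<exists>C. \<forall>y\<in>carrier G. L (y \<otimes> x) \<le> L y + C"
    using assms generators_closed by blast
  then obtain c where c: "\<And>x y. x \<in> S \<Longrightarrow> y \<in> carrier G \<Longrightarrow> L (y \<otimes> x) \<le> L y + c x"
    unfolding bchoice_iff by blast
  define C where "C = 1 + (\<Sum>x\<in>S. \<bar>c x\<bar>)"
  have fin: "finite S" using S by (simp add: finite_symmetric_generating_set_def)
  have C0: "C > 0" unfolding C_def by (simp add: add_pos_nonneg sum_nonneg)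
  have cC: "c x \<le> C" if "x \<in> S" for x
    using member_le_sum[of x S "\<lambda>x. \<bar>c x\<bar>"] that fin unfolding C_def by auto
  have *: "L (word_prod G ws) \<le> L \<one> + C * real (length ws)" if "ws \<in> lists S" for ws
    using that
  proof (induction ws rule: rev_induct)
    case Nil
    show ?case by (simp add: word_prod_def)
  next
    case (snoc s ws)
    then have s: "s \<in> S" "s \<in> carrier G" and ws: "ws \<in> lists S" using generators_closed by auto
    have eq: "word_prod G (ws @ [s]) = word_prod G ws \<otimes> s"
      using word_prod_append_closed[of ws "[s]"] ws s by (simp add: word_prod_def)
    have "L (word_prod G (ws @ [s])) \<le> L (word_prod G ws) + c s"
      unfolding eq using c[OF s(1)] word_prod_append_closed[of ws "[]"] ws by auto
    then show ?case using snoc.IH[OF ws] cC[OF s(1)] by (simp add: algebra_simps)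
  qed
  show ?thesis
  proof (rule that[OF C0])
    fix x assume "x \<in> carrier G"
    then obtain ws where "ws \<in> lists S" "length ws = word_length G S x" "word_prod G ws = x"
      using word_length_witness by blast
    then show "L x \<le> L \<one> + C * real (word_length G S x)" using *[of ws] by simp
  qed
qed

end


section \<open>Maps with left-invariant distances\<close>

text \<open>Everything that the compression sees of an equivariant map are the distances between its
  values; these are invariant under left translation, and conversely this invariance makes a map
  equivariant up to a translation.\<close>

definition left_invariant :: "('a, 'b) monoid_scheme \<Rightarrow> ('a \<Rightarrow> 'h::real_normed_vector) \<Rightarrow> bool" where
  "left_invariant G f \<longleftrightarrow> (\<forall>g\<in>carrier G. \<forall>x\<in>carrier G. \<forall>y\<in>carrier G.
     norm (f (g \<otimes>\<^bsub>G\<^esub> x) - f (g \<otimes>\<^bsub>G\<^esub> y)) = norm (f x - f y))"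

lemma left_invariantD:
  "left_invariant G f \<Longrightarrow> g \<in> carrier G \<Longrightarrow> x \<in> carrier G \<Longrightarrow> y \<in> carrier G \<Longrightarrow>
     norm (f (g \<otimes>\<^bsub>G\<^esub> x) - f (g \<otimes>\<^bsub>G\<^esub> y)) = norm (f x - f y)"
  by (simp add: left_invariant_def)

lemma equivariant_imp_left_invariant:
  assumes "equivariant G f"
  shows "left_invariant G f"
proof -
  obtain \<pi> b where "affine_isometric_action G \<pi> b"
    and eq: "\<And>x y. x \<in> carrier G \<Longrightarrow> y \<in> carrier G \<Longrightarrow> f (x \<otimes>\<^bsub>G\<^esub> y) = \<pi> x (f y) + b x"
    using assms by (auto simp: equivariant_def)
  then have ot: "orthogonal_transformation (\<pi> x)" if "x \<in> carrier G" for x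
    using that by (auto simp: affine_isometric_action_def hom_def orthogonal_group_def)
  show ?thesis
    unfolding left_invariant_def
  proof (intro ballI)
    fix g x y assume g: "g \<in> carrier G" and x: "x \<in> carrier G" and y: "y \<in> carrier G"
    have "f (g \<otimes>\<^bsub>G\<^esub> x) - f (g \<otimes>\<^bsub>G\<^esub> y) = \<pi> g (f x - f y)"
      using eq[OF g x] eq[OF g y] orthogonal_transformation_linear[OF ot[OF g]]
      by (simp add: linear_diff)
    then show "norm (f (g \<otimes>\<^bsub>G\<^esub> x) - f (g \<otimes>\<^bsub>G\<^esub> y)) = norm (f x - f y)"
      using ot[OF g] by (simp add: orthogonal_transformation)
  qed
qed

lemma left_invariant_from_one:
  assumes "group G" "left_invariant G f" "x \<in> carrier G" "y \<in> carrier G"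
  shows "norm (f x - f y) = norm (f (inv\<^bsub>G\<^esub> x \<otimes>\<^bsub>G\<^esub> y) - f \<one>\<^bsub>G\<^esub>)"
proof -
  interpret group G by fact
  show ?thesis
    using left_invariantD[OF assms(2), of "inv\<^bsub>G\<^esub> x" x y] assms
    by (simp add: norm_minus_commute)
qed

text \<open>The Gram-Schmidt process only uses inner products, so it commutes with any isometry between
  two families, even one that is not yet known to extend to the ambient space.\<close>

lemma gram_schmidt_cong:
  fixes c c' :: "nat \<Rightarrow> 'h::real_inner"
  assumes gram: "\<And>i j. c i \<bullet> c j = c' i \<bullet> c' j"
  shows "gram_schmidt c i \<bullet> c j = gram_schmidt c' i \<bullet> c' j"
    and "gram_schmidt c i = 0 \<longleftrightarrow> gram_schmidt c' i = 0"
proof -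
  define w where "w c i = c i - (\<Sum>k<i. (c i \<bullet> gram_schmidt c k) *\<^sub>R gram_schmidt c k)"
    for c :: "nat \<Rightarrow> 'h" and i
  have g: "gram_schmidt c i = sgn (w c i)" for c :: "nat \<Rightarrow> 'h" and i
    unfolding w_def by (rule gram_schmidt.simps)
  have wg: "w c i \<bullet> gram_schmidt c k = 0" if "k < i" for c :: "nat \<Rightarrow> 'h" and i k
  proof -
    have "w c i = norm (w c i) *\<^sub>R gram_schmidt c i"
      by (cases "w c i = 0") (simp_all add: g sgn_div_norm)
    then show ?thesis using gram_schmidt_orth[of k i c] that
      by (metis inner_commute inner_scaleR_left less_irrefl mult_zero_right)
  qed
  have wc: "w c i \<bullet> c j = c i \<bullet> c j - (\<Sum>k<i. (gram_schmidt c k \<bullet> c i) * (gram_schmidt c k \<bullet> c j))"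
    for c :: "nat \<Rightarrow> 'h" and i j
    unfolding w_def inner_diff_left inner_sum_left inner_scaleR_left by (simp add: inner_commute)
  have nw: "norm (w c i) = sqrt (w c i \<bullet> c i)" for c :: "nat \<Rightarrow> 'h" and i
  proof -
    have "w c i \<bullet> w c i = w c i \<bullet> c i"
      by (subst (2) w_def) (simp add: inner_diff_right inner_sum_right wg)
    then show ?thesis by (simp add: norm_eq_sqrt_inner)
  qed
  have main: "w c i \<bullet> c j = w c' i \<bullet> c' j \<and> gram_schmidt c i \<bullet> c j = gram_schmidt c' i \<bullet> c' j" for j
  proof (induction i arbitrary: j rule: less_induct)
    case (less i)
    have 1: "w c i \<bullet> c j = w c' i \<bullet> c' j" for j
      unfolding wc using less gram by simp
    then show ?case by (simp add: g sgn_div_norm nw)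
  qed
  then show "gram_schmidt c i \<bullet> c j = gram_schmidt c' i \<bullet> c' j" by blast
  have "norm (w c i) = norm (w c' i)" unfolding nw using main by simp
  then show "gram_schmidt c i = 0 \<longleftrightarrow> gram_schmidt c' i = 0"
    unfolding g sgn_zero_iff by (metis norm_eq_zero)
qed

text \<open>The linear isometry determined by a left translation is defined on the closed span of the
  values \<open>c x = f x - f 1\<close>. The Gram-Schmidt bases \<open>e\<close> of \<open>x \<mapsto> c x\<close> and \<open>e' g\<close> of the translated
  family \<open>x \<mapsto> f (g x) - f g\<close> have the same Gram matrix, so that isometry \<open>U g\<close> carries \<open>e n\<close> to
  \<open>e' g n\<close>; it is extended by the identity on the orthogonal complement.\<close>

theorem left_invariant_imp_equivariant:
  fixes G (structure) and f :: "'a \<Rightarrow> 'h::{real_inner, banach}"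
  assumes "group G" and count: "countable (carrier G)" and inv: "left_invariant G f"
  shows "equivariant G (\<lambda>x. f x - f \<one>)"
proof -
  interpret group G by fact
  define en where "en = from_nat_into (carrier G)"
  have en: "range en = carrier G"
    unfolding en_def using count by (intro range_from_nat_into) auto
  have enG: "en n \<in> carrier G" for n using en by blast
  define c where "c g x = f (g \<otimes> x) - f g" for g x
  have c_one: "c \<one> x = f x - f \<one>" if "x \<in> carrier G" for x
    using that by (simp add: c_def)
  have c_diff: "c g x - c g y = f (g \<otimes> x) - f (g \<otimes> y)" for g x y
    by (simp add: c_def)
  have c_mult: "c g (h \<otimes> x) - c g h = c (g \<otimes> h) x"
    if "g \<in> carrier G" "h \<in> carrier G" "x \<in> carrier G" for g h x
    using that by (simp add: c_def m_assoc)
  have nc: "norm (c g x) = norm (c \<one> x)" if "g \<in> carrier G" "x \<in> carrier G" for g x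
    using left_invariantD[OF inv that(1,2) one_closed] that by (simp add: c_def)
  have ncd: "norm (c g x - c g y) = norm (c \<one> x - c \<one> y)"
    if "g \<in> carrier G" "x \<in> carrier G" "y \<in> carrier G" for g x y
    using left_invariantD[OF inv that] that unfolding c_diff by simp
  have gram: "c g x \<bullet> c g y = c \<one> x \<bullet> c \<one> y"
    if "g \<in> carrier G" "x \<in> carrier G" "y \<in> carrier G" for g x y
    using nc[OF that(1,2)] nc[OF that(1,3)] ncd[OF that] by (simp only: dot_norm_neg)
  define e where "e g = gram_schmidt (\<lambda>n. c g (en n))" for g
  define e1 where "e1 = e \<one>"
  have orth: "i \<noteq> j \<Longrightarrow> e g i \<bullet> e g j = 0" and nrm: "e g i = 0 \<or> norm (e g i) = 1" for g i j
    unfolding e_def by (rule gram_schmidt_orth gram_schmidt_norm; assumption?)+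
  have orth1: "i \<noteq> j \<Longrightarrow> e1 i \<bullet> e1 j = 0" and nrm1: "e1 i = 0 \<or> norm (e1 i) = 1" for i j
    unfolding e1_def using orth nrm by blast+
  have e_zero: "e g i = 0 \<longleftrightarrow> e1 i = 0" if "g \<in> carrier G" for g i
    unfolding e_def e1_def by (rule gram_schmidt_cong(2)) (rule gram[OF that enG enG])
  have coord_eq: "c g x \<bullet> e g i = c \<one> x \<bullet> e1 i"
    if g: "g \<in> carrier G" and x: "x \<in> carrier G" for g x i
  proof -
    obtain n where "x = en n" using en x by blast
    then show ?thesis
      unfolding e_def e1_def inner_commute[of "c _ _"]
      using gram_schmidt_cong(1)[of "\<lambda>n. c g (en n)" "\<lambda>n. c \<one> (en n)" i n]
        gram[OF g enG enG] by simp
  qed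
  have c_span: "c g x \<in> closed_span (e g)" if x: "x \<in> carrier G" for g x
  proof -
    obtain n where "x = en n" using en x by blast
    then have "c g x \<in> span (range (e g))"
      using gram_schmidt_span(1)[of "\<lambda>n. c g (en n)" n] by (simp add: e_def)
    then show ?thesis using span_subset[where e = "e g", OF orth nrm] by (rule subsetD[rotated])
  qed
  have e_span: "e1 n \<in> span (c \<one> ` carrier G)" for n
  proof -
    have "range (\<lambda>n. c \<one> (en n)) = c \<one> ` carrier G" using en by (metis image_image)
    then show ?thesis
      using gram_schmidt_span(2)[of "\<lambda>n. c \<one> (en n)" n] by (simp add: e_def e1_def)
  qed
  note lin_c = linear_coeffs[where e = e1, OF orth1 nrm1]
  note lin_s = linear_synth[OF orth nrm] and lin_s1 = linear_synth[where e = e1, OF orth1 nrm1]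
  note sub = subspace_closed_span[where e = e1, OF orth1 nrm1]
  define P where "P v = synth e1 (coeffs e1 v)" for v
  define U where "U g v = synth (e g) (coeffs e1 v)" for g v
  have lin_P: "linear P" unfolding P_def
    using linear_compose[OF lin_c lin_s1] by (simp add: comp_def)
  have lin_U: "linear (U g)" for g unfolding U_def
    using linear_compose[OF lin_c lin_s] by (simp add: comp_def)
  have Pin: "P v \<in> closed_span e1" for v
    unfolding P_def by (rule synth_in[where e = e1, OF orth1 nrm1])
  have P_id: "P v = v" if "v \<in> closed_span e1" for v
    unfolding P_def by (rule closed_spanD[where e = e1, OF orth1 nrm1 that])
  have coeffs_P: "coeffs e1 (P v) = coeffs e1 v" for v
    by (rule ell2_eqI)
       (simp add: P_def coord_coeffs[where e = e1, OF orth1 nrm1]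
         inner_synth_e[where e = e1, OF orth1 nrm1] e_self[where e = e1, OF orth1 nrm1])
  have P_orth: "u \<bullet> (v - P v) = 0" if "u \<in> closed_span e1" for u v
  proof -
    have "u \<bullet> (v - P v) = coeffs e1 u \<bullet> coeffs e1 (v - P v)"
      using inner_coeffs[where e = e1, OF orth1 nrm1 that] by simp
    also have "\<dots> = 0" using lin_c coeffs_P by (simp add: linear_diff)
    finally show ?thesis .
  qed
  have U_c: "U g (c \<one> x) = c g x" if "g \<in> carrier G" "x \<in> carrier G" for g x
  proof -
    have "coeffs e1 (c \<one> x) = coeffs (e g) (c g x)"
      by (rule ell2_eqI)
        (simp add: coord_coeffs[where e = e1, OF orth1 nrm1] coord_coeffs[where e = "e g", OF orth nrm] coord_eq that)
    then show ?thesis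
      using closed_spanD[where e = "e g", OF orth nrm c_span[OF that(2)]] by (simp add: U_def)
  qed
  have U_P: "U g (P v) = U g v" for g v
    by (simp add: U_def coeffs_P)
  have U_norm: "norm (U g v) = norm (P v)" if "g \<in> carrier G" for g v
  proof -
    have "coeffs (e g) (U g v) = coeffs e1 v"
      by (rule ell2_eqI)
         (simp add: U_def coord_coeffs[where e = "e g", OF orth nrm] coord_coeffs[where e = e1, OF orth1 nrm1]
           inner_synth_e[where e = "e g", OF orth nrm] e_self[where e = "e g", OF orth nrm] e_zero that)
    moreover have "norm (coeffs (e g) (U g v)) = norm (U g v)"
      unfolding U_def
      by (rule norm_coeffs[where e = "e g", OF orth nrm synth_in[where e = "e g", OF orth nrm]])
    moreover have "norm (coeffs e1 (P v)) = norm (P v)"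
      by (rule norm_coeffs[where e = e1, OF orth1 nrm1 Pin])
    ultimately show ?thesis by (simp add: coeffs_P)
  qed
  have bl_U: "bounded_linear (U g)" for g
    unfolding U_def
    by (rule bounded_linear_compose[OF bounded_linear_synth[OF orth nrm]
          bounded_linear_coeffs[where e = e1, OF orth1 nrm1]])
  \<comment> \<open>Bounded linear maps are determined on the closed span by their values at the \<open>c x\<close>.\<close>
  have agree: "A v = B v" if A: "bounded_linear A" and B: "bounded_linear B"
      and AB: "\<And>x. x \<in> carrier G \<Longrightarrow> A (c \<one> x) = B (c \<one> x)" and v: "v \<in> closed_span e1"
    for A B :: "'h \<Rightarrow> 'h" and v
  proof -
    have AB_e: "A (e1 n) = B (e1 n)" for n
    proof (rule linear_eq_on_span[OF bounded_linear.linear[OF A] bounded_linear.linear[OF B] _ e_span])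
      fix w assume "w \<in> c \<one> ` carrier G" then show "A w = B w" using AB by blast
    qed
    have expand: "T (synth e1 a) = (\<Sum>n. coord a n *\<^sub>R T (e1 n))" if "bounded_linear T"
      for T :: "'h \<Rightarrow> 'h" and a
      using bounded_linear.suminf[OF that summable_synth[where e = e1, OF orth1 nrm1], of a]
        bounded_linear.linear[OF that]
      by (simp add: synth_def[where e = e1, OF orth1 nrm1] linear_scale)
    show ?thesis
      using expand[OF A, of "coeffs e1 v"] expand[OF B, of "coeffs e1 v"] AB_e
        P_id[OF v] by (simp add: P_def)
  qed
  have c1_in: "c \<one> x \<in> closed_span e1" if "x \<in> carrier G" for x
    using c_span[OF that] by (simp add: e1_def)
  have bl_P: "bounded_linear P"
    unfolding P_def
    by (rule bounded_linear_compose[OF bounded_linear_synth[where e = e1, OF orth1 nrm1]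
          bounded_linear_coeffs[where e = e1, OF orth1 nrm1]])
  have cg_in: "c g x \<in> closed_span e1" if "g \<in> carrier G" "x \<in> carrier G" for g x
    using subspace_diff[OF sub c1_in[of "g \<otimes> x"] c1_in[of g]] c_mult[of "\<one>" g x] that by simp
  have U_in: "P (U g v) = U g v" if g: "g \<in> carrier G" for g v
  proof -
    have "P (U g (P v)) = U g (P v)"
      by (rule agree[OF bounded_linear_compose[OF bl_P bl_U] bl_U _ Pin])
         (simp add: U_c g P_id cg_in)
    then show ?thesis by (simp add: U_P)
  qed
  have U_mult: "U g (U h v) = U (g \<otimes> h) v" if g: "g \<in> carrier G" and h: "h \<in> carrier G" for g h v
  proof -
    have "U g (U h (P v)) = U (g \<otimes> h) (P v)"
    proof (rule agree[OF bounded_linear_compose[OF bl_U bl_U] bl_U _ Pin])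
      fix x assume x: "x \<in> carrier G"
      have "c h x = c \<one> (h \<otimes> x) - c \<one> h" using c_mult[of "\<one>" h x] h x by simp
      then have "U g (c h x) = c g (h \<otimes> x) - c g h"
        using g h x by (simp only: linear_diff[OF lin_U] U_c m_closed)
      then show "U g (U h (c \<one> x)) = U (g \<otimes> h) (c \<one> x)"
        using g h x by (simp add: U_c c_mult)
    qed
    then show ?thesis by (simp add: U_P)
  qed
  have U_one: "U \<one> v = P v" for v
    by (simp add: U_def P_def e1_def)
  define \<pi> where "\<pi> g v = U g v + (v - P v)" for g v
  have \<pi>_mult: "\<pi> g (\<pi> h v) = \<pi> (g \<otimes> h) v" if "g \<in> carrier G" "h \<in> carrier G" for g h v
  proof -
    have "U g (v - P v) = 0" "P (v - P v) = 0"
      using P_id[OF Pin] by (simp_all add: linear_diff[OF lin_U] linear_diff[OF lin_P] U_P)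
    then show ?thesis
      by (simp add: \<pi>_def linear_add[OF lin_U] linear_add[OF lin_P] U_mult U_in that)
  qed
  have \<pi>_one: "\<pi> \<one> v = v" for v by (simp add: \<pi>_def U_one)
  have ot: "orthogonal_transformation (\<pi> g)" if g: "g \<in> carrier G" for g
    unfolding orthogonal_transformation
  proof
    show "linear (\<pi> g)"
      unfolding \<pi>_def using lin_U lin_P
      by (intro linearI) (simp_all add: linear_add linear_scale scaleR_diff_right scaleR_add_right)
    show "\<forall>v. norm (\<pi> g v) = norm v"
    proof
      fix v
      have "orthogonal (U g v) (v - P v)"
        unfolding orthogonal_def using P_orth[of "U g v" v] Pin[of "U g v"] U_in[OF g] by simp
      then have "(norm (\<pi> g v))\<^sup>2 = (norm (P v))\<^sup>2 + (norm (v - P v))\<^sup>2"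
        by (simp add: \<pi>_def norm_add_Pythagorean U_norm g)
      also have "\<dots> = (norm (P v + (v - P v)))\<^sup>2"
        by (rule norm_add_Pythagorean[symmetric]) (simp add: orthogonal_def P_orth Pin)
      finally show "norm (\<pi> g v) = norm v" by simp
    qed
  qed
  have "surj (\<pi> g)" if g: "g \<in> carrier G" for g
    using \<pi>_mult[OF g inv_closed[OF g]] g
    by (intro surjI[of _ "\<pi> (inv g)"]) (simp add: \<pi>_one)
  then have hom: "\<pi> \<in> hom G orthogonal_group"
    using ot \<pi>_mult by (auto simp: hom_def orthogonal_group_def fun_eq_iff)
  have aff: "c \<one> (x \<otimes> y) = \<pi> x (c \<one> y) + c \<one> x"
    if "x \<in> carrier G" "y \<in> carrier G" for x y
    using c_mult[of "\<one>" x y] that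
    by (simp add: \<pi>_def U_c P_id c1_in algebra_simps)
  show ?thesis
    unfolding equivariant_def affine_isometric_action_def
    using hom aff by (intro exI[of _ \<pi>] exI[of _ "\<lambda>x. f x - f \<one>"]) (simp add: c_one)
qed

section \<open>Compression exponents\<close>

definition compression_exponent ::
  "('a, 'b) monoid_scheme \<Rightarrow> 'a set \<Rightarrow> ('a \<Rightarrow> 'h::real_normed_vector) \<Rightarrow> real \<Rightarrow> bool" where
  "compression_exponent G S f \<epsilon> \<longleftrightarrow> (\<exists>C>0. \<exists>D\<ge>0. \<forall>x\<in>carrier G. \<forall>y\<in>carrier G.
     norm (f x - f y) \<ge> (1 / C) * word_dist G S x y powr \<epsilon> - D)"

lemma compression_eq_Sup: "compression G S f = Sup {\<epsilon>\<in>{0..1}. compression_exponent G S f \<epsilon>}"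
  by (simp add: compression_def compression_exponent_def)

lemma compression_exponent_mono:
  assumes "compression_exponent G S f \<epsilon>" "\<epsilon>' \<le> \<epsilon>"
  shows "compression_exponent G S f \<epsilon>'"
proof -
  obtain C D where CD: "C > 0" "D \<ge> 0" and le: "\<And>x y. x \<in> carrier G \<Longrightarrow> y \<in> carrier G \<Longrightarrow>
      norm (f x - f y) \<ge> (1 / C) * word_dist G S x y powr \<epsilon> - D"
    using assms(1) unfolding compression_exponent_def by blast
  have "word_dist G S x y powr \<epsilon>' \<le> word_dist G S x y powr \<epsilon>" for x y
    using assms(2) by (cases "word_length G S (inv\<^bsub>G\<^esub> x \<otimes>\<^bsub>G\<^esub> y) = 0")
      (auto simp: word_dist_def intro!: powr_mono)
  then have "(1 / C) * word_dist G S x y powr \<epsilon>' \<le> (1 / C) * word_dist G S x y powr \<epsilon>" for x y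
    using CD(1) by (intro mult_left_mono) auto
  then have "norm (f x - f y) \<ge> (1 / C) * word_dist G S x y powr \<epsilon>' - D"
    if "x \<in> carrier G" "y \<in> carrier G" for x y
    using le[OF that] by (meson diff_right_mono order_trans)
  then show ?thesis unfolding compression_exponent_def using CD by blast
qed

lemma compression_exponent_le_compression:
  assumes "compression_exponent G S f \<epsilon>" "0 \<le> \<epsilon>" "\<epsilon> \<le> 1"
  shows "\<epsilon> \<le> compression G S f"
  unfolding compression_eq_Sup
  by (rule cSup_upper) (use assms in \<open>auto intro!: bdd_aboveI[of _ 1]\<close>)

lemma compression_exponent_below_compression:
  assumes "0 \<le> \<epsilon>" "\<epsilon> < compression G S f"
  shows "compression_exponent G S f \<epsilon>"
proof -
  let ?E = "{\<epsilon>\<in>{0..1}. compression_exponent G S f \<epsilon>}"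
  have "1 / 1 * word_dist G S x y powr 0 - 1 \<le> norm (f x - f y)" for x y
    by (rule order_trans[of _ 0]) (auto simp: powr_def)
  then have "compression_exponent G S f 0"
    unfolding compression_exponent_def by (intro exI[of _ "1::real"] conjI ballI) auto
  then have "?E \<noteq> {}" by (intro ex_in_conv[THEN iffD1] exI[of _ 0]) simp
  moreover have "bdd_above ?E" by (rule bdd_aboveI[of _ 1]) auto
  ultimately obtain \<epsilon>' where "\<epsilon>' \<in> ?E" "\<epsilon> < \<epsilon>'"
    using assms(2) unfolding compression_eq_Sup by (auto simp: less_cSup_iff)
  then show ?thesis using compression_exponent_mono[of G S f \<epsilon>' \<epsilon>] by auto
qed

lemma compression_le_compression:
  assumes "\<And>\<epsilon>. 0 \<le> \<epsilon> \<Longrightarrow> \<epsilon> \<le> 1 \<Longrightarrow> compression_exponent G S f \<epsilon> \<Longrightarrow> compression_exponent H T g \<epsilon>"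
  shows "compression G S f \<le> compression H T g"
proof (rule ccontr)
  assume "\<not> ?thesis"
  then obtain \<epsilon> where \<epsilon>: "compression H T g < \<epsilon>" "\<epsilon> < compression G S f"
    using dense[of "compression H T g" "compression G S f"] by auto
  have 0: "0 \<le> \<epsilon>" "\<epsilon> \<le> 1"
    using \<epsilon> compression_bounds(1)[of H T g] compression_bounds(2)[of G S f] by auto
  have "\<epsilon> \<le> compression H T g"
    using compression_exponent_below_compression[OF 0(1) \<epsilon>(2)] assms 0
    by (intro compression_exponent_le_compression) auto
  then show False using \<epsilon> by simp
qed

lemma equivariant_compression_least:
  fixes G :: "('a, 'b) monoid_scheme"
  assumes "\<And>f :: 'a \<Rightarrow> ell2. equivariant G f \<Longrightarrow> lipschitz_uniform_embedding G S f \<Longrightarrow>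
      compression G S f \<le> c" and "0 \<le> c"
  shows "equivariant_compression G S \<le> c"
  unfolding equivariant_compression_def Let_def
  by (split if_split) (use assms in \<open>auto intro!: cSup_least\<close>)

lemma equivariant_compression_bounds:
  fixes G :: "('a, 'b) monoid_scheme"
  shows "0 \<le> equivariant_compression G S" "equivariant_compression G S \<le> 1"
proof -
  let ?R = "{compression G S f | f :: 'a \<Rightarrow> ell2. equivariant G f \<and> lipschitz_uniform_embedding G S f}"
  have bdd: "bdd_above ?R" by (rule bdd_aboveI[of _ 1]) (auto simp: compression_bounds)
  have "0 \<le> Sup ?R" if "x \<in> ?R" for x
  proof -
    have "0 \<le> x" using that compression_bounds(1) by blast
    then show ?thesis using cSup_upper[OF that bdd] by (rule order_trans)
  qed
  then show "0 \<le> equivariant_compression G S"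
    unfolding equivariant_compression_def Let_def by auto
  show "equivariant_compression G S \<le> 1"
    by (rule equivariant_compression_least) (auto simp: compression_bounds)
qed

lemma exponent_below_equivariant_compression:
  fixes G :: "('a, 'b) monoid_scheme"
  assumes "0 \<le> \<epsilon>" "\<epsilon> < equivariant_compression G S"
  obtains f :: "'a \<Rightarrow> ell2"
  where "equivariant G f" "lipschitz_uniform_embedding G S f" "compression_exponent G S f \<epsilon>"
proof -
  have "\<not> (\<forall>f :: 'a \<Rightarrow> ell2. equivariant G f \<longrightarrow> lipschitz_uniform_embedding G S f \<longrightarrow>
      compression G S f \<le> \<epsilon>)"
    using equivariant_compression_least[of G S \<epsilon>] assms by force
  then obtain f :: "'a \<Rightarrow> ell2" where f: "equivariant G f" "lipschitz_uniform_embedding G S f"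
    "\<epsilon> < compression G S f"
    by (auto simp: not_le)
  then show ?thesis
    using that compression_exponent_below_compression[OF assms(1) f(3)] by blast
qed

lemma left_invariant_lipschitz:
  assumes "group G" and S: "finite_symmetric_generating_set G S" and f: "left_invariant G f"
  obtains C where "C > 0"
    "\<And>x y. x \<in> carrier G \<Longrightarrow> y \<in> carrier G \<Longrightarrow> norm (f x - f y) \<le> C * word_dist G S x y"
proof -
  interpret group G by fact
  have "\<exists>C. \<forall>y\<in>carrier G. norm (f (y \<otimes>\<^bsub>G\<^esub> x) - f \<one>\<^bsub>G\<^esub>) \<le> norm (f y - f \<one>\<^bsub>G\<^esub>) + C"
    if x: "x \<in> carrier G" for x
  proof (intro exI ballI)
    fix y assume y: "y \<in> carrier G"
    have "norm (f (y \<otimes>\<^bsub>G\<^esub> x) - f y) = norm (f x - f \<one>\<^bsub>G\<^esub>)"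
      using left_invariantD[OF f y x one_closed] y by simp
    then show "norm (f (y \<otimes>\<^bsub>G\<^esub> x) - f \<one>\<^bsub>G\<^esub>) \<le> norm (f y - f \<one>\<^bsub>G\<^esub>) + norm (f x - f \<one>\<^bsub>G\<^esub>)"
      using norm_triangle_ineq[of "f (y \<otimes>\<^bsub>G\<^esub> x) - f y" "f y - f \<one>\<^bsub>G\<^esub>"] by simp
  qed
  from word_length_dominates[OF \<open>group G\<close> S this]
  obtain C where C: "C > 0" "\<And>x. x \<in> carrier G \<Longrightarrow>
      norm (f x - f \<one>\<^bsub>G\<^esub>) \<le> norm (f \<one>\<^bsub>G\<^esub> - f \<one>\<^bsub>G\<^esub>) + C * real (word_length G S x)"
    by blast
  show ?thesis
  proof (rule that[OF C(1)])
    fix x y assume x: "x \<in> carrier G" and y: "y \<in> carrier G"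
    show "norm (f x - f y) \<le> C * word_dist G S x y"
      unfolding left_invariant_from_one[OF \<open>group G\<close> f x y] word_dist_def
      using C(2)[of "inv\<^bsub>G\<^esub> x \<otimes>\<^bsub>G\<^esub> y"] x y by simp
  qed
qed

text \<open>Squared norms add up over orthogonal summands, which makes this form of the exponent condition,
  with a single constant, the convenient one for maps assembled from orthogonal pieces.\<close>

lemma compression_exponent_squared:
  assumes "group G" and f: "left_invariant G f"
  shows "compression_exponent G S f \<epsilon> \<longleftrightarrow> (\<exists>A>0. \<forall>x\<in>carrier G.
    real (word_length G S x) powr (2 * \<epsilon>) \<le> A * ((norm (f x - f \<one>\<^bsub>G\<^esub>))\<^sup>2 + 1))"
    (is "_ \<longleftrightarrow> (\<exists>A>0. \<forall>x\<in>carrier G. real (?l x) powr _ \<le> A * ((?n x)\<^sup>2 + 1))")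
proof -
  interpret group G by fact
  have sq: "(real (?l x) powr \<epsilon>)\<^sup>2 = real (?l x) powr (2 * \<epsilon>)" for x
    by (cases "?l x = 0") (simp_all add: power2_eq_square flip: powr_add)
  show ?thesis
  proof
    assume "compression_exponent G S f \<epsilon>"
    then obtain B D where BD: "B > 0" "D \<ge> 0" and low: "\<And>x y. x \<in> carrier G \<Longrightarrow> y \<in> carrier G \<Longrightarrow>
        norm (f x - f y) \<ge> (1 / B) * word_dist G S x y powr \<epsilon> - D"
      unfolding compression_exponent_def by blast
    have "real (?l x) powr (2 * \<epsilon>) \<le> (2 * B\<^sup>2 * (1 + D\<^sup>2)) * ((?n x)\<^sup>2 + 1)"
      if x: "x \<in> carrier G" for x
    proof -
      have "(1 / B) * real (?l x) powr \<epsilon> - D \<le> ?n x"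
        using low[OF one_closed x] x by (simp add: word_dist_def norm_minus_commute)
      then have "real (?l x) powr \<epsilon> \<le> B * (?n x + D)"
        using BD by (simp add: field_simps)
      then have "(real (?l x) powr \<epsilon>)\<^sup>2 \<le> (B * (?n x + D))\<^sup>2"
        by (intro power_mono) auto
      also have "\<dots> \<le> B\<^sup>2 * (2 * ((?n x)\<^sup>2 + D\<^sup>2))"
        unfolding power_mult_distrib using sum_squares_bound[of "?n x" D]
        by (intro mult_left_mono) (auto simp: power2_sum)
      also have "\<dots> \<le> B\<^sup>2 * (2 * ((1 + D\<^sup>2) * ((?n x)\<^sup>2 + 1)))"
        by (intro mult_left_mono) (auto simp: algebra_simps)
      finally show ?thesis unfolding sq by (simp add: mult_ac)
    qed
    moreover have "2 * B\<^sup>2 * (1 + D\<^sup>2) > 0" using BD by (simp add: add_pos_nonneg)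
    ultimately show "\<exists>A>0. \<forall>x\<in>carrier G. real (?l x) powr (2 * \<epsilon>) \<le> A * ((?n x)\<^sup>2 + 1)" by blast
  next
    assume "\<exists>A>0. \<forall>x\<in>carrier G. real (?l x) powr (2 * \<epsilon>) \<le> A * ((?n x)\<^sup>2 + 1)"
    then obtain A where A: "A > 0"
      "\<And>x. x \<in> carrier G \<Longrightarrow> real (?l x) powr (2 * \<epsilon>) \<le> A * ((?n x)\<^sup>2 + 1)" by blast
    have "(1 / sqrt A) * word_dist G S x y powr \<epsilon> - 1 \<le> norm (f x - f y)"
      if x: "x \<in> carrier G" and y: "y \<in> carrier G" for x y
    proof -
      define z where "z = inv\<^bsub>G\<^esub> x \<otimes>\<^bsub>G\<^esub> y"
      have z: "z \<in> carrier G" using x y by (simp add: z_def)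
      have "(?n z)\<^sup>2 + 1 \<le> (?n z + 1)\<^sup>2" by (simp add: power2_sum)
      then have "A * ((?n z)\<^sup>2 + 1) \<le> (sqrt A * (?n z + 1))\<^sup>2"
        using A(1) by (simp add: power_mult_distrib)
      then have "(real (?l z) powr \<epsilon>)\<^sup>2 \<le> (sqrt A * (?n z + 1))\<^sup>2"
        unfolding sq using A(2)[OF z] by simp
      then have "real (?l z) powr \<epsilon> \<le> sqrt A * (?n z + 1)"
        by (rule power2_le_imp_le) (use A(1) in simp)
      then show ?thesis
        using A(1) left_invariant_from_one[OF \<open>group G\<close> f x y]
        by (simp add: word_dist_def z_def field_simps)
    qed
    then show "compression_exponent G S f \<epsilon>"
      unfolding compression_exponent_def using A(1)
      by (intro exI[of _ "sqrt A"] conjI exI[of _ "1::real"] ballI) auto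
  qed
qed

text \<open>A lower bound by a positive power of the distance is by itself a lower control function, and the
  Lipschitz condition is automatic, so every left-invariant map of positive exponent competes in the
  supremum that defines the equivariant compression.\<close>

theorem exponent_le_equivariant_compression:
  fixes f :: "'a \<Rightarrow> 'h::{real_inner, banach}"
  assumes G: "group G" and S: "finite_symmetric_generating_set G S"
    and f: "left_invariant G f" and \<epsilon>: "0 < \<epsilon>" "\<epsilon> \<le> 1" and exp: "compression_exponent G S f \<epsilon>"
  shows "\<epsilon> \<le> equivariant_compression G S"
proof -
  define c where "c x = f x - f \<one>\<^bsub>G\<^esub>" for x
  have nc: "c x - c y = f x - f y" for x y by (simp add: c_def)
  have eq: "equivariant G c"
    unfolding c_def
    by (rule left_invariant_imp_equivariant[OF G countable_finitely_generated[OF G S] f])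
  obtain C D where CD: "C > 0" "D \<ge> 0" and le: "\<And>x y. x \<in> carrier G \<Longrightarrow> y \<in> carrier G \<Longrightarrow>
      norm (f x - f y) \<ge> (1 / C) * word_dist G S x y powr \<epsilon> - D"
    using exp unfolding compression_exponent_def by blast
  obtain L where L: "L > 0"
    "\<And>x y. x \<in> carrier G \<Longrightarrow> y \<in> carrier G \<Longrightarrow> norm (f x - f y) \<le> L * word_dist G S x y"
    using left_invariant_lipschitz[OF G S f] by blast
  define \<rho> where "\<rho> t = max 0 ((1 / C) * t powr \<epsilon> - D)" for t
  have "filterlim (\<lambda>t. (1 / C) * t powr \<epsilon> - D) at_top at_top"
    using CD \<epsilon> by real_asymp
  then have lim: "filterlim \<rho> at_top at_top"
    by (rule filterlim_at_top_mono) (auto simp: \<rho>_def)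
  have mono: "mono_on {0..} \<rho>"
  proof (rule mono_onI)
    fix s t :: real assume "s \<in> {0..}" "t \<in> {0..}" "s \<le> t"
    then have "(1 / C) * s powr \<epsilon> \<le> (1 / C) * t powr \<epsilon>"
      using CD \<epsilon> by (intro mult_left_mono powr_mono2) auto
    then show "\<rho> s \<le> \<rho> t" by (auto simp: \<rho>_def)
  qed
  have "uniform_embedding_with G S c \<rho> (\<lambda>t. L * t)"
    unfolding uniform_embedding_with_def nc
    using lim mono L le by (auto simp: \<rho>_def mono_on_def mult_left_mono)
  then have "lipschitz_uniform_embedding G S c"
    using L(1) unfolding lipschitz_uniform_embedding_def by blast
  then have "compression G S c \<le> equivariant_compression G S"
    by (rule compression_le_equivariant_compression[OF G S eq])
  moreover have "\<epsilon> \<le> compression G S c"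
    using exp \<epsilon> by (intro compression_exponent_le_compression)
      (auto simp: compression_exponent_def nc)
  ultimately show ?thesis by simp
qed


section \<open>Random walks and the bound one half\<close>

text \<open>Distribution of the random walk with step list \<open>us\<close> after \<open>2 ^ k\<close> steps, as a list with
  repetitions; only dyadic times are needed.\<close>

primrec dyadic_walk :: "('a, 'b) monoid_scheme \<Rightarrow> 'a list \<Rightarrow> nat \<Rightarrow> 'a list" where
  "dyadic_walk G us 0 = us"
| "dyadic_walk G us (Suc k) =
     concat (map (\<lambda>x. map (\<lambda>y. x \<otimes>\<^bsub>G\<^esub> y) (dyadic_walk G us k)) (dyadic_walk G us k))"

lemma sum_list_products:
  fixes \<phi> :: "'c \<Rightarrow> real"
  shows "(\<Sum>z\<leftarrow>concat (map (\<lambda>x. map (m x) ys) xs). \<phi> z) = (\<Sum>x\<leftarrow>xs. \<Sum>y\<leftarrow>ys. \<phi> (m x y))"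
  by (induction xs) (simp_all add: comp_def)

lemma sum_list_swap:
  fixes \<phi> :: "'c \<Rightarrow> 'd \<Rightarrow> real"
  shows "(\<Sum>x\<leftarrow>xs. \<Sum>y\<leftarrow>ys. \<phi> x y) = (\<Sum>y\<leftarrow>ys. \<Sum>x\<leftarrow>xs. \<phi> x y)"
  by (induction xs) (simp_all add: sum_list_addf)

lemma inner_sum_list:
  "(\<Sum>x\<leftarrow>xs. \<Sum>y\<leftarrow>ys. c x \<bullet> d y) = (\<Sum>x\<leftarrow>xs. c x) \<bullet> (\<Sum>y\<leftarrow>ys. d y)"
proof -
  have "(\<Sum>y\<leftarrow>ys. v \<bullet> d y) = v \<bullet> (\<Sum>y\<leftarrow>ys. d y)" for v
    by (induction ys) (simp_all add: inner_add_right)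
  then show ?thesis by (induction xs) (simp_all add: inner_add_left)
qed

lemma sum_list_real_const: "(\<Sum>x\<leftarrow>xs. c) = real (length xs) * c"
  by (induction xs) (simp_all add: algebra_simps)

lemma sum_list_cong_mset: "mset xs = mset ys \<Longrightarrow> (\<Sum>x\<leftarrow>xs. \<phi> x) = (\<Sum>x\<leftarrow>ys. \<phi> x :: real)"
  by (metis mset_map sum_mset_sum_list)

context
  fixes G :: "('a, 'b) monoid_scheme" (structure) and us :: "'a list"
  assumes G: "group G" and us: "set us \<subseteq> carrier G"
begin

interpretation group G by (rule G)

lemma dyadic_walk_closed: "set (dyadic_walk G us k) \<subseteq> carrier G"
  using us by (induction k) auto

lemma dyadic_walk_mem: "x \<in> set (dyadic_walk G us k) \<Longrightarrow> x \<in> carrier G"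
  using dyadic_walk_closed by blast

lemma length_dyadic_walk_Suc:
  "length (dyadic_walk G us (Suc k)) = length (dyadic_walk G us k) * length (dyadic_walk G us k)"
proof -
  have "length (concat (map (\<lambda>x. map (m x) ys) xs)) = length xs * length ys" for m xs ys
    by (induction xs) auto
  then show ?thesis by simp
qed

lemma dyadic_walk_symmetric:
  assumes "mset (map (\<lambda>x. inv x) us) = mset us"
  shows "(\<Sum>x\<leftarrow>dyadic_walk G us k. \<phi> (inv x)) = (\<Sum>x\<leftarrow>dyadic_walk G us k. \<phi> x :: real)"
proof (induction k arbitrary: \<phi>)
  case 0
  show ?case using sum_list_cong_mset[OF assms, of \<phi>] by (simp add: comp_def)
next
  case (Suc k)
  let ?W = "dyadic_walk G us k"
  have "(\<Sum>x\<leftarrow>dyadic_walk G us (Suc k). \<phi> (inv x)) =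
      (\<Sum>x\<leftarrow>?W. \<Sum>y\<leftarrow>?W. \<phi> (inv (x \<otimes> y)))"
    by (simp add: sum_list_products)
  also have "\<dots> = (\<Sum>x\<leftarrow>?W. \<Sum>y\<leftarrow>?W. \<phi> (inv y \<otimes> inv x))"
    by (intro arg_cong[where f = sum_list] map_cong refl)
       (simp_all add: inv_mult_group dyadic_walk_mem)
  also have "\<dots> = (\<Sum>x\<leftarrow>?W. \<Sum>y\<leftarrow>?W. \<phi> (y \<otimes> inv x))"
    using Suc[of "\<lambda>z. \<phi> (z \<otimes> inv x)" for x] by simp
  also have "\<dots> = (\<Sum>x\<leftarrow>?W. \<Sum>y\<leftarrow>?W. \<phi> (y \<otimes> x))"
    by (rule Suc[of "\<lambda>x. \<Sum>y\<leftarrow>?W. \<phi> (y \<otimes> x)"])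
  also have "\<dots> = (\<Sum>x\<leftarrow>dyadic_walk G us (Suc k). \<phi> x)"
    by (subst sum_list_swap) (simp add: sum_list_products)
  finally show ?case .
qed

text \<open>For independent \<open>x\<close> and \<open>y\<close> with the same symmetric distribution, the displacement of \<open>x y\<close> is
  the distance from \<open>f (inv x)\<close> to \<open>f y\<close>, which are again independent with the same distribution. The
  mean squared distance between two independent copies of a vector is twice its variance, hence at most
  twice its second moment. So doubling the time at most doubles the mean squared displacement.\<close>

lemma displacement_doubling:
  fixes f :: "'a \<Rightarrow> 'h::real_inner"
  assumes sym: "mset (map (\<lambda>x. inv x) us) = mset us" and f: "left_invariant G f"
  defines "E \<equiv> \<lambda>k. (\<Sum>x\<leftarrow>dyadic_walk G us k. (norm (f x - f \<one>))\<^sup>2)"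
  shows "E (Suc k) \<le> 2 * real (length (dyadic_walk G us k)) * E k"
proof -
  let ?W = "dyadic_walk G us k"
  define c where "c x = f x - f \<one>" for x
  have dist: "norm (f (x \<otimes> y) - f \<one>) = norm (c (inv x) - c y)"
    if "x \<in> carrier G" "y \<in> carrier G" for x y
    using left_invariantD[OF f that(1), of y "inv x"] that
    by (simp add: c_def norm_minus_commute)
  have "E (Suc k) = (\<Sum>x\<leftarrow>?W. \<Sum>y\<leftarrow>?W. (norm (f (x \<otimes> y) - f \<one>))\<^sup>2)"
    by (simp add: E_def sum_list_products)
  also have "\<dots> = (\<Sum>x\<leftarrow>?W. \<Sum>y\<leftarrow>?W. (norm (c (inv x) - c y))\<^sup>2)"
    by (intro arg_cong[where f = sum_list] map_cong refl) (simp_all add: dist dyadic_walk_mem)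
  also have "\<dots> = (\<Sum>x\<leftarrow>?W. \<Sum>y\<leftarrow>?W. (norm (c x - c y))\<^sup>2)"
    by (rule dyadic_walk_symmetric[OF sym, of "\<lambda>x. \<Sum>y\<leftarrow>?W. (norm (c x - c y))\<^sup>2"])
  also have "\<dots> = (\<Sum>x\<leftarrow>?W. \<Sum>y\<leftarrow>?W. ((norm (c x))\<^sup>2 + (norm (c y))\<^sup>2) - 2 * (c x \<bullet> c y))"
    by (simp add: power2_norm_eq_inner inner_diff_left inner_diff_right inner_commute algebra_simps)
  also have "\<dots> = 2 * real (length ?W) * E k - 2 * (\<Sum>x\<leftarrow>?W. \<Sum>y\<leftarrow>?W. c x \<bullet> c y)"
    by (simp add: sum_list_subtractf sum_list_addf sum_list_real_const sum_list_const_mult E_def c_def)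
  also have "\<dots> = 2 * real (length ?W) * E k - 2 * ((\<Sum>x\<leftarrow>?W. c x) \<bullet> (\<Sum>x\<leftarrow>?W. c x))"
    by (simp only: inner_sum_list)
  also have "\<dots> \<le> 2 * real (length ?W) * E k" by simp
  finally show ?thesis .
qed

lemma drift_doubling:
  fixes n :: "'a \<Rightarrow> real"
  assumes drift: "\<And>g. g \<in> carrier G \<Longrightarrow>
      (\<Sum>u\<leftarrow>us. n (g \<otimes> u)) \<ge> real (length us) * (n g + \<delta>)"
    and g: "g \<in> carrier G"
  shows "(\<Sum>u\<leftarrow>dyadic_walk G us k. n (g \<otimes> u)) \<ge>
    real (length (dyadic_walk G us k)) * (n g + 2 ^ k * \<delta>)"
  using g
proof (induction k arbitrary: g)
  case 0
  then show ?case using drift by simp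
next
  case (Suc k)
  let ?W = "dyadic_walk G us k"
  let ?N = "real (length ?W)"
  have "?N * ?N * (n g + 2 ^ Suc k * \<delta>) = ?N * (?N * (n g + 2 ^ k * \<delta>)) + ?N * ?N * 2 ^ k * \<delta>"
    by (simp add: algebra_simps)
  also have "\<dots> \<le> ?N * (\<Sum>x\<leftarrow>?W. n (g \<otimes> x)) + ?N * ?N * 2 ^ k * \<delta>"
    using Suc.IH[OF Suc.prems] by (simp add: mult_left_mono)
  also have "\<dots> = (\<Sum>x\<leftarrow>?W. ?N * (n (g \<otimes> x) + 2 ^ k * \<delta>))"
    by (simp add: sum_list_const_mult sum_list_addf sum_list_real_const distrib_left mult.assoc)
  also have "\<dots> \<le> (\<Sum>x\<leftarrow>?W. \<Sum>y\<leftarrow>?W. n (g \<otimes> x \<otimes> y))"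
    using Suc.prems by (intro sum_list_mono Suc.IH) (simp add: dyadic_walk_mem)
  also have "\<dots> = (\<Sum>x\<leftarrow>?W. \<Sum>y\<leftarrow>?W. n (g \<otimes> (x \<otimes> y)))"
    using Suc.prems
    by (intro arg_cong[where f = sum_list] map_cong refl) (simp_all add: m_assoc dyadic_walk_mem)
  also have "\<dots> = (\<Sum>u\<leftarrow>dyadic_walk G us (Suc k). n (g \<otimes> u))"
    by (simp add: sum_list_products)
  finally show ?case by (simp only: length_dyadic_walk_Suc of_nat_mult)
qed

text \<open>A symmetric random walk with positive speed has a mean distance of the order of \<open>2 ^ k\<close> after \<open>2 ^ k\<close> steps,
  while its mean squared displacement in Hilbert space is at most of the order of \<open>2 ^ k\<close>. Here \<open>n\<close> is
  any function dominated by the word length whose mean grows at least by \<open>\<delta>\<close> at each step.\<close>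

theorem positive_drift_exponent_le_half:
  fixes f :: "'a \<Rightarrow> 'h::real_inner" and n :: "'a \<Rightarrow> real"
  assumes sym: "mset (map (\<lambda>x. inv x) us) = mset us" and ne: "us \<noteq> []"
    and drift: "\<And>g. g \<in> carrier G \<Longrightarrow>
      (\<Sum>u\<leftarrow>us. n (g \<otimes> u)) \<ge> real (length us) * (n g + \<delta>)"
    and \<delta>: "\<delta> > 0" and n_one: "n \<one> \<ge> 0"
    and dom: "\<And>x. x \<in> carrier G \<Longrightarrow> n x \<le> C * real (word_length G S x)" and C: "C > 0"
    and f: "left_invariant G f" and exp: "compression_exponent G S f \<epsilon>"
  shows "\<epsilon> \<le> 1 / 2"
proof (rule ccontr)
  assume "\<not> \<epsilon> \<le> 1 / 2"
  define p where "p = 2 * \<epsilon>"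
  have p: "p > 1" using \<open>\<not> \<epsilon> \<le> 1 / 2\<close> by (simp add: p_def)
  define c where "c x = f x - f \<one>" for x
  let ?W = "dyadic_walk G us" and ?l = "word_length G S"
  obtain B where B: "B > 0" and wl: "\<And>x. x \<in> carrier G \<Longrightarrow>
      real (?l x) powr p \<le> B * ((norm (c x))\<^sup>2 + 1)"
    using exp unfolding compression_exponent_squared[OF G f] p_def c_def by blast
  have N: "length (?W k) > 0" for k
    using ne by (induction k) (simp_all only: length_dyadic_walk_Suc dyadic_walk.simps, auto)
  define A where "A = (\<Sum>x\<leftarrow>us. (norm (c x))\<^sup>2)"
  have A0: "A \<ge> 0" unfolding A_def by (intro sum_list_nonneg) auto
  have disp: "(\<Sum>x\<leftarrow>?W k. (norm (c x))\<^sup>2) \<le> real (length (?W k)) * 2 ^ k * A" for k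
  proof (induction k)
    case 0
    have "1 * A \<le> real (length us) * A" using ne A0 by (intro mult_right_mono) (auto simp: Suc_le_eq)
    then show ?case by (simp add: A_def)
  next
    case (Suc k)
    have "(\<Sum>x\<leftarrow>?W (Suc k). (norm (c x))\<^sup>2) \<le>
        2 * real (length (?W k)) * (\<Sum>x\<leftarrow>?W k. (norm (c x))\<^sup>2)"
      using displacement_doubling[OF sym f, of k] unfolding c_def .
    also have "\<dots> \<le> 2 * real (length (?W k)) * (real (length (?W k)) * 2 ^ k * A)"
      by (rule mult_left_mono[OF Suc]) simp
    finally show ?case unfolding length_dyadic_walk_Suc by (simp add: mult_ac)
  qed
  define K where "K = \<delta> / (2 * C)"
  have K: "K > 0" using \<delta> C by (simp add: K_def)
  \<comment> \<open>The bound \<open>t powr p \<ge> L powr (p - 1) * (t - L)\<close>, affine in \<open>t\<close>, replaces Jensen's inequality;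
    \<open>L\<close> is half of the lower bound \<open>2 ^ k * \<delta> / C\<close> for the mean of \<open>n / C\<close> at time \<open>2 ^ k\<close>.\<close>
  have key: "(K * 2 ^ k) powr p \<le> B * (2 ^ k * A + 1)" for k
  proof -
    define L where "L = K * 2 ^ k"
    have L: "L > 0" using K by (simp add: L_def)
    let ?N = "real (length (?W k))"
    have tangent: "L powr (p - 1) * (n x / C - L) \<le> real (?l x) powr p" if x: "x \<in> carrier G" for x
    proof (cases "real (?l x) \<le> L")
      case True
      have "n x / C \<le> real (?l x)" using dom[OF x] C by (simp add: field_simps)
      then have "L powr (p - 1) * (n x / C - L) \<le> 0"
        using True L by (intro mult_nonneg_nonpos) auto
      then show ?thesis by (rule order_trans) simp
    next
      case False
      then have l: "real (?l x) > 0" "L \<le> real (?l x)" using L by auto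
      have "n x / C \<le> real (?l x)" using dom[OF x] C by (simp add: field_simps)
      then have "L powr (p - 1) * (n x / C - L) \<le> L powr (p - 1) * real (?l x)"
        using L by (intro mult_left_mono) auto
      also have "\<dots> \<le> real (?l x) powr (p - 1) * real (?l x)"
        using l L p by (intro mult_right_mono powr_mono2) auto
      also have "\<dots> = real (?l x) powr p" using l by (simp add: powr_diff)
      finally show ?thesis .
    qed
    have n_sum: "(\<Sum>x\<leftarrow>?W k. n x) \<ge> ?N * (2 ^ k * \<delta>)"
    proof -
      have "(\<Sum>x\<leftarrow>?W k. n (\<one> \<otimes> x)) = (\<Sum>x\<leftarrow>?W k. n x)"
        by (intro arg_cong[where f = sum_list] map_cong refl) (simp_all add: dyadic_walk_mem)
      moreover have "?N * (2 ^ k * \<delta>) \<le> ?N * (n \<one> + 2 ^ k * \<delta>)"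
        using n_one by (intro mult_left_mono) auto
      ultimately show ?thesis using drift_doubling[OF drift one_closed, of k] by simp
    qed
    have "?N * L powr p = L powr (p - 1) * (?N * L)"
      using L by (simp add: powr_diff)
    also have "?N * L = ?N * (2 ^ k * \<delta>) / C - ?N * L"
      using C by (simp add: L_def K_def field_simps)
    also have "L powr (p - 1) * \<dots> \<le> L powr (p - 1) * ((\<Sum>x\<leftarrow>?W k. n x) / C - ?N * L)"
      using n_sum C L by (intro mult_left_mono diff_right_mono divide_right_mono) auto
    also have "\<dots> = (\<Sum>x\<leftarrow>?W k. L powr (p - 1) * (n x / C - L))"
      by (simp add: sum_list_const_mult sum_list_subtractf sum_list_real_const divide_inverse
          sum_list_mult_const)
    also have "\<dots> \<le> (\<Sum>x\<leftarrow>?W k. B * ((norm (c x))\<^sup>2 + 1))"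
      by (intro sum_list_mono order_trans[OF tangent wl]) (simp_all add: dyadic_walk_mem)
    also have "\<dots> = B * ((\<Sum>x\<leftarrow>?W k. (norm (c x))\<^sup>2) + ?N)"
      by (simp add: sum_list_const_mult sum_list_addf sum_list_real_const)
    also have "\<dots> \<le> B * (?N * 2 ^ k * A + ?N)"
      using disp[of k] B by (intro mult_left_mono add_right_mono) auto
    also have "\<dots> = ?N * (B * (2 ^ k * A + 1))" by (simp add: algebra_simps)
    finally show ?thesis using N[of k] by (simp add: L_def)
  qed
  have "filterlim (\<lambda>k::nat. (K * 2 ^ k) powr p - B * (2 ^ k * A + 1)) at_top at_top"
  proof -
    define q where "q = p - 1"
    have pq: "p = q + 1" "q > 0" using p by (simp_all add: q_def)
    have "filterlim (\<lambda>x::real. x * (K * (K * x) powr q - B * A) - B) at_top at_top"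
      using K pq(2) by real_asymp
    moreover have "filterlim (\<lambda>k::nat. 2 ^ k :: real) at_top at_top" by real_asymp
    ultimately have "filterlim (\<lambda>k::nat. 2 ^ k * (K * (K * 2 ^ k) powr q - B * A) - B)
        at_top at_top"
      by (rule filterlim_compose)
    moreover have "2 ^ k * (K * (K * 2 ^ k) powr q - B * A) - B =
        (K * 2 ^ k) powr p - B * (2 ^ k * A + 1)" for k :: nat
      using K by (simp add: pq(1) powr_add algebra_simps)
    ultimately show ?thesis by simp
  qed
  then have "eventually (\<lambda>k::nat. (K * 2 ^ k) powr p - B * (2 ^ k * A + 1) > 0) at_top"
    unfolding filterlim_at_top_dense by (rule spec)
  then obtain k :: nat where "(K * 2 ^ k) powr p - B * (2 ^ k * A + 1) > 0"
    by (auto simp: eventually_at_top_linorder)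
  then show False using key[of k] by simp
qed

end

section \<open>Normal forms in HNN extensions\<close>

text \<open>The two associated subgroups and the isomorphism between them are indexed by the exponent of
  the stable letter, \<open>True\<close> standing for \<open>t\<close> and \<open>False\<close> for its inverse. In these terms the
  defining relation reads \<open>x t\<^sup>e = t\<^sup>e (iso e x)\<close> for \<open>x\<close> in \<open>assoc e\<close>, symmetrically in \<open>e\<close>.\<close>

locale hnn_extension = H: group H
  for H :: "('a, 'b) monoid_scheme" (structure) +
  fixes F :: "'a set" and \<theta> :: "'a \<Rightarrow> 'a"
  assumes F_subgroup: "subgroup F H"
    and \<theta>_hom: "\<theta> \<in> hom (H\<lparr>carrier := F\<rparr>) H"
    and \<theta>_inj: "inj_on \<theta> F"
begin

definition assoc :: "bool \<Rightarrow> 'a set" where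
  "assoc e = (if e then F else \<theta> ` F)"

definition iso :: "bool \<Rightarrow> 'a \<Rightarrow> 'a" where
  "iso e = (if e then \<theta> else inv_into F \<theta>)"

lemma F_closed: "F \<subseteq> carrier H"
  using F_subgroup by (rule subgroup.subset)

lemma \<theta>_closed: "\<theta> ` F \<subseteq> carrier H"
  using \<theta>_hom by (auto simp: hom_def)

lemma assoc_subgroup: "subgroup (assoc e) H"
proof (cases e)
  case False
  have "group_hom (H\<lparr>carrier := F\<rparr>) H \<theta>"
    using F_subgroup \<theta>_hom H.is_group
    by (simp add: group_hom_def group_hom_axioms_def H.subgroup_imp_group)
  from group_hom.img_is_subgroup[OF this] show ?thesis using False by (simp add: assoc_def)
qed (simp add: assoc_def F_subgroup)

lemma assoc_closed: "x \<in> assoc e \<Longrightarrow> x \<in> carrier H"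
  using subgroup.subset[OF assoc_subgroup] by blast

lemma assoc_one: "\<one> \<in> assoc e"
  by (rule subgroup.one_closed[OF assoc_subgroup])

lemma assoc_mult: "x \<in> assoc e \<Longrightarrow> y \<in> assoc e \<Longrightarrow> x \<otimes> y \<in> assoc e"
  by (rule subgroup.m_closed[OF assoc_subgroup])

lemma assoc_inv: "x \<in> assoc e \<Longrightarrow> inv x \<in> assoc e"
  by (rule subgroup.m_inv_closed[OF assoc_subgroup])

lemma assoc_mult_cancel_right:
  assumes "x \<in> carrier H" "y \<in> assoc e" "x \<otimes> y \<in> assoc e"
  shows "x \<in> assoc e"
proof -
  have "x = (x \<otimes> y) \<otimes> inv y"
    using assms assoc_closed by (simp add: H.m_assoc)
  then show ?thesis using assoc_mult[OF assms(3) assoc_inv[OF assms(2)]] by simp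
qed

lemma assoc_mult_cancel_left:
  assumes "y \<in> carrier H" "x \<in> assoc e" "x \<otimes> y \<in> assoc e"
  shows "y \<in> assoc e"
proof -
  have "y = inv x \<otimes> (x \<otimes> y)"
    using assms assoc_closed by (simp flip: H.m_assoc)
  then show ?thesis using assoc_mult[OF assoc_inv[OF assms(2)] assms(3)] by simp
qed

lemma iso_closed: "x \<in> assoc e \<Longrightarrow> iso e x \<in> assoc (\<not> e)"
  by (auto simp: assoc_def iso_def inv_into_into split: if_splits)

lemma iso_iso: "x \<in> assoc e \<Longrightarrow> iso (\<not> e) (iso e x) = x"
  using \<theta>_inj by (auto simp: assoc_def iso_def f_inv_into_f split: if_splits)

lemma \<theta>_mult: "x \<in> F \<Longrightarrow> y \<in> F \<Longrightarrow> \<theta> (x \<otimes> y) = \<theta> x \<otimes> \<theta> y"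
  using \<theta>_hom by (simp add: hom_def)

lemma iso_mult: "x \<in> assoc e \<Longrightarrow> y \<in> assoc e \<Longrightarrow> iso e (x \<otimes> y) = iso e x \<otimes> iso e y"
proof (cases e)
  case False
  assume "x \<in> assoc e" "y \<in> assoc e"
  then obtain u v where u: "u \<in> F" "x = \<theta> u" and v: "v \<in> F" "y = \<theta> v"
    using False by (auto simp: assoc_def)
  then have "x \<otimes> y = \<theta> (u \<otimes> v)" "u \<otimes> v \<in> F"
    using \<theta>_mult subgroup.m_closed[OF F_subgroup] by auto
  then show ?thesis using u v False \<theta>_inj by (simp add: iso_def)
qed (auto simp: assoc_def iso_def \<theta>_mult)

text \<open>Representatives of the right cosets of \<open>assoc e\<close>. As \<open>\<one>\<close> is chosen for the subgroup itself, the
  syllables at which stable letters can cancel are recognised in a normal form as those equal to \<open>\<one>\<close>.\<close>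

definition rep :: "bool \<Rightarrow> 'a \<Rightarrow> 'a" where
  "rep e h = (if h \<in> assoc e then \<one> else SOME x. x \<in> assoc e #> h)"

definition part :: "bool \<Rightarrow> 'a \<Rightarrow> 'a" where
  "part e h = h \<otimes> inv (rep e h)"

lemma rep_mem: "h \<in> carrier H \<Longrightarrow> rep e h \<in> assoc e #> h"
proof (cases "h \<in> assoc e")
  case True
  assume h: "h \<in> carrier H"
  have "\<one> = inv h \<otimes> h" using h by simp
  then have "\<one> \<in> assoc e #> h" using assoc_inv[OF True] by (auto simp: r_coset_def)
  then show ?thesis using True by (simp add: rep_def)
next
  case False
  assume h: "h \<in> carrier H"
  have "h \<in> assoc e #> h" by (rule H.rcos_self[OF h assoc_subgroup])
  then show ?thesis using False by (auto simp: rep_def intro: someI)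
qed

lemma rep_closed: "h \<in> carrier H \<Longrightarrow> rep e h \<in> carrier H"
  using rep_mem[of h e] assoc_closed by (auto simp: r_coset_def)

lemma part_closed: "h \<in> carrier H \<Longrightarrow> part e h \<in> assoc e"
proof -
  assume h: "h \<in> carrier H"
  obtain a where a: "a \<in> assoc e" "rep e h = a \<otimes> h" using rep_mem[OF h] by (auto simp: r_coset_def)
  then have "part e h = inv a"
    using h assoc_closed[OF a(1)] by (simp add: part_def H.inv_mult_group flip: H.m_assoc)
  then show ?thesis using assoc_inv[OF a(1)] by simp
qed

lemma part_rep: "h \<in> carrier H \<Longrightarrow> part e h \<otimes> rep e h = h"
  using rep_closed by (simp add: part_def H.m_assoc)

lemma rep_mult: "a \<in> assoc e \<Longrightarrow> h \<in> carrier H \<Longrightarrow> rep e (a \<otimes> h) = rep e h"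
proof -
  assume a: "a \<in> assoc e" and h: "h \<in> carrier H"
  have "a \<otimes> h \<in> assoc e \<longleftrightarrow> h \<in> assoc e"
    using assoc_mult[OF a] assoc_mult_cancel_left[OF h a] by blast
  moreover have "assoc e #> (a \<otimes> h) = assoc e #> h"
    using H.coset_mult_assoc[OF subgroup.subset[OF assoc_subgroup[of e]] assoc_closed[OF a] h]
      H.coset_join2[OF assoc_closed[OF a] assoc_subgroup a] by simp
  ultimately show ?thesis by (simp add: rep_def)
qed

lemma part_mult: "a \<in> assoc e \<Longrightarrow> h \<in> carrier H \<Longrightarrow> part e (a \<otimes> h) = a \<otimes> part e h"
  using rep_closed assoc_closed by (simp add: part_def rep_mult H.m_assoc)

lemma rep_rep: "h \<in> carrier H \<Longrightarrow> rep e (rep e h) = rep e h"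
  using rep_mult[OF part_closed[of h e] rep_closed[of h e]] part_rep[of h e] by simp

lemma rep_eq_one_iff: "h \<in> carrier H \<Longrightarrow> rep e h = \<one> \<longleftrightarrow> h \<in> assoc e"
proof
  assume "h \<in> carrier H" "rep e h = \<one>"
  then show "h \<in> assoc e" using part_rep[of h e] part_closed[of h e] assoc_closed by fastforce
qed (simp add: rep_def)

lemma part_assoc: "h \<in> assoc e \<Longrightarrow> part e h = h"
  using assoc_closed by (simp add: part_def rep_def)

text \<open>The pair \<open>(h, [(e\<^sub>1, s\<^sub>1), \<dots>])\<close> encodes \<open>h t\<^bsup>e\<^sub>1\<^esup> s\<^sub>1 t\<^bsup>e\<^sub>2\<^esup> s\<^sub>2 \<dots>\<close>, in normal form if each \<open>s\<^sub>i\<close> is a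
  chosen coset representative and no \<open>t \<one> t\<inverse>\<close> or \<open>t\<inverse> \<one> t\<close> occurs. Following van der Waerden, the
  letters act on normal forms as left multiplication should.\<close>

definition normal :: "'a \<times> (bool \<times> 'a) list \<Rightarrow> bool" where
  "normal = (\<lambda>(h, l). h \<in> carrier H \<and> (\<forall>(e, s) \<in> set l. s \<in> carrier H \<and> rep (\<not> e) s = s) \<and>
     successively (\<lambda>(e, s) (e', s'). s = \<one> \<longrightarrow> e' = e) l)"

definition stable_act :: "bool \<Rightarrow> 'a \<times> (bool \<times> 'a) list \<Rightarrow> 'a \<times> (bool \<times> 'a) list" where
  "stable_act e = (\<lambda>(h, l).
     let s = rep (\<not> e) h; x = iso (\<not> e) (part (\<not> e) h)
     in if s = \<one> \<and> l \<noteq> [] \<and> fst (hd l) = (\<not> e) then (x \<otimes> snd (hd l), tl l)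
        else (x, (e, s) # l))"

fun letter_act :: "'a hnn_letter \<Rightarrow> 'a \<times> (bool \<times> 'a) list \<Rightarrow> 'a \<times> (bool \<times> 'a) list" where
  "letter_act (Base x) (h, l) = (x \<otimes> h, l)"
| "letter_act Stable v = stable_act True v"
| "letter_act Stable_Inv v = stable_act False v"

definition word_act :: "'a hnn_letter list \<Rightarrow> 'a \<times> (bool \<times> 'a) list \<Rightarrow> 'a \<times> (bool \<times> 'a) list" where
  "word_act w v = foldr letter_act w v"

lemma normal_base: "x \<in> carrier H \<Longrightarrow> normal (h, l) \<Longrightarrow> normal (x \<otimes> h, l)"
  by (auto simp: normal_def)

lemma iso_part_closed: "h \<in> carrier H \<Longrightarrow> iso (\<not> e) (part (\<not> e) h) \<in> assoc e"
  using iso_closed[OF part_closed, of h "\<not> e"] by simp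

lemma normal_stable:
  assumes "normal v"
  shows "normal (stable_act e v)"
proof -
  obtain h l where v: "v = (h, l)" by (cases v)
  have h: "h \<in> carrier H" using assms v by (simp add: normal_def)
  note x = assoc_closed[OF iso_part_closed[OF h, of e]]
  show ?thesis
  proof (cases "rep (\<not> e) h = \<one> \<and> l \<noteq> [] \<and> fst (hd l) = (\<not> e)")
    case True
    then obtain s l' where "l = (\<not> e, s) # l'" by (cases l) auto
    then show ?thesis using assms v True x
      by (auto simp: normal_def stable_act_def successively_Cons)
  next
    case False
    then show ?thesis using assms v x rep_closed[OF h] rep_rep[OF h]
      by (cases l) (auto simp: normal_def stable_act_def Let_def)
  qed
qed

text \<open>If \<open>t\<^sup>e\<close> cancels against the first stable letter of a normal form, normality forbids that
  \<open>t\<^bsup>-e\<^esup>\<close> cancels against the next one; if it is prepended, \<open>t\<^bsup>-e\<^esup>\<close> removes it again.\<close>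

lemma stable_act_inverse:
  assumes "normal v"
  shows "stable_act (\<not> e) (stable_act e v) = v"
proof -
  obtain h l where v: "v = (h, l)" by (cases v)
  have h: "h \<in> carrier H" using assms v by (simp add: normal_def)
  define x where "x = iso (\<not> e) (part (\<not> e) h)"
  have x: "x \<in> assoc e" "x \<in> carrier H"
    unfolding x_def using iso_part_closed[OF h] assoc_closed by auto
  have ix: "iso e x = part (\<not> e) h"
    unfolding x_def using iso_iso[OF part_closed[OF h], of "\<not> e"] by simp
  show ?thesis
  proof (cases "rep (\<not> e) h = \<one> \<and> l \<noteq> [] \<and> fst (hd l) = (\<not> e)")
    case True
    then obtain s l' where l: "l = (\<not> e, s) # l'" by (cases l) auto
    have s: "s \<in> carrier H" "rep e s = s" and succ: "l' \<noteq> [] \<Longrightarrow> s = \<one> \<Longrightarrow> fst (hd l') = (\<not> e)"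
      using assms v l by (auto simp: normal_def successively_Cons split: prod.splits)
    have 1: "stable_act e v = (x \<otimes> s, l')"
      using True v l by (simp add: stable_act_def x_def)
    have "part e s = \<one>" using s by (simp add: part_def)
    then have "part e (x \<otimes> s) = x" "rep e (x \<otimes> s) = s"
      using x s by (simp_all add: part_mult rep_mult)
    moreover have "iso e x = h"
      using ix part_rep[OF h, of "\<not> e"] True assoc_closed[OF part_closed[OF h, of "\<not> e"]] by simp
    ultimately show ?thesis
      unfolding 1 using succ by (auto simp: stable_act_def v l Let_def)
  next
    case False
    then have 1: "stable_act e v = (x, (e, rep (\<not> e) h) # l)"
      using v by (auto simp: stable_act_def x_def Let_def)
    have "rep e x = \<one>" "part e x = x" using x rep_eq_one_iff part_assoc by auto
    then show ?thesis
      unfolding 1 using ix part_rep[OF h] by (simp add: stable_act_def v)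
  qed
qed

lemma stable_act_base:
  assumes "x \<in> assoc e" "normal v"
  shows "letter_act (Base x) (stable_act e v) = stable_act e (letter_act (Base (iso e x)) v)"
proof -
  obtain h l where v: "v = (h, l)" by (cases v)
  have h: "h \<in> carrier H" using assms v by (simp add: normal_def)
  have y: "iso e x \<in> assoc (\<not> e)" by (rule iso_closed[OF assms(1)])
  have sc: "snd (hd l) \<in> carrier H" if "l \<noteq> []"
    using assms(2) v that by (cases l) (auto simp: normal_def)
  have "iso (\<not> e) (iso e x \<otimes> part (\<not> e) h) = x \<otimes> iso (\<not> e) (part (\<not> e) h)"
    using iso_mult[OF y part_closed[OF h]] iso_iso[OF assms(1)] by simp
  then show ?thesis
    using assoc_closed[OF assms(1)] assoc_closed[OF iso_part_closed[OF h, of e]] sc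
    by (simp add: v stable_act_def rep_mult[OF y h] part_mult[OF y h] Let_def H.m_assoc)
qed

lemma letter_act_normal:
  "l \<in> Base ` carrier H \<union> {Stable, Stable_Inv} \<Longrightarrow> normal v \<Longrightarrow> normal (letter_act l v)"
  using normal_stable normal_base by (cases v) auto

lemma word_act_normal: "w \<in> hnn_words H \<Longrightarrow> normal v \<Longrightarrow> normal (word_act w v)"
proof (induction w)
  case (Cons a w)
  then show ?case using letter_act_normal[of a] by (auto simp: word_act_def hnn_words_def)
qed (simp add: word_act_def)

lemma word_act_append: "word_act (u @ w) v = word_act u (word_act w v)"
  by (simp add: word_act_def)

lemma word_act_relation:
  assumes "(u, w) \<in> hnn_relations H F \<theta>" "normal v"
  shows "word_act u v = word_act w v"
  using assms(1)
proof cases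
  case (base_mult x y)
  then show ?thesis using assms(2) by (cases v) (auto simp: word_act_def normal_def H.m_assoc)
next
  case base_one
  then show ?thesis using assms(2) by (cases v) (auto simp: word_act_def normal_def)
next
  case stable_cancel
  then show ?thesis using stable_act_inverse[OF assms(2), of False] by (simp add: word_act_def)
next
  case stable_inv_cancel
  then show ?thesis using stable_act_inverse[OF assms(2), of True] by (simp add: word_act_def)
next
  case (conjugate f)
  have "f \<in> assoc True" using conjugate by (simp add: assoc_def)
  from stable_act_base[OF this assms(2)]
  have "letter_act (Base f) (stable_act True v) = stable_act True (letter_act (Base (\<theta> f)) v)"
    by (simp add: iso_def)
  moreover have "normal (letter_act (Base (\<theta> f)) v)"
    using letter_act_normal[OF _ assms(2)] \<theta>_closed conjugate by blast
  ultimately show ?thesis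
    using conjugate stable_act_inverse[of _ True] by (simp add: word_act_def)
qed

lemma word_act_congruence:
  assumes "(u, w) \<in> hnn_congruence H F \<theta>" "normal v"
  shows "word_act u v = word_act w v"
  using assms
proof (induction arbitrary: v)
  case (rel u w p q)
  then show ?case
    by (simp add: word_act_append word_act_relation[OF rel(1) word_act_normal[OF rel(3)]])
qed auto


subsection \<open>The group and its normal form map\<close>

abbreviation G :: "'a hnn_letter list set monoid" where "G \<equiv> HNN H F \<theta>"

abbreviation mult_G (infixl "\<cdot>" 70) where "x \<cdot> y \<equiv> x \<otimes>\<^bsub>G\<^esub> y"

abbreviation cls :: "'a hnn_letter list \<Rightarrow> 'a hnn_letter list set" where
  "cls w \<equiv> hnn_congruence H F \<theta> `` {w}"

definition base :: "'a \<Rightarrow> 'a hnn_letter list set" where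
  "base h = cls [Base h]"

definition stable_letter :: "bool \<Rightarrow> 'a hnn_letter" where
  "stable_letter e = (if e then Stable else Stable_Inv)"

definition stable :: "bool \<Rightarrow> 'a hnn_letter list set" where
  "stable e = cls [stable_letter e]"

lemmas equiv_cong = equiv_hnn_congruence[OF H.is_group F_closed \<theta>_closed]
lemmas cls_mult = HNN_mult_class[OF H.is_group F_closed \<theta>_closed]

lemma group_G: "group G"
  by (rule group_HNN[OF H.is_group F_closed \<theta>_closed])

sublocale G: group G by (rule group_G)

lemma words_simps [simp]:
  "[] \<in> hnn_words H"
  "a # b # w \<in> hnn_words H \<longleftrightarrow> [a] \<in> hnn_words H \<and> b # w \<in> hnn_words H"
  "[Base x] \<in> hnn_words H \<longleftrightarrow> x \<in> carrier H" "[stable_letter e] \<in> hnn_words H"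
  by (auto simp: hnn_words_def stable_letter_def)

lemma base_word: "w \<in> hnn_words H \<Longrightarrow> h \<in> carrier H \<Longrightarrow> Base h # w \<in> hnn_words H"
  and stable_word: "w \<in> hnn_words H \<Longrightarrow> stable_letter e # w \<in> hnn_words H"
  by (auto simp: hnn_words_def stable_letter_def)

lemma carrier_G: "carrier G = cls ` hnn_words H"
  by (auto simp: HNN_def quotient_def)

lemma one_G: "\<one>\<^bsub>G\<^esub> = cls []"
  by (simp add: HNN_def)

lemma cls_eqI: "(u, v) \<in> hnn_relations H F \<theta> \<Longrightarrow> cls u = cls v"
  using hnn_congruence.rel[of u v H F \<theta> "[]" "[]"]
  by (intro equiv_class_eq[OF equiv_cong]) simp

lemma base_closed [simp]: "h \<in> carrier H \<Longrightarrow> base h \<in> carrier G"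
  by (simp add: base_def carrier_G)

lemma stable_closed [simp]: "stable e \<in> carrier G"
  by (simp add: stable_def carrier_G)

lemma base_mult: "x \<in> carrier H \<Longrightarrow> y \<in> carrier H \<Longrightarrow> base x \<cdot> base y = base (x \<otimes> y)"
  unfolding base_def by (subst cls_mult) (auto intro!: cls_eqI hnn_relations.base_mult)

lemma base_hom: "base \<in> hom H G"
  by (auto simp: hom_def base_mult)

lemma base_one: "base \<one> = \<one>\<^bsub>G\<^esub>"
  unfolding base_def one_G by (rule cls_eqI) (rule hnn_relations.base_one)

lemma base_inv: "x \<in> carrier H \<Longrightarrow> base (inv x) = inv\<^bsub>G\<^esub> base x"
  by (intro G.inv_equality[symmetric]) (simp_all add: base_mult base_one)

lemma stable_mult: "stable e \<cdot> stable (\<not> e) = \<one>\<^bsub>G\<^esub>"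
proof -
  have "stable e \<cdot> stable (\<not> e) = cls [stable_letter e, stable_letter (\<not> e)]"
    unfolding stable_def by (subst cls_mult) auto
  also have "\<dots> = cls []"
    by (rule cls_eqI) (cases e; simp add: stable_letter_def
        hnn_relations.stable_cancel hnn_relations.stable_inv_cancel)
  finally show ?thesis by (simp add: one_G)
qed

lemma stable_inv: "inv\<^bsub>G\<^esub> stable e = stable (\<not> e)"
  using stable_mult[of "\<not> e"] by (intro G.inv_equality) simp_all

lemma base_stable:
  assumes "x \<in> assoc e"
  shows "base x \<cdot> stable e = stable e \<cdot> base (iso e x)"
proof -
  have True_case: "base y \<cdot> stable True = stable True \<cdot> base (\<theta> y)" if y: "y \<in> F" for y
  proof -
    have yH: "y \<in> carrier H" "\<theta> y \<in> carrier H" using y F_closed \<theta>_closed by auto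
    have "stable False \<cdot> (base y \<cdot> stable True) = base (\<theta> y)"
    proof -
      have "base y \<cdot> stable True = cls [Base y, Stable]"
        unfolding stable_def base_def stable_letter_def
        using yH by (subst cls_mult) (auto simp: hnn_words_def)
      also have "stable False \<cdot> \<dots> = cls [Stable_Inv, Base y, Stable]"
        unfolding stable_def stable_letter_def
        using yH by (subst cls_mult) (auto simp: hnn_words_def)
      also have "\<dots> = cls [Base (\<theta> y)]"
        by (rule cls_eqI) (rule hnn_relations.conjugate[OF y])
      finally show ?thesis by (simp add: base_def)
    qed
    then have "stable True \<cdot> (stable False \<cdot> (base y \<cdot> stable True)) =
        stable True \<cdot> base (\<theta> y)" by simp
    then show ?thesis using yH stable_mult[of True] by (simp flip: G.m_assoc)
  qed
  show ?thesis
  proof (cases e)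
    case True
    then show ?thesis using True_case assms by (simp add: assoc_def iso_def)
  next
    case False
    define y where "y = iso e x"
    have y: "y \<in> F" "\<theta> y = x"
      using iso_closed[OF assms] iso_iso[OF assms] False by (simp_all add: y_def assoc_def iso_def)
    have yH: "y \<in> carrier H" "x \<in> carrier H" using y F_closed \<theta>_closed by auto
    have "stable False \<cdot> (base y \<cdot> stable True) \<cdot> stable False =
        stable False \<cdot> (stable True \<cdot> base x) \<cdot> stable False"
      using True_case[OF y(1)] y(2) by simp
    then have "stable False \<cdot> base y \<cdot> (stable True \<cdot> stable False) =
        (stable False \<cdot> stable True) \<cdot> base x \<cdot> stable False"
      using yH by (simp add: G.m_assoc)
    then show ?thesis using yH False stable_mult[of True] stable_mult[of False] by (simp add: y_def)
  qed
qed

lemma G_induct [consumes 1, case_names one base stable]: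
  assumes "g \<in> carrier G"
    and one: "P \<one>\<^bsub>G\<^esub>"
    and base: "\<And>g h. g \<in> carrier G \<Longrightarrow> P g \<Longrightarrow> h \<in> carrier H \<Longrightarrow> P (g \<cdot> base h)"
    and stable: "\<And>g e. g \<in> carrier G \<Longrightarrow> P g \<Longrightarrow> P (g \<cdot> stable e)"
  shows "P g"
proof -
  have "P (cls w)" if "w \<in> hnn_words H" for w
    using that
  proof (induction w rule: rev_induct)
    case Nil
    show ?case using one by (simp add: one_G)
  next
    case (snoc a w)
    then have w: "w \<in> hnn_words H" "P (cls w)" "cls w \<in> carrier G" and a: "[a] \<in> hnn_words H"
      by (auto simp: hnn_words_def carrier_G)
    have eq: "cls (w @ [a]) = cls w \<cdot> cls [a]" using w a by (simp add: cls_mult)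
    consider (b) h where "h \<in> carrier H" "a = Base h" | (s) e where "a = stable_letter e"
      using a by (auto simp: hnn_words_def stable_letter_def) (metis)+
    then show ?case
    proof cases
      case b
      then show ?thesis using base[OF w(3,2)] unfolding eq base_def by simp
    next
      case s
      then show ?thesis using stable[OF w(3,2)] unfolding eq stable_def by simp
    qed
  qed
  then show ?thesis using assms(1) by (auto simp: carrier_G)
qed

text \<open>Congruent words act in the same way, so the choice of a representing word does not matter.\<close>

definition nf :: "'a hnn_letter list set \<Rightarrow> 'a \<times> (bool \<times> 'a) list" where
  "nf g = word_act (SOME w. w \<in> hnn_words H \<and> cls w = g) (\<one>, [])"

lemma normal_one: "normal (\<one>, [])"
  by (simp add: normal_def)

lemma nf_cls:
  assumes "w \<in> hnn_words H"
  shows "nf (cls w) = word_act w (\<one>, [])"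
proof -
  define w' where "w' = (SOME w'. w' \<in> hnn_words H \<and> cls w' = cls w)"
  have "w' \<in> hnn_words H \<and> cls w' = cls w"
    unfolding w'_def by (rule someI[of _ w]) (use assms in simp)
  then have "(w', w) \<in> hnn_congruence H F \<theta>"
    using eq_equiv_class[OF _ equiv_cong] assms by blast
  then show ?thesis
    using word_act_congruence[OF _ normal_one] by (simp add: nf_def w'_def)
qed

lemma nf_one: "nf \<one>\<^bsub>G\<^esub> = (\<one>, [])"
  by (simp add: one_G nf_cls word_act_def)

lemma nf_normal: "g \<in> carrier G \<Longrightarrow> normal (nf g)"
  using word_act_normal normal_one by (auto simp: carrier_G nf_cls)

lemma nf_base:
  assumes "g \<in> carrier G" "h \<in> carrier H"
  shows "nf (base h \<cdot> g) = (h \<otimes> fst (nf g), snd (nf g))"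
proof -
  obtain w where w: "w \<in> hnn_words H" "g = cls w" using assms by (auto simp: carrier_G)
  obtain k l where kl: "word_act w (\<one>, []) = (k, l)" by fastforce
  have "base h \<cdot> g = cls (Base h # w)" using w assms by (simp add: base_def cls_mult)
  then have "nf (base h \<cdot> g) = letter_act (Base h) (word_act w (\<one>, []))"
    using w assms base_word[OF w(1) assms(2)] by (simp add: nf_cls word_act_def)
  then show ?thesis using w kl by (simp add: nf_cls)
qed

lemma nf_stable:
  assumes "g \<in> carrier G"
  shows "nf (stable e \<cdot> g) = stable_act e (nf g)"
proof -
  obtain w where w: "w \<in> hnn_words H" "g = cls w" using assms by (auto simp: carrier_G)
  have "stable e \<cdot> g = cls (stable_letter e # w)" using w by (simp add: stable_def cls_mult)
  then show ?thesis
    using w stable_word[of w e] by (cases e) (simp_all add: nf_cls word_act_def stable_letter_def)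
qed

end

section \<open>Reduced words, first edges and the number of stable letters\<close>

context hnn_extension
begin

fun elem :: "'a \<Rightarrow> (bool \<times> 'a) list \<Rightarrow> 'a hnn_letter list set" where
  "elem h [] = base h"
| "elem h ((e, k) # l) = base h \<cdot> (stable e \<cdot> elem k l)"

definition reduced :: "'a \<Rightarrow> (bool \<times> 'a) list \<Rightarrow> bool" where
  "reduced h l \<longleftrightarrow> h \<in> carrier H \<and> snd ` set l \<subseteq> carrier H \<and>
     successively (\<lambda>p q. snd p \<in> assoc (\<not> fst p) \<longrightarrow> fst q = fst p) l"

definition last_syllable :: "'a \<Rightarrow> (bool \<times> 'a) list \<Rightarrow> 'a" where
  "last_syllable h l = (if l = [] then h else snd (last l))"

lemma last_syllable_simps [simp]:
  "last_syllable h [] = h" "last_syllable h (l @ [p]) = snd p"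
  "last_syllable h (p # l) = last_syllable (snd p) l"
  by (auto simp: last_syllable_def)

lemma reduced_Nil [simp]: "reduced h [] \<longleftrightarrow> h \<in> carrier H"
  by (simp add: reduced_def)

lemma reduced_Cons:
  "reduced h ((e, k) # l) \<longleftrightarrow> h \<in> carrier H \<and> reduced k l \<and>
     (l \<noteq> [] \<longrightarrow> k \<in> assoc (\<not> e) \<longrightarrow> fst (hd l) = e)"
  by (auto simp: reduced_def successively_Cons)

lemma reduced_snoc:
  "reduced h (l @ [(e, k)]) \<longleftrightarrow> reduced h l \<and> k \<in> carrier H \<and>
     (l \<noteq> [] \<longrightarrow> snd (last l) \<in> assoc (\<not> fst (last l)) \<longrightarrow> e = fst (last l))"
  by (auto simp: reduced_def successively_append_iff)

lemma reduced_append: "reduced h (l @ m) \<Longrightarrow> reduced h l \<and> reduced (last_syllable h l) m"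
  by (induction l arbitrary: h) (auto simp: reduced_Cons reduced_def successively_append_iff
      successively_Cons)

lemma reduced_closed: "reduced h l \<Longrightarrow> h \<in> carrier H"
  by (simp add: reduced_def)

lemma last_syllable_closed: "reduced h l \<Longrightarrow> last_syllable h l \<in> carrier H"
  by (auto simp: last_syllable_def reduced_def)

lemma elem_in_carrier [simp]:
  "h \<in> carrier H \<Longrightarrow> snd ` set l \<subseteq> carrier H \<Longrightarrow> elem h l \<in> carrier G"
  by (induction h l rule: elem.induct) auto

lemma elem_closed: "reduced h l \<Longrightarrow> elem h l \<in> carrier G"
  by (simp add: reduced_def)

lemma elem_append:
  assumes "h \<in> carrier H" "snd ` set l \<subseteq> carrier H" "snd ` set m \<subseteq> carrier H"
  shows "elem h (l @ m) =
    elem h l \<cdot> inv\<^bsub>G\<^esub> base (last_syllable h l) \<cdot> elem (last_syllable h l) m"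
  using assms
proof (induction l arbitrary: h)
  case (Cons p l)
  have cl: "last_syllable (snd p) l \<in> carrier H"
    using Cons.prems by (auto simp: last_syllable_def)
  then show ?case using Cons by (cases p) (simp add: G.m_assoc)
qed simp

lemma elem_snoc:
  assumes "h \<in> carrier H" "snd ` set l \<subseteq> carrier H" "k \<in> carrier H"
  shows "elem h (l @ [(e, k)]) = elem h l \<cdot> stable e \<cdot> base k"
proof -
  have "last_syllable h l \<in> carrier H" using assms by (auto simp: last_syllable_def)
  then have c: "base (last_syllable h l) \<in> carrier G" by simp
  then have "inv\<^bsub>G\<^esub> base (last_syllable h l) \<cdot> (base (last_syllable h l) \<cdot> z) = z"
    if "z \<in> carrier G" for z
    using that by (simp flip: G.m_assoc)
  then show ?thesis
    using assms c by (simp add: elem_append G.m_assoc)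
qed

text \<open>Britton's lemma. When the letters of a reduced word act one after another, starting from its end,
  no stable letter is cancelled: normalising what follows a syllable multiplies it by an element of the
  associated subgroup that passes the next stable letter, and a cancellation there depends exactly on
  whether the syllable lies in that subgroup.\<close>

lemma nf_elem:
  assumes "reduced h l"
  shows "\<exists>a s. nf (elem h l) = (h \<otimes> a, s) \<and> map fst s = map fst l \<and>
    (if l = [] then a = \<one> else a \<in> assoc (fst (hd l)))"
  using assms
proof (induction h l rule: elem.induct)
  case (1 h)
  then show ?case using nf_base[OF G.one_closed, of h] by (simp add: nf_one)
next
  case (2 h e k l)
  then have red: "reduced k l" and h: "h \<in> carrier H"
    and pinch: "l \<noteq> [] \<Longrightarrow> k \<in> assoc (\<not> e) \<Longrightarrow> fst (hd l) = e"
    by (auto simp: reduced_Cons)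
  note k = reduced_closed[OF red]
  obtain a s where as: "nf (elem k l) = (k \<otimes> a, s)" "map fst s = map fst l"
    "if l = [] then a = \<one> else a \<in> assoc (fst (hd l))"
    using 2(1)[OF red] by blast
  have a: "a \<in> carrier H" using as(3) assoc_closed by (auto split: if_splits)
  have "\<not> (rep (\<not> e) (k \<otimes> a) = \<one> \<and> s \<noteq> [] \<and> fst (hd s) = (\<not> e))"
  proof
    assume *: "rep (\<not> e) (k \<otimes> a) = \<one> \<and> s \<noteq> [] \<and> fst (hd s) = (\<not> e)"
    then have l: "l \<noteq> []" "fst (hd l) = (\<not> e)" using as(2) by (cases s; cases l; auto)+
    then have "k \<in> assoc (\<not> e)"
      using * as(3) k a rep_eq_one_iff assoc_mult_cancel_right[OF k, of a "\<not> e"] by auto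
    then show False using pinch l by simp
  qed
  then have "nf (stable e \<cdot> elem k l) =
      (iso (\<not> e) (part (\<not> e) (k \<otimes> a)), (e, rep (\<not> e) (k \<otimes> a)) # s)"
    using nf_stable[OF elem_closed[OF red]] as(1) by (auto simp: stable_act_def Let_def)
  then have "nf (elem h ((e, k) # l)) =
      (h \<otimes> iso (\<not> e) (part (\<not> e) (k \<otimes> a)), (e, rep (\<not> e) (k \<otimes> a)) # s)"
    using nf_base[of "stable e \<cdot> elem k l" h] h elem_closed[OF red] by simp
  then show ?case using as(2) iso_part_closed[of "k \<otimes> a" e] k a by auto
qed

definition stable_length :: "'a hnn_letter list set \<Rightarrow> nat" where
  "stable_length g = length (snd (nf g))"

definition syllable :: "'a hnn_letter list set \<Rightarrow> 'a" where
  "syllable g = fst (nf g)"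

text \<open>The first edge of the path in the Bass-Serre tree from the vertex \<open>H\<close> to the vertex \<open>g H\<close>: the
  edges at the vertex \<open>H\<close> are the left cosets in \<open>H\<close> of the two associated subgroups.\<close>

definition edge :: "'a hnn_letter list set \<Rightarrow> (bool \<times> 'a set) option" where
  "edge g = (case snd (nf g) of [] \<Rightarrow> None | p # _ \<Rightarrow> Some (fst p, syllable g <# assoc (fst p)))"

lemma lcoset_absorb: "h \<in> carrier H \<Longrightarrow> a \<in> assoc e \<Longrightarrow> h \<otimes> a <# assoc e = h <# assoc e"
proof -
  assume h: "h \<in> carrier H" and a: "a \<in> assoc e"
  have "a <# assoc e = assoc e"
    by (rule H.coset_join3[OF assoc_closed[OF a] assoc_subgroup a])
  then show ?thesis
    using H.lcos_m_assoc[OF subgroup.subset[OF assoc_subgroup] h assoc_closed[OF a], of e] by simp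
qed

lemma stable_length_elem: "reduced h l \<Longrightarrow> stable_length (elem h l) = length l"
  using nf_elem[of h l] by (auto simp: stable_length_def dest: map_eq_imp_length_eq)

lemma edge_elem:
  assumes "reduced h l"
  shows "edge (elem h l) = (if l = [] then None else Some (fst (hd l), h <# assoc (fst (hd l))))"
proof -
  obtain a s where as: "nf (elem h l) = (h \<otimes> a, s)" "map fst s = map fst l"
    "if l = [] then a = \<one> else a \<in> assoc (fst (hd l))"
    using nf_elem[OF assms] by blast
  show ?thesis
    using as lcoset_absorb[OF reduced_closed[OF assms]]
    by (cases l; cases s) (auto simp: edge_def syllable_def)
qed

lemma syllable_base: "h \<in> carrier H \<Longrightarrow> syllable (base h) = h"
  using nf_base[OF G.one_closed, of h] by (simp add: syllable_def nf_one)

lemma edge_base: "h \<in> carrier H \<Longrightarrow> edge (base h) = None"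
  using edge_elem[of h "[]"] by simp

lemma stable_length_one: "stable_length \<one>\<^bsub>G\<^esub> = 0"
  by (simp add: stable_length_def nf_one)

lemma syllable_closed: "g \<in> carrier G \<Longrightarrow> syllable g \<in> carrier H"
  using nf_normal[of g] by (auto simp: normal_def syllable_def split: prod.splits)

lemma syllable_base_mult:
  "h \<in> carrier H \<Longrightarrow> g \<in> carrier G \<Longrightarrow> syllable (base h \<cdot> g) = h \<otimes> syllable g"
  by (simp add: syllable_def nf_base)

lemma edge_base_mult:
  assumes "h \<in> carrier H" "g \<in> carrier G"
  shows "edge (base h \<cdot> g) = map_option (\<lambda>(e, A). (e, h <# A)) (edge g)"
  using assms H.lcos_m_assoc[OF subgroup.subset[OF assoc_subgroup] assms(1) syllable_closed[OF assms(2)]]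
  by (auto simp: edge_def nf_base syllable_base_mult split: list.splits)

lemma edge_eq_imp_syllable:
  assumes "edge y = edge z" "edge y \<noteq> None" "y \<in> carrier G" "z \<in> carrier G"
  shows "\<exists>e. \<exists>a\<in>assoc e. syllable z = syllable y \<otimes> a"
proof -
  obtain e where "syllable y <# assoc e = syllable z <# assoc e"
    using assms(1,2) by (auto simp: edge_def split: list.splits)
  moreover have "syllable z \<in> syllable z <# assoc e"
    using syllable_closed[OF assms(4)] assoc_one[of e] by (force simp: l_coset_def)
  ultimately have "syllable z \<in> syllable y <# assoc e" by simp
  then show ?thesis unfolding l_coset_def by blast
qed

text \<open>Only the end of a reduced word has to be rearranged when a letter is appended, so the first
  syllable and the first edge can be followed under right multiplication.\<close>

lemma elem_base_right:
  assumes "reduced h l" "x \<in> carrier H"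
  obtains h' l' where "reduced h' l'" "elem h' l' = elem h l \<cdot> base x"
    "map fst l' = map fst l" "l \<noteq> [] \<Longrightarrow> h' = h"
    "last_syllable h' l' = last_syllable h l \<otimes> x"
proof (cases l rule: rev_cases)
  case Nil
  then show ?thesis using that[of "h \<otimes> x" "[]"] assms by (simp add: base_mult)
next
  case (snoc m p)
  obtain e k where p: "p = (e, k)" by (cases p)
  have red: "reduced h m" "k \<in> carrier H" using assms snoc p by (auto simp: reduced_snoc)
  then have cl: "h \<in> carrier H" "snd ` set m \<subseteq> carrier H" by (auto simp: reduced_def)
  have "reduced h (m @ [(e, k \<otimes> x)])" using assms snoc p by (auto simp: reduced_snoc)
  moreover have "elem h (m @ [(e, k \<otimes> x)]) = elem h l \<cdot> base x"
    using cl red assms snoc p by (simp add: elem_snoc G.m_assoc base_mult)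
  ultimately show ?thesis using that snoc p by simp
qed

definition pinched :: "bool \<Rightarrow> (bool \<times> 'a) list \<Rightarrow> bool" where
  "pinched e l \<longleftrightarrow> l \<noteq> [] \<and> fst (last l) = (\<not> e) \<and> snd (last l) \<in> assoc e"

lemma elem_stable_right_reduced:
  assumes "reduced h l" "\<not> pinched e l"
  shows "reduced h (l @ [(e, \<one>)])" "elem h (l @ [(e, \<one>)]) = elem h l \<cdot> stable e"
proof -
  show "reduced h (l @ [(e, \<one>)])"
    using assms by (cases e; cases "fst (last l)") (auto simp: reduced_snoc pinched_def)
  show "elem h (l @ [(e, \<one>)]) = elem h l \<cdot> stable e"
    using assms elem_closed[OF assms(1)] by (simp add: elem_snoc base_one reduced_def)
qed

lemma elem_stable_right_pinched:
  assumes "reduced h l" "pinched e l"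
  obtains h' l' where "reduced h' l'" "elem h' l' = elem h l \<cdot> stable e"
    "map fst l' = butlast (map fst l)" "l' \<noteq> [] \<Longrightarrow> h' = h"
proof -
  obtain m k where l: "l = m @ [(\<not> e, k)]" and k: "k \<in> assoc e"
    using assms(2) by (cases l rule: rev_cases) (auto simp: pinched_def)
  have red: "reduced h m" "k \<in> carrier H" using assms l by (auto simp: reduced_snoc)
  then have cl: "h \<in> carrier H" "snd ` set m \<subseteq> carrier H" by (auto simp: reduced_def)
  have i: "iso e k \<in> carrier H" using iso_closed[OF k] assoc_closed by blast
  have "elem h l \<cdot> stable e = elem h m \<cdot> (stable (\<not> e) \<cdot> (base k \<cdot> stable e))"
    using cl red l by (simp add: elem_snoc G.m_assoc)
  also have "\<dots> = elem h m \<cdot> base (iso e k)"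
    using i stable_mult[of "\<not> e"] by (simp add: base_stable[OF k] flip: G.m_assoc)
  finally have eq: "elem h m \<cdot> base (iso e k) = elem h l \<cdot> stable e" ..
  obtain h' l' where hl: "reduced h' l'" "elem h' l' = elem h m \<cdot> base (iso e k)"
    "map fst l' = map fst m" "m \<noteq> [] \<Longrightarrow> h' = h"
    using elem_base_right[OF red(1) i] by metis
  have "h' = h" if "l' \<noteq> []" using hl(3,4) that by (metis map_is_Nil_conv)
  then show ?thesis
    using that[OF hl(1)] hl(2,3) l eq by (simp add: butlast_append)
qed

lemma elem_surj:
  assumes "g \<in> carrier G"
  obtains h l where "reduced h l" "elem h l = g"
proof -
  have "\<exists>h l. reduced h l \<and> elem h l = g"
    using assms
  proof (induction g rule: G_induct)
    case one
    show ?case by (intro exI[of _ \<one>] exI[of _ "[]"]) (simp add: base_one)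
  next
    case (base g h)
    then show ?case using elem_base_right by metis
  next
    case (stable g e)
    then show ?case using elem_stable_right_pinched elem_stable_right_reduced by metis
  qed
  then show ?thesis using that by blast
qed

lemma edge_None_iff:
  assumes "g \<in> carrier G"
  shows "edge g = None \<longleftrightarrow> g \<in> base ` carrier H"
proof -
  obtain h l where "reduced h l" "elem h l = g" using elem_surj[OF assms] .
  then show ?thesis using edge_elem[of h l] edge_base reduced_closed[of h l]
    by (cases l) (auto split: if_splits)
qed

text \<open>As soon as the path to \<open>g H\<close> has a first edge, moving \<open>g\<close> to a neighbour does not change it,
  unless the neighbour lies in \<open>H\<close>. So what the first syllable and the first edge determine changes at
  few places only.\<close>

lemma edge_mult_base:
  assumes "g \<in> carrier G" "x \<in> carrier H" "edge g \<noteq> None"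
  shows "edge (g \<cdot> base x) = edge g"
proof -
  obtain h l where hl: "reduced h l" "elem h l = g" using elem_surj[OF assms(1)] .
  obtain h' l' where hl': "reduced h' l'" "elem h' l' = g \<cdot> base x"
    "map fst l' = map fst l" "l \<noteq> [] \<Longrightarrow> h' = h"
    using elem_base_right[OF hl(1) assms(2)] hl(2) by metis
  have "l \<noteq> []" using assms(3) edge_elem[OF hl(1)] hl(2) by auto
  then have "fst (hd l') = fst (hd l)" "l' \<noteq> []" "h' = h"
    using hl'(3,4) by (cases l; cases l'; simp)+
  then show ?thesis
    using edge_elem[OF hl(1)] edge_elem[OF hl'(1)] hl(2) hl'(2) \<open>l \<noteq> []\<close> by simp
qed

lemma edge_mult_stable:
  assumes "g \<in> carrier G" "edge g \<noteq> None" "edge (g \<cdot> stable e) \<noteq> None"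
  shows "edge (g \<cdot> stable e) = edge g"
proof -
  obtain h l where hl: "reduced h l" "elem h l = g" using elem_surj[OF assms(1)] .
  have l: "l \<noteq> []" using assms(2) edge_elem[OF hl(1)] hl(2) by auto
  show ?thesis
  proof (cases "pinched e l")
    case False
    from elem_stable_right_reduced[OF hl(1) this] show ?thesis
      using edge_elem[OF hl(1)] edge_elem[of h "l @ [(e, \<one>)]"] hl(2) l by simp
  next
    case True
    obtain h' l' where hl': "reduced h' l'" "elem h' l' = g \<cdot> stable e"
      "map fst l' = butlast (map fst l)" "l' \<noteq> [] \<Longrightarrow> h' = h"
      using elem_stable_right_pinched[OF hl(1) True] hl(2) by metis
    have l': "l' \<noteq> []" using assms(3) edge_elem[OF hl'(1)] hl'(2) by auto
    then have "fst (hd l') = fst (hd l)"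
      using hl'(3) l by (cases l; cases l'; auto split: if_splits)
    then show ?thesis
      using edge_elem[OF hl(1)] edge_elem[OF hl'(1)] hl(2) hl'(2,4) l l' by simp
  qed
qed

lemma syllable_mult_stable:
  assumes "g \<in> carrier G"
  shows "\<exists>e'. \<exists>a\<in>assoc e'. syllable (g \<cdot> stable e) = syllable g \<otimes> a"
proof -
  have *: "\<exists>a\<in>assoc e. syllable (base h \<cdot> stable e) = h \<otimes> a" if h: "h \<in> carrier H" for h e
  proof -
    have "reduced h [(e, \<one>)]" using h by (simp add: reduced_Cons)
    from nf_elem[OF this] show ?thesis by (auto simp: syllable_def base_one)
  qed
  consider (inside) h where "h \<in> carrier H" "g = base h"
    | (outside) h where "h \<in> carrier H" "g \<cdot> stable e = base h"
    | (neither) "edge g \<noteq> None" "edge (g \<cdot> stable e) \<noteq> None"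
    using edge_None_iff[OF assms] edge_None_iff[of "g \<cdot> stable e"] assms by auto
  then show ?thesis
  proof cases
    case inside
    then show ?thesis using *[of h e] by (auto simp: syllable_base)
  next
    case outside
    have "g = g \<cdot> stable e \<cdot> stable (\<not> e)"
      using assms stable_mult[of e] by (simp add: G.m_assoc)
    then have "g = base h \<cdot> stable (\<not> e)" using outside by simp
    then obtain a where a: "a \<in> assoc (\<not> e)" "syllable g = h \<otimes> a" using *[OF outside(1), of "\<not> e"] by blast
    then have "h = syllable g \<otimes> inv a" using outside(1) assoc_closed by (simp add: H.m_assoc)
    then have "syllable (g \<cdot> stable e) = syllable g \<otimes> inv a"
      using outside by (simp add: syllable_base)
    then show ?thesis using assoc_inv[OF a(1)] by blast
  next
    case neither
    then show ?thesis
      using edge_eq_imp_syllable[of g "g \<cdot> stable e"] edge_mult_stable[of g e] assms by auto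
  qed
qed

lemma syllable_mult_base:
  assumes "g \<in> carrier G" "x \<in> carrier H"
  shows "syllable (g \<cdot> base x) = syllable g \<otimes> x \<or>
    (\<exists>e. \<exists>a\<in>assoc e. syllable (g \<cdot> base x) = syllable g \<otimes> a)"
proof (cases "edge g = None")
  case True
  then obtain h where "h \<in> carrier H" "g = base h" using edge_None_iff[OF assms(1)] by blast
  then show ?thesis using assms by (simp add: base_mult syllable_base)
next
  case False
  then show ?thesis
    using edge_eq_imp_syllable[of g "g \<cdot> base x"] edge_mult_base[OF assms] assms by auto
qed

lemma stable_length_mult_base:
  assumes "g \<in> carrier G" "x \<in> carrier H"
  shows "stable_length (g \<cdot> base x) = stable_length g"
proof -
  obtain h l where hl: "reduced h l" "elem h l = g" using elem_surj[OF assms(1)] .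
  obtain h' l' where "reduced h' l'" "elem h' l' = g \<cdot> base x" "map fst l' = map fst l"
    using elem_base_right[OF hl(1) assms(2)] hl(2) by metis
  then show ?thesis using hl stable_length_elem map_eq_imp_length_eq by metis
qed

text \<open>Here \<open>k\<close> is the last syllable of \<open>g\<close> and \<open>e\<^sub>0\<close> the negative of its last exponent, if there is
  one: \<open>c t\<^sup>e\<close> can only cancel against the last stable letter of \<open>g\<close>.\<close>

lemma stable_length_step:
  assumes "g \<in> carrier G"
  obtains e\<^sub>0 k where "k \<in> carrier H" "\<And>e c. c \<in> carrier H \<Longrightarrow>
    stable_length (g \<cdot> base c \<cdot> stable e) = stable_length g + 1 \<or>
    (e = e\<^sub>0 \<and> k \<otimes> c \<in> assoc e \<and>
     stable_length (g \<cdot> base c \<cdot> stable e) + 1 = stable_length g)"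
proof -
  obtain h l where hl: "reduced h l" "elem h l = g" using elem_surj[OF assms] .
  have step: "stable_length (g \<cdot> base c \<cdot> stable e) = stable_length g + 1 \<or>
      (l \<noteq> [] \<and> e = (\<not> fst (last l)) \<and> last_syllable h l \<otimes> c \<in> assoc e \<and>
       stable_length (g \<cdot> base c \<cdot> stable e) + 1 = stable_length g)"
    if c: "c \<in> carrier H" for e c
  proof -
    obtain h' l' where hl': "reduced h' l'" "elem h' l' = g \<cdot> base c"
      "map fst l' = map fst l" "last_syllable h' l' = last_syllable h l \<otimes> c"
      using elem_base_right[OF hl(1) c] hl(2) by metis
    have len: "length l' = length l" using hl'(3) by (rule map_eq_imp_length_eq)
    show ?thesis
    proof (cases "pinched e l'")
      case False
      from elem_stable_right_reduced[OF hl'(1) this] show ?thesis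
        using stable_length_elem[of h' "l' @ [(e, \<one>)]"] stable_length_elem[OF hl(1)] hl'(2) hl(2) len
        by simp
    next
      case True
      then have l': "l' \<noteq> []" "fst (last l') = (\<not> e)" "snd (last l') \<in> assoc e"
        by (auto simp: pinched_def)
      have l: "l \<noteq> []" using l'(1) len by auto
      have "fst (last l) = fst (last l')"
        using hl'(3) l l'(1) by (metis last_map)
      moreover obtain h'' l'' where "reduced h'' l''"
        "elem h'' l'' = g \<cdot> base c \<cdot> stable e" "map fst l'' = butlast (map fst l')"
        using elem_stable_right_pinched[OF hl'(1) True] hl'(2) by metis
      moreover from this(3) have "length l'' = length l' - 1"
        by (metis length_butlast length_map)
      ultimately show ?thesis
        using l' l len hl'(4) hl stable_length_elem[of h'' l''] stable_length_elem[of h l]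
        by (auto simp: last_syllable_def)
    qed
  qed
  show ?thesis
    by (rule that[OF last_syllable_closed[OF hl(1)], of "\<not> fst (last l)"]) (use step in blast)
qed

text \<open>Inversion reverses a word and turns subwords \<open>t\<^sup>e k t\<^bsup>-e\<^esup>\<close> that can be cancelled into such subwords,
  so the formal inverse of a reduced word is reduced.\<close>

lemma inv_elem:
  assumes "reduced h l"
  shows "\<exists>l'. reduced (inv (last_syllable h l)) l' \<and>
    elem (inv (last_syllable h l)) l' = inv\<^bsub>G\<^esub> elem h l \<and>
    (if l = [] then l' = [] else l' \<noteq> [] \<and> fst (hd l') = (\<not> fst (last l)))"
  using assms
proof (induction l rule: rev_induct)
  case Nil
  then show ?case by (simp add: base_inv)
next
  case (snoc p l)
  obtain e k where p: "p = (e, k)" by (cases p)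
  let ?s = "last_syllable h l"
  have red: "reduced h l" and k: "k \<in> carrier H"
    and nopinch: "l \<noteq> [] \<Longrightarrow> snd (last l) \<in> assoc (\<not> fst (last l)) \<Longrightarrow> e = fst (last l)"
    using snoc.prems p by (auto simp: reduced_snoc)
  obtain l' where l': "reduced (inv ?s) l'" "elem (inv ?s) l' = inv\<^bsub>G\<^esub> elem h l"
    "if l = [] then l' = [] else l' \<noteq> [] \<and> fst (hd l') = (\<not> fst (last l))"
    using snoc.IH[OF red] by blast
  note s = last_syllable_closed[OF red]
  have s_assoc: "?s \<in> assoc e" if "inv ?s \<in> assoc e"
    using assoc_inv[OF that] s by simp
  have "reduced (inv k) ((\<not> e, inv ?s) # l')"
    using l' k nopinch s_assoc
    by (cases e; cases "fst (last l)") (auto simp: reduced_Cons last_syllable_def split: if_splits)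
  moreover have "elem (inv k) ((\<not> e, inv ?s) # l') = inv\<^bsub>G\<^esub> elem h (l @ [p])"
    using p k red elem_closed[OF red] l'(2)
    by (simp add: elem_snoc reduced_def G.inv_mult_group stable_inv base_inv G.m_assoc)
  ultimately show ?case using p by (intro exI[of _ "(\<not> e, inv ?s) # l'"]) simp
qed

text \<open>The point at which the path to the element of a reduced word enters its \<open>i\<close>-th vertex, that is,
  the product of the word up to its \<open>i\<close>-th stable letter; it is \<open>1\<close> for \<open>i = 0\<close>.\<close>

definition station :: "'a \<Rightarrow> (bool \<times> 'a) list \<Rightarrow> nat \<Rightarrow> 'a hnn_letter list set" where
  "station h l i = elem h (take i l) \<cdot> inv\<^bsub>G\<^esub> base (last_syllable h (take i l))"

lemma reduced_take_drop:
  assumes "reduced h l"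
  shows "reduced h (take i l)" "reduced (last_syllable h (take i l)) (drop i l)"
  using reduced_append[of h "take i l" "drop i l"] assms by simp_all

lemma station_closed: "reduced h l \<Longrightarrow> station h l i \<in> carrier G"
  using elem_closed[OF reduced_take_drop(1)] last_syllable_closed[OF reduced_take_drop(1)]
  by (simp add: station_def)

lemma station_to_elem:
  assumes "reduced h l"
  shows "inv\<^bsub>G\<^esub> station h l i \<cdot> elem h l = elem (last_syllable h (take i l)) (drop i l)"
proof -
  have "elem h (take i l @ drop i l) = station h l i \<cdot> elem (last_syllable h (take i l)) (drop i l)"
    unfolding station_def
    by (rule elem_append) (use assms in \<open>auto simp: reduced_def dest: in_set_takeD in_set_dropD\<close>)
  then show ?thesis
    using station_closed[OF assms] elem_closed[OF reduced_take_drop(2)[OF assms]]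
    by (simp flip: G.m_assoc)
qed

lemma edge_inv_station:
  assumes "reduced h l" "i \<le> length l"
  shows "edge (inv\<^bsub>G\<^esub> station h l i) =
    (if i = 0 then None else Some (\<not> fst (l ! (i - 1)), assoc (\<not> fst (l ! (i - 1)))))"
    and "\<exists>e. \<exists>a\<in>assoc e. syllable (inv\<^bsub>G\<^esub> station h l i) = a"
proof -
  have "edge (inv\<^bsub>G\<^esub> station h l i) =
    (if i = 0 then None else Some (\<not> fst (l ! (i - 1)), assoc (\<not> fst (l ! (i - 1))))) \<and>
    (\<exists>e. \<exists>a\<in>assoc e. syllable (inv\<^bsub>G\<^esub> station h l i) = a)"
  proof (cases i)
    case 0
    then have "station h l i = base \<one>"
      using assms by (simp add: station_def reduced_def base_one)
    then show ?thesis
      using 0 assoc_one by (auto simp: edge_base syllable_base base_inv[symmetric])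
  next
    case (Suc j)
    define e k where "e = fst (l ! j)" and "k = snd (l ! j)"
    have tk: "take i l = take j l @ [(e, k)]"
      using Suc assms(2) by (simp add: take_Suc_conv_app_nth e_def k_def)
    have red: "reduced h (take j l @ [(e, k)])"
      using reduced_take_drop(1)[OF assms(1), of i] by (simp add: tk)
    then have red1: "reduced h (take j l @ [(e, \<one>)])" and k: "k \<in> carrier H"
      by (auto simp: reduced_snoc)
    have "station h l i = elem h (take j l @ [(e, \<one>)])"
      unfolding station_def tk
      using red k elem_closed[of h "take j l"]
      by (simp add: elem_snoc reduced_snoc reduced_def base_one G.m_assoc)
    then obtain l' where l': "reduced \<one> l'" "elem \<one> l' = inv\<^bsub>G\<^esub> station h l i" "l' \<noteq> []"
      "fst (hd l') = (\<not> e)"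
      using inv_elem[OF red1] by auto
    have "\<one> <# assoc (\<not> e) = assoc (\<not> e)"
      by (rule H.lcos_mult_one[OF subgroup.subset[OF assoc_subgroup]])
    then show ?thesis
      using edge_elem[OF l'(1)] nf_elem[OF l'(1)] l' Suc assoc_closed
      by (auto simp: syllable_def e_def)
  qed
  then show "edge (inv\<^bsub>G\<^esub> station h l i) =
    (if i = 0 then None else Some (\<not> fst (l ! (i - 1)), assoc (\<not> fst (l ! (i - 1)))))"
    and "\<exists>e. \<exists>a\<in>assoc e. syllable (inv\<^bsub>G\<^esub> station h l i) = a" by blast+
qed

lemma station_vertices_distinct:
  assumes "reduced h l" "i < j" "j \<le> length l"
  shows "inv\<^bsub>G\<^esub> station h l i \<cdot> station h l j \<notin> base ` carrier H"
proof -
  let ?m = "take j l"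
  have red: "reduced h ?m" by (rule reduced_take_drop(1)[OF assms(1)])
  have st: "station h l i = station h ?m i" using assms(2) by (simp add: station_def)
  have s: "last_syllable h ?m \<in> carrier H" by (rule last_syllable_closed[OF red])
  have cl: "station h ?m i \<in> carrier G" "elem h ?m \<in> carrier G"
    by (rule station_closed[OF red], rule elem_closed[OF red])
  have "inv\<^bsub>G\<^esub> station h l i \<cdot> station h l j =
      inv\<^bsub>G\<^esub> station h ?m i \<cdot> elem h ?m \<cdot> base (inv (last_syllable h ?m))"
    using cl s by (simp add: st station_def[of h l j] base_inv G.m_assoc)
  also have "\<dots> = elem (last_syllable h (take i ?m)) (drop i ?m) \<cdot> base (inv (last_syllable h ?m))"
    by (simp only: station_to_elem[OF red])
  finally have eq: "inv\<^bsub>G\<^esub> station h l i \<cdot> station h l j = \<dots>" .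
  have red2: "reduced (last_syllable h (take i ?m)) (drop i ?m)"
    by (rule reduced_take_drop(2)[OF red])
  have "drop i ?m \<noteq> []" using assms by simp
  then have "edge (elem (last_syllable h (take i ?m)) (drop i ?m)) \<noteq> None"
    using edge_elem[OF red2] by simp
  then have "edge (inv\<^bsub>G\<^esub> station h l i \<cdot> station h l j) \<noteq> None"
    unfolding eq using edge_mult_base[OF elem_closed[OF red2], of "inv (last_syllable h ?m)"] s by simp
  moreover have "inv\<^bsub>G\<^esub> station h l i \<cdot> station h l j \<in> carrier G"
    using station_closed[OF assms(1)] by simp
  note edge_None_iff[OF this]
  ultimately show ?thesis by simp
qed

text \<open>Seen from the \<open>i\<close>-th station, the first edges towards the origin and towards the end of the path
  are different: equal edges would make the word cancel at its \<open>i\<close>-th syllable, and at either end of the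
  path exactly one of the two edges is missing.\<close>

lemma station_edges_differ:
  assumes "reduced h l" "i \<le> length l" "l \<noteq> []"
  shows "edge (inv\<^bsub>G\<^esub> station h l i) \<noteq> edge (inv\<^bsub>G\<^esub> station h l i \<cdot> elem h l)"
proof -
  let ?s = "last_syllable h (take i l)"
  have red: "reduced ?s (drop i l)" by (rule reduced_take_drop(2)[OF assms(1)])
  have s: "?s \<in> carrier H" by (rule reduced_closed[OF red])
  have e2: "edge (inv\<^bsub>G\<^esub> station h l i \<cdot> elem h l) =
      (if i = length l then None else Some (fst (l ! i), ?s <# assoc (fst (l ! i))))"
    unfolding station_to_elem[OF assms(1)] edge_elem[OF red] using assms(2)
    by (auto simp: hd_drop_conv_nth)
  show ?thesis
  proof (cases i)
    case 0
    then show ?thesis unfolding e2 edge_inv_station(1)[OF assms(1,2)] using assms(3) by auto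
  next
    case (Suc j)
    show ?thesis
    proof (cases "i = length l")
      case True
      then show ?thesis unfolding e2 edge_inv_station(1)[OF assms(1,2)] using Suc True assms(3) by simp
    next
      case False
      then have i: "Suc j < length l" using assms(2) Suc by simp
      have s_eq: "?s = snd (l ! j)" using i Suc by (simp add: last_syllable_def take_Suc_conv_app_nth)
      have "snd (l ! j) \<in> assoc (\<not> fst (l ! j)) \<longrightarrow> fst (l ! Suc j) = fst (l ! j)"
        using successively_nth[OF _ i] assms(1) unfolding reduced_def by blast
      moreover have "?s \<in> ?s <# assoc e" for e
        using s assoc_one[of e] by (force simp: l_coset_def)
      ultimately have "\<not> (fst (l ! Suc j) = (\<not> fst (l ! j)) \<and>
          ?s <# assoc (\<not> fst (l ! j)) = assoc (\<not> fst (l ! j)))"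
        using s_eq by metis
      moreover have "(if i = length l then None
          else Some (fst (l ! i), ?s <# assoc (fst (l ! i)))) =
          Some (fst (l ! Suc j), ?s <# assoc (fst (l ! Suc j)))"
        using False Suc by simp
      moreover have "edge (inv\<^bsub>G\<^esub> station h l i) =
          Some (\<not> fst (l ! j), assoc (\<not> fst (l ! j)))"
        using edge_inv_station(1)[OF assms(1,2)] Suc by simp
      ultimately show ?thesis unfolding e2 by (metis option.inject prod.inject)
    qed
  qed
qed

end

section \<open>Orthogonal copies of the sequence space\<close>

definition unit_vector :: "nat \<Rightarrow> ell2" where
  "unit_vector n = Abs_ell2 (\<lambda>m. if m = n then 1 else 0)"

lemma coord_unit_vector: "coord (unit_vector n) m = (if m = n then 1 else 0)"
proof -
  have "(\<lambda>m. (if m = n then 1 else 0 :: real)\<^sup>2) = (\<lambda>m. if m = n then 1 else 0)" by auto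
  then have "summable (\<lambda>m. (if m = n then 1 else 0 :: real)\<^sup>2)" by simp
  then show ?thesis unfolding unit_vector_def by (rule coord_Abs_ell2)
qed

lemma inner_unit_vector: "unit_vector m \<bullet> unit_vector n = (if m = n then 1 else 0)"
proof -
  have "unit_vector m \<bullet> unit_vector n = (\<Sum>k\<in>{m}. coord (unit_vector m) k * coord (unit_vector n) k)"
    unfolding inner_ell2_def by (rule suminf_finite) (auto simp: coord_unit_vector)
  then show ?thesis by (auto simp: coord_unit_vector)
qed

definition copy_basis :: "nat \<Rightarrow> nat \<Rightarrow> ell2" where
  "copy_basis i m = unit_vector (prod_encode (i, m))"

definition copy :: "nat \<Rightarrow> ell2 \<Rightarrow> ell2" where
  "copy i = synth (copy_basis i)"

lemma inner_copy_basis: "copy_basis i m \<bullet> copy_basis j n = (if i = j \<and> m = n then 1 else 0)"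
  by (auto simp: copy_basis_def inner_unit_vector)

lemma copy_basis_orth: "m \<noteq> n \<Longrightarrow> copy_basis i m \<bullet> copy_basis i n = 0"
  by (simp add: inner_copy_basis)

lemma copy_basis_norm: "copy_basis i m = 0 \<or> norm (copy_basis i m) = 1"
  by (simp add: norm_eq_sqrt_inner inner_copy_basis)

lemmas copy_facts = copy_basis_orth copy_basis_norm

lemma linear_copy: "linear (copy i)"
  unfolding copy_def by (rule linear_synth[where e = "copy_basis i", OF copy_facts])

lemma inner_copy: "copy i a \<bullet> copy j b = (if i = j then a \<bullet> b else 0)"
proof -
  have 1: "copy i a \<bullet> v = a \<bullet> coeffs (copy_basis i) v" for i a v
    unfolding copy_def by (rule inner_synth[where e = "copy_basis i", OF copy_facts])
  have cc: "coord (coeffs (copy_basis i) v) n = v \<bullet> copy_basis i n" for i v n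
    by (rule coord_coeffs[where e = "copy_basis i", OF copy_facts])
  have "coeffs (copy_basis j) (copy_basis i n) = 0" if "i \<noteq> j" for n
    by (rule ell2_eqI) (use that in \<open>simp add: cc inner_copy_basis\<close>)
  then have "copy j b \<bullet> copy_basis i n = 0" if "i \<noteq> j" for n
    unfolding 1 using that by simp
  then have "coeffs (copy_basis i) (copy j b) = 0" if "i \<noteq> j"
    using that by (intro ell2_eqI) (simp add: cc)
  moreover have "coeffs (copy_basis i) (copy i b) = b"
    by (rule ell2_eqI)
       (simp add: cc copy_def inner_synth_e[where e = "copy_basis i", OF copy_facts] inner_copy_basis)
  ultimately show ?thesis unfolding 1 by auto
qed

lemma norm_copy: "norm (copy i a) = norm a"
  by (simp add: norm_eq_sqrt_inner inner_copy)

lemma norm_copy_add: "i \<noteq> j \<Longrightarrow> (norm (copy i a + copy j b))\<^sup>2 = (norm a)\<^sup>2 + (norm b)\<^sup>2"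
  by (subst norm_add_Pythagorean) (auto simp: orthogonal_def inner_copy norm_copy)


section \<open>Inducing a left-invariant map from a subgroup\<close>

text \<open>A map \<open>\<beta>\<close> on \<open>G\<close> whose distances are invariant under a subgroup \<open>L\<close> induces a left-invariant map
  into the sum of copies of the target space over \<open>G/L\<close>: the coordinate of the image of \<open>x\<close> at the
  coset \<open>r L\<close> is \<open>\<beta> (inv r x)\<close>, renormalised by subtracting its value at \<open>x = 1\<close>. The finiteness
  assumption makes the renormalised sums finite.\<close>

theorem induced_left_invariant:
  fixes G :: "('a, 'b) monoid_scheme" (structure) and \<beta> :: "'a \<Rightarrow> ell2"
  assumes "group G" and count: "countable (carrier G)" and L: "subgroup L G"
    and inv: "\<And>h x y. h \<in> L \<Longrightarrow> x \<in> carrier G \<Longrightarrow> y \<in> carrier G \<Longrightarrow>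
      norm (\<beta> (h \<otimes> x) - \<beta> (h \<otimes> y)) = norm (\<beta> x - \<beta> y)"
    and fin: "\<And>x. x \<in> carrier G \<Longrightarrow> \<exists>R. finite R \<and> R \<subseteq> carrier G \<and>
      (\<forall>g\<in>carrier G. \<beta> (inv g \<otimes> x) \<noteq> \<beta> (inv g) \<longrightarrow> (\<exists>r\<in>R. inv r \<otimes> g \<in> L))"
  obtains B :: "'a \<Rightarrow> ell2" where "left_invariant G B"
    "\<And>x y (I :: nat set) p. x \<in> carrier G \<Longrightarrow> y \<in> carrier G \<Longrightarrow> finite I \<Longrightarrow> p ` I \<subseteq> carrier G \<Longrightarrow>
       (\<And>i j. i \<in> I \<Longrightarrow> j \<in> I \<Longrightarrow> i \<noteq> j \<Longrightarrow> inv p i \<otimes> p j \<notin> L) \<Longrightarrow>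
       (\<Sum>i\<in>I. (norm (\<beta> (inv p i \<otimes> x) - \<beta> (inv p i \<otimes> y)))\<^sup>2) \<le> (norm (B x - B y))\<^sup>2"
proof -
  interpret group G by fact
  interpret L: subgroup L G by fact
  define \<rho> where "\<rho> x = (SOME y. y \<in> carrier G \<and> inv x \<otimes> y \<in> L)" for x
  have \<rho>: "\<rho> x \<in> carrier G \<and> inv x \<otimes> \<rho> x \<in> L" if "x \<in> carrier G" for x
    unfolding \<rho>_def by (rule someI[of _ x]) (use that L.one_closed in simp)
  have sym: "inv y \<otimes> x \<in> L" if "x \<in> carrier G" "y \<in> carrier G" "inv x \<otimes> y \<in> L" for x y
    using L.m_inv_closed[OF that(3)] that by (simp add: inv_mult_group)
  have trans: "inv x \<otimes> z \<in> L" if "x \<in> carrier G" "y \<in> carrier G" "z \<in> carrier G"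
    "inv x \<otimes> y \<in> L" "inv y \<otimes> z \<in> L" for x y z
  proof -
    have "inv x \<otimes> z = (inv x \<otimes> y) \<otimes> (inv y \<otimes> z)"
      using that(1-3) by (simp add: m_assoc) (simp flip: m_assoc)
    then show ?thesis using L.m_closed[OF that(4,5)] by simp
  qed
  have \<rho>_eq: "\<rho> x = \<rho> y" if "x \<in> carrier G" "y \<in> carrier G" "inv x \<otimes> y \<in> L" for x y
  proof -
    have "inv x \<otimes> z \<in> L \<longleftrightarrow> inv y \<otimes> z \<in> L" if "z \<in> carrier G" for z
      using trans sym that \<open>x \<in> _\<close> \<open>y \<in> _\<close> \<open>inv x \<otimes> y \<in> L\<close> by metis
    then show ?thesis unfolding \<rho>_def by metis
  qed
  define R where "R = \<rho> ` carrier G"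
  have R_closed: "r \<in> carrier G" if "r \<in> R" for r using that \<rho> by (auto simp: R_def)
  have \<rho>_R: "\<rho> r = r" if r: "r \<in> R" for r
  proof -
    obtain x where x: "x \<in> carrier G" "r = \<rho> x" using r by (auto simp: R_def)
    then show ?thesis using \<rho>_eq[of x "\<rho> x"] \<rho>[OF x(1)] by simp
  qed
  define q where "q r x y = (norm (\<beta> (inv r \<otimes> x) - \<beta> (inv r \<otimes> y)))\<^sup>2" for r x y
  have q_coset: "q p x y = q r x y"
    if "p \<in> carrier G" "r \<in> carrier G" "x \<in> carrier G" "y \<in> carrier G" "inv p \<otimes> r \<in> L" for p r x y
  proof -
    have "inv p \<otimes> z = (inv p \<otimes> r) \<otimes> (inv r \<otimes> z)" if "z \<in> carrier G" for z
      using that \<open>p \<in> _\<close> \<open>r \<in> _\<close> by (simp add: m_assoc) (simp flip: m_assoc)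
    then show ?thesis
      using inv[OF that(5), of "inv r \<otimes> x" "inv r \<otimes> y"] that(1-4)
      unfolding q_def by (metis inv_closed m_closed)
  qed
  have q_\<rho>: "q (\<rho> p) x y = q p x y" if "p \<in> carrier G" "x \<in> carrier G" "y \<in> carrier G" for p x y
    using q_coset[of p "\<rho> p" x y] \<rho>[OF that(1)] that by simp
  have q_translate: "q (g \<otimes> r) (g \<otimes> x) (g \<otimes> y) = q r x y"
    if "g \<in> carrier G" "r \<in> carrier G" "x \<in> carrier G" "y \<in> carrier G" for g r x y
  proof -
    have "inv (g \<otimes> r) \<otimes> (g \<otimes> z) = inv r \<otimes> z" if "z \<in> carrier G" for z
    proof -
      have "inv g \<otimes> (g \<otimes> z) = z" using that \<open>g \<in> _\<close> by (simp flip: m_assoc)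
      then show ?thesis using that \<open>g \<in> _\<close> \<open>r \<in> _\<close> by (simp add: inv_mult_group m_assoc)
    qed
    then show ?thesis using that by (simp add: q_def)
  qed
  define supp where "supp x = {r \<in> R. \<beta> (inv r \<otimes> x) \<noteq> \<beta> (inv r)}" for x
  have supp_R: "supp x \<subseteq> R" for x by (auto simp: supp_def)
  have fin_supp: "finite (supp x)" if x: "x \<in> carrier G" for x
  proof -
    obtain Q where Q: "finite Q" "Q \<subseteq> carrier G"
      "\<And>g. g \<in> carrier G \<Longrightarrow> \<beta> (inv g \<otimes> x) \<noteq> \<beta> (inv g) \<Longrightarrow> \<exists>r\<in>Q. inv r \<otimes> g \<in> L"
      using fin[OF x] by blast
    have "supp x \<subseteq> \<rho> ` Q"
    proof
      fix r assume "r \<in> supp x"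
      then have r: "r \<in> R" "\<beta> (inv r \<otimes> x) \<noteq> \<beta> (inv r)" by (auto simp: supp_def)
      then obtain s where "s \<in> Q" "inv s \<otimes> r \<in> L" using Q(3)[OF R_closed] by blast
      then show "r \<in> \<rho> ` Q" using \<rho>_eq[of s r] Q(2) R_closed[OF r(1)] \<rho>_R[OF r(1)] by force
    qed
    then show ?thesis using Q(1) finite_surj by blast
  qed
  define idx where "idx = to_nat_on (carrier G)"
  have idx: "idx r \<noteq> idx s" if "r \<in> R" "s \<in> R" "r \<noteq> s" for r s
    using inj_on_to_nat_on[OF count] that R_closed unfolding idx_def inj_on_def by blast
  define B where
    "B x = (\<Sum>r\<in>supp x. copy (idx r) (\<beta> (inv r \<otimes> x) - \<beta> (inv r)))" for x
  have norm_B: "(norm (B x - B y))\<^sup>2 = (\<Sum>r\<in>A. q r x y)"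
    if A: "finite A" "A \<subseteq> R" "supp x \<subseteq> A" "supp y \<subseteq> A" for x y A
  proof -
    have ext: "B z = (\<Sum>r\<in>A. copy (idx r) (\<beta> (inv r \<otimes> z) - \<beta> (inv r)))" if "supp z \<subseteq> A" for z
      unfolding B_def
      by (rule sum.mono_neutral_left) (use A that in \<open>auto simp: supp_def linear_0[OF linear_copy]\<close>)
    have "B x - B y = (\<Sum>r\<in>A. copy (idx r) (\<beta> (inv r \<otimes> x) - \<beta> (inv r \<otimes> y)))"
      unfolding ext[OF A(3)] ext[OF A(4)] by (simp flip: sum_subtractf linear_diff[OF linear_copy])
    also have "(norm \<dots>)\<^sup>2 = (\<Sum>r\<in>A. (norm (copy (idx r) (\<beta> (inv r \<otimes> x) - \<beta> (inv r \<otimes> y))))\<^sup>2)"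
      using A(1,2) idx by (intro norm_sum_Pythagorean) (auto simp: pairwise_def orthogonal_def inner_copy)
    finally show ?thesis by (simp add: norm_copy q_def)
  qed
  define E where "E x y = {r \<in> R. q r x y \<noteq> 0}" for x y
  have norm_B_E: "(norm (B x - B y))\<^sup>2 = (\<Sum>r\<in>E x y. q r x y)"
    if "x \<in> carrier G" "y \<in> carrier G" for x y
  proof -
    have "(norm (B x - B y))\<^sup>2 = (\<Sum>r\<in>supp x \<union> supp y. q r x y)"
      using supp_R fin_supp that by (intro norm_B) auto
    also have "\<dots> = (\<Sum>r\<in>E x y. q r x y)"
      by (rule sum.mono_neutral_right)
         (use fin_supp that supp_R in \<open>auto simp: E_def supp_def q_def\<close>)
    finally show ?thesis .
  qed
  have \<rho>_translate: "\<rho> (g \<otimes> \<rho> z) = \<rho> (g \<otimes> z)" if "g \<in> carrier G" "z \<in> carrier G" for g z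
  proof (rule \<rho>_eq)
    note r = \<rho>[OF that(2)]
    have "inv g \<otimes> (g \<otimes> z) = z" using that by (simp flip: m_assoc)
    then show "inv (g \<otimes> \<rho> z) \<otimes> (g \<otimes> z) \<in> L"
      using that r sym[of z "\<rho> z"] by (simp add: inv_mult_group m_assoc)
  qed (use that \<rho> in auto)
  have cancel: "g \<otimes> (inv g \<otimes> z) = z" "inv g \<otimes> (g \<otimes> z) = z"
    if "g \<in> carrier G" "z \<in> carrier G" for g z
    using that by (simp_all flip: m_assoc)
  have "left_invariant G B"
    unfolding left_invariant_def
  proof (intro ballI)
    fix g x y assume g: "g \<in> carrier G" and x: "x \<in> carrier G" and y: "y \<in> carrier G"
    have q_shift: "q (\<rho> (inv g \<otimes> r)) x y = q r (g \<otimes> x) (g \<otimes> y)" if "r \<in> R" for r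
      using q_\<rho>[of "inv g \<otimes> r" x y] q_translate[of g "inv g \<otimes> r" x y] R_closed[OF that] g x y cancel
      by simp
    have q_shift': "q (\<rho> (g \<otimes> r)) (g \<otimes> x) (g \<otimes> y) = q r x y" if "r \<in> R" for r
      using q_\<rho>[of "g \<otimes> r" "g \<otimes> x" "g \<otimes> y"] q_translate[of g r x y] R_closed[OF that] g x y
      by simp
    have "(\<Sum>r\<in>E (g \<otimes> x) (g \<otimes> y). q r (g \<otimes> x) (g \<otimes> y)) = (\<Sum>r\<in>E x y. q r x y)"
    proof (rule sum.reindex_bij_witness[of _ "\<lambda>r. \<rho> (g \<otimes> r)" "\<lambda>r. \<rho> (inv g \<otimes> r)"])
      fix r assume "r \<in> E (g \<otimes> x) (g \<otimes> y)"
      then have r: "r \<in> R" "q r (g \<otimes> x) (g \<otimes> y) \<noteq> 0" by (auto simp: E_def)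
      show "\<rho> (g \<otimes> \<rho> (inv g \<otimes> r)) = r"
        using \<rho>_translate[of g "inv g \<otimes> r"] g R_closed[OF r(1)] cancel \<rho>_R[OF r(1)] by simp
      show "\<rho> (inv g \<otimes> r) \<in> E x y"
        using r g R_closed[OF r(1)] q_shift[OF r(1)] by (auto simp: E_def R_def)
      show "q (\<rho> (inv g \<otimes> r)) x y = q r (g \<otimes> x) (g \<otimes> y)" by (rule q_shift[OF r(1)])
    next
      fix r assume "r \<in> E x y"
      then have r: "r \<in> R" "q r x y \<noteq> 0" by (auto simp: E_def)
      show "\<rho> (inv g \<otimes> \<rho> (g \<otimes> r)) = r"
        using \<rho>_translate[of "inv g" "g \<otimes> r"] g R_closed[OF r(1)] cancel \<rho>_R[OF r(1)] by simp
      show "\<rho> (g \<otimes> r) \<in> E (g \<otimes> x) (g \<otimes> y)"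
        using r g R_closed[OF r(1)] q_shift'[OF r(1)] by (auto simp: E_def R_def)
    qed
    then have "(norm (B (g \<otimes> x) - B (g \<otimes> y)))\<^sup>2 = (norm (B x - B y))\<^sup>2"
      using norm_B_E g x y by simp
    then show "norm (B (g \<otimes> x) - B (g \<otimes> y)) = norm (B x - B y)" by simp
  qed
  moreover have "(\<Sum>i\<in>I. (norm (\<beta> (inv p i \<otimes> x) - \<beta> (inv p i \<otimes> y)))\<^sup>2) \<le> (norm (B x - B y))\<^sup>2"
    if x: "x \<in> carrier G" and y: "y \<in> carrier G" and I: "finite I" "p ` I \<subseteq> carrier G"
      and dis: "\<And>i j. i \<in> I \<Longrightarrow> j \<in> I \<Longrightarrow> i \<noteq> j \<Longrightarrow> inv p i \<otimes> p j \<notin> L"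
    for x y p and I :: "nat set"
  proof -
    have pG: "p i \<in> carrier G" if "i \<in> I" for i using I(2) that by blast
    have inj: "inj_on (\<lambda>i. \<rho> (p i)) I"
    proof (rule inj_onI, rule ccontr)
      fix i j assume ij: "i \<in> I" "j \<in> I" "\<rho> (p i) = \<rho> (p j)" "i \<noteq> j"
      have "inv p i \<otimes> p j \<in> L"
        using trans[of "p i" "\<rho> (p i)" "p j"] sym[of "p j" "\<rho> (p j)"] \<rho>[OF pG[OF ij(1)]]
          \<rho>[OF pG[OF ij(2)]] pG ij by simp
      then show False using dis ij by blast
    qed
    let ?A = "(\<lambda>i. \<rho> (p i)) ` I \<union> (supp x \<union> supp y)"
    have "(\<Sum>i\<in>I. q (p i) x y) = (\<Sum>i\<in>I. q (\<rho> (p i)) x y)"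
      using pG x y q_\<rho> by (intro sum.cong) auto
    also have "\<dots> = (\<Sum>r\<in>(\<lambda>i. \<rho> (p i)) ` I. q r x y)"
      by (simp add: sum.reindex[OF inj])
    also have "\<dots> \<le> (\<Sum>r\<in>?A. q r x y)"
      using I fin_supp x y by (intro sum_mono2) (auto simp: q_def)
    also have "\<dots> = (norm (B x - B y))\<^sup>2"
      using I fin_supp x y supp_R pG by (intro norm_B[symmetric]) (auto simp: R_def)
    finally show ?thesis by (simp add: q_def)
  qed
  ultimately show ?thesis using that by blast
qed

text \<open>Averaging over \<open>K\<close> replaces the orbit of the origin by the orbit of a fixed point of \<open>K\<close>. The new
  map is at bounded distance from the old one and can be applied to first syllables, which are only
  well defined up to right multiplication by certain elements of a finite subgroup.\<close>

lemma equivariant_average: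
  fixes H (structure) and f :: "'a \<Rightarrow> 'h::{real_inner, banach}"
  assumes "group H" and f: "equivariant H f" and K: "subgroup K H" "finite K"
    and exp: "compression_exponent H S f \<epsilon>"
  obtains f' :: "'a \<Rightarrow> 'h" where "left_invariant H f'" "compression_exponent H S f' \<epsilon>"
    "\<And>h k. h \<in> carrier H \<Longrightarrow> k \<in> K \<Longrightarrow> f' (h \<otimes> k) = f' h"
proof -
  interpret group H by fact
  interpret K: subgroup K H by fact
  obtain \<pi> b where "affine_isometric_action H \<pi> b"
    and eq: "\<And>x y. x \<in> carrier H \<Longrightarrow> y \<in> carrier H \<Longrightarrow> f (x \<otimes> y) = \<pi> x (f y) + b x"
    using f by (auto simp: equivariant_def)
  then have ot: "orthogonal_transformation (\<pi> x)" if "x \<in> carrier H" for x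
    using that by (auto simp: affine_isometric_action_def hom_def orthogonal_group_def)
  note lin = orthogonal_transformation_linear[OF ot]
  define f' where "f' h = (1 / real (card K)) *\<^sub>R (\<Sum>k\<in>K. f (h \<otimes> k))" for h
  have K0: "card K > 0" using K(2) K.one_closed by (metis card_gt_0_iff empty_iff)
  have "left_invariant H f'"
    unfolding left_invariant_def
  proof (intro ballI)
    fix g x y assume g: "g \<in> carrier H" and x: "x \<in> carrier H" and y: "y \<in> carrier H"
    have "f (g \<otimes> x \<otimes> k) - f (g \<otimes> y \<otimes> k) = \<pi> g (f (x \<otimes> k) - f (y \<otimes> k))" if "k \<in> K" for k
      using eq[OF g, of "x \<otimes> k"] eq[OF g, of "y \<otimes> k"] that g x y
      by (simp add: m_assoc linear_diff[OF lin])
    then have "f' (g \<otimes> x) - f' (g \<otimes> y) = \<pi> g (f' x - f' y)"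
      unfolding f'_def
      by (simp add: linear_scale[OF lin[OF g]] linear_sum[OF lin[OF g]]
          flip: sum_subtractf scaleR_diff_right)
    then show "norm (f' (g \<otimes> x) - f' (g \<otimes> y)) = norm (f' x - f' y)"
      using ot[OF g] by (simp add: orthogonal_transformation)
  qed
  moreover have "f' (h \<otimes> k) = f' h" if h: "h \<in> carrier H" and k: "k \<in> K" for h k
  proof -
    have "(\<Sum>j\<in>K. f (h \<otimes> k \<otimes> j)) = (\<Sum>j\<in>K. f (h \<otimes> j))"
      by (rule sum.reindex_bij_witness[of _ "\<lambda>j. inv k \<otimes> j" "\<lambda>j. k \<otimes> j"])
         (use h k in \<open>auto simp: m_assoc simp flip: m_assoc[of "inv k"] m_assoc[of k "inv k"]\<close>)
    then show ?thesis by (simp add: f'_def)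
  qed
  moreover have "compression_exponent H S f' \<epsilon>"
  proof -
    define M where "M = (\<Sum>k\<in>K. norm (f k - f \<one>))"
    have M0: "M \<ge> 0" unfolding M_def by (intro sum_nonneg) simp
    have close: "norm (f' x - f x) \<le> M" if x: "x \<in> carrier H" for x
    proof -
      have "(\<Sum>k\<in>K. f (x \<otimes> k) - f x) = real (card K) *\<^sub>R (f' x - f x)"
        using K0 by (simp add: f'_def sum_subtractf scaleR_diff_right sum_constant_scaleR)
      then have "real (card K) * norm (f' x - f x) = norm (\<Sum>k\<in>K. f (x \<otimes> k) - f x)"
        by simp
      also have "\<dots> \<le> (\<Sum>k\<in>K. norm (f (x \<otimes> k) - f x))" by (rule norm_sum)
      also have "\<dots> = M"
        unfolding M_def
        using left_invariantD[OF equivariant_imp_left_invariant[OF f] x _ one_closed] x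
        by (intro sum.cong) auto
      finally have "real (card K) * norm (f' x - f x) \<le> M" .
      moreover have "1 * norm (f' x - f x) \<le> real (card K) * norm (f' x - f x)"
        using K0 by (intro mult_right_mono) (auto simp: Suc_le_eq)
      ultimately show ?thesis by simp
    qed
    obtain C D where CD: "C > 0" "D \<ge> 0" and low: "\<And>x y. x \<in> carrier H \<Longrightarrow> y \<in> carrier H \<Longrightarrow>
        norm (f x - f y) \<ge> (1 / C) * word_dist H S x y powr \<epsilon> - D"
      using exp unfolding compression_exponent_def by blast
    have "(1 / C) * word_dist H S x y powr \<epsilon> - (D + 2 * M) \<le> norm (f' x - f' y)"
      if x: "x \<in> carrier H" and y: "y \<in> carrier H" for x y
    proof -
      have "f x - f y = (f' x - f' y) - (f' x - f x) + (f' y - f y)" by simp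
      then have "norm (f x - f y) \<le> norm (f' x - f' y) + norm (f' x - f x) + norm (f' y - f y)"
        using norm_triangle_ineq[of "(f' x - f' y) - (f' x - f x)" "f' y - f y"]
          norm_triangle_ineq4[of "f' x - f' y" "f' x - f x"] by simp
      then show ?thesis using low[OF x y] close[OF x] close[OF y] by simp
    qed
    moreover have "D + 2 * M \<ge> 0" using CD(2) M0 by simp
    ultimately show ?thesis unfolding compression_exponent_def using CD(1) by blast
  qed
  ultimately show ?thesis using that by blast
qed

section \<open>Upper bounds for the compression of an HNN extension\<close>

text \<open>\<open>K\<close> is a finite subgroup that contains both associated subgroups. The first syllable of an element
  is well defined up to right multiplication by associated elements, hence as a left coset of \<open>K\<close>.\<close>

locale finite_hnn_extension = hnn_extension H F \<theta>
  for H :: "('a, 'b) monoid_scheme" (structure) and F \<theta> +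
  fixes S :: "'a set" and T :: "'a hnn_letter list set set" and K :: "'a set"
  assumes S: "finite_symmetric_generating_set H S"
    and T: "finite_symmetric_generating_set (HNN H F \<theta>) T"
    and K: "subgroup K H" "finite K" "\<And>e. assoc e \<subseteq> K"
begin

abbreviation lenH :: "'a \<Rightarrow> nat" where "lenH \<equiv> word_length H S"
abbreviation lenG :: "'a hnn_letter list set \<Rightarrow> nat" where "lenG \<equiv> word_length G T"

lemma dominated_by_letters:
  fixes L :: "'a hnn_letter list set \<Rightarrow> real"
  assumes base: "\<And>h. h \<in> carrier H \<Longrightarrow> \<exists>C. \<forall>y\<in>carrier G. L (y \<cdot> base h) \<le> L y + C"
    and stable: "\<And>e. \<exists>C. \<forall>y\<in>carrier G. L (y \<cdot> stable e) \<le> L y + C"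
  obtains C where "C > 0" "\<And>x. x \<in> carrier G \<Longrightarrow> L x \<le> L \<one>\<^bsub>G\<^esub> + C * real (lenG x)"
proof -
  have prod: "\<exists>C. \<forall>y\<in>carrier G. L (y \<cdot> (g \<cdot> u)) \<le> L y + C"
    if g: "g \<in> carrier G" and u: "u \<in> carrier G"
      and ex: "\<exists>C. \<forall>y\<in>carrier G. L (y \<cdot> g) \<le> L y + C" "\<exists>C. \<forall>y\<in>carrier G. L (y \<cdot> u) \<le> L y + C"
    for g u
  proof -
    obtain C D where "\<And>y. y \<in> carrier G \<Longrightarrow> L (y \<cdot> g) \<le> L y + C"
      and "\<And>y. y \<in> carrier G \<Longrightarrow> L (y \<cdot> u) \<le> L y + D"
      using ex by blast
    then have "L (y \<cdot> (g \<cdot> u)) \<le> L y + (C + D)" if "y \<in> carrier G" for y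
      using that g u by (smt (verit) G.m_assoc G.m_closed)
    then show ?thesis by blast
  qed
  have "\<exists>C. \<forall>y\<in>carrier G. L (y \<cdot> x) \<le> L y + C" if "x \<in> carrier G" for x
    using that
  proof (induction x rule: G_induct)
    case one
    show ?case by (rule exI[of _ 0]) simp
  next
    case (base g h)
    then show ?case using prod assms(1) by simp
  next
    case (stable g e)
    then show ?case using prod assms(2) by simp
  qed
  from word_length_dominates[OF group_G T this] show ?thesis using that by blast
qed

lemma stable_length_dominated:
  obtains C where "C > 0" "\<And>x. x \<in> carrier G \<Longrightarrow> real (stable_length x) \<le> C * real (lenG x)"
proof -
  have "real (stable_length (y \<cdot> stable e)) \<le> real (stable_length y) + 1" if y: "y \<in> carrier G" for y e
  proof -
    obtain e\<^sub>0 k where "\<And>e c. c \<in> carrier H \<Longrightarrow>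
        stable_length (y \<cdot> base c \<cdot> stable e) = stable_length y + 1 \<or>
        (e = e\<^sub>0 \<and> k \<otimes> c \<in> assoc e \<and>
         stable_length (y \<cdot> base c \<cdot> stable e) + 1 = stable_length y)"
      using stable_length_step[OF y] by metis
    from this[of \<one> e] show ?thesis using y by (auto simp: base_one)
  qed
  then have "\<exists>C. \<forall>y\<in>carrier G. real (stable_length (y \<cdot> stable e)) \<le> real (stable_length y) + C" for e
    by blast
  moreover have "\<exists>C. \<forall>y\<in>carrier G. real (stable_length (y \<cdot> base h)) \<le> real (stable_length y) + C"
    if "h \<in> carrier H" for h
    using that by (intro exI[of _ 0]) (simp add: stable_length_mult_base)
  ultimately obtain C where "C > 0" "\<And>x. x \<in> carrier G \<Longrightarrow>
      real (stable_length x) \<le> real (stable_length \<one>\<^bsub>G\<^esub>) + C * real (lenG x)"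
    using dominated_by_letters[of "\<lambda>g. real (stable_length g)"] by metis
  then show ?thesis using that by (simp add: stable_length_one)
qed

text \<open>Passing to the first syllable is the identity on \<open>H\<close>, and appending a letter multiplies the first
  syllable by an element of the finite group \<open>K\<close>, or by that letter itself.\<close>

lemma base_undistorted:
  obtains C where "C > 0" "\<And>h. h \<in> carrier H \<Longrightarrow> real (lenH h) \<le> C * real (lenG (base h))"
proof -
  define M where "M = (\<Sum>k\<in>K. real (lenH k))"
  have M: "real (lenH a) \<le> M" if "a \<in> assoc e" for a e
    using member_le_sum[of a K "\<lambda>k. real (lenH k)"] K that unfolding M_def by auto
  have M0: "M \<ge> 0" unfolding M_def by (intro sum_nonneg) simp
  have le: "real (lenH (syllable y \<otimes> a)) \<le> real (lenH (syllable y)) + real (lenH a)"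
    if "y \<in> carrier G" "a \<in> carrier H" for y a
    using word_length_mult_le[OF H.is_group S syllable_closed[OF that(1)] that(2)] by simp
  have "\<exists>C. \<forall>y\<in>carrier G. real (lenH (syllable (y \<cdot> stable e))) \<le> real (lenH (syllable y)) + C" for e
  proof (intro exI ballI)
    fix y assume y: "y \<in> carrier G"
    then obtain e' a where "a \<in> assoc e'" "syllable (y \<cdot> stable e) = syllable y \<otimes> a"
      using syllable_mult_stable[OF y, of e] by blast
    then show "real (lenH (syllable (y \<cdot> stable e))) \<le> real (lenH (syllable y)) + M"
      using le[OF y assoc_closed, of a e'] M[of a e'] by simp
  qed
  moreover have "\<exists>C. \<forall>y\<in>carrier G. real (lenH (syllable (y \<cdot> base h))) \<le> real (lenH (syllable y)) + C"
    if h: "h \<in> carrier H" for h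
  proof (intro exI ballI)
    fix y assume y: "y \<in> carrier G"
    consider "syllable (y \<cdot> base h) = syllable y \<otimes> h"
      | e a where "a \<in> assoc e" "syllable (y \<cdot> base h) = syllable y \<otimes> a"
      using syllable_mult_base[OF y h] by blast
    then show "real (lenH (syllable (y \<cdot> base h))) \<le> real (lenH (syllable y)) + (M + real (lenH h))"
    proof cases
      case 1
      then show ?thesis using le[OF y h] M0 by simp
    next
      case 2
      then show ?thesis using le[OF y assoc_closed, of a e] M[of a e] by simp
    qed
  qed
  ultimately obtain C where C: "C > 0" "\<And>x. x \<in> carrier G \<Longrightarrow>
      real (lenH (syllable x)) \<le> real (lenH (syllable \<one>\<^bsub>G\<^esub>)) + C * real (lenG x)"
    using dominated_by_letters[of "\<lambda>g. real (lenH (syllable g))"] by metis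
  have "lenH (syllable \<one>\<^bsub>G\<^esub>) = 0"
    using syllable_base[of \<one>] word_length_one[OF H.is_group S] by (simp add: base_one)
  then have "real (lenH h) \<le> C * real (lenG (base h))" if "h \<in> carrier H" for h
    using C(2)[of "base h"] that by (simp add: syllable_base)
  then show ?thesis using that[OF C(1)] by blast
qed

text \<open>Since the base group is undistorted, an equivariant map on \<open>G\<close> restricts to one on \<open>H\<close> with the
  same exponents.\<close>

theorem equivariant_compression_le_base:
  "equivariant_compression G T \<le> equivariant_compression H S"
proof (rule equivariant_compression_least)
  show "0 \<le> equivariant_compression H S" by (rule equivariant_compression_bounds)
  fix f :: "'a hnn_letter list set \<Rightarrow> ell2"
  assume eq: "equivariant G f" and lip: "lipschitz_uniform_embedding G T f"
  obtain C where C: "C > 0" "\<And>h. h \<in> carrier H \<Longrightarrow> real (lenH h) \<le> C * real (lenG (base h))"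
    using base_undistorted by blast
  have dist: "word_dist H S x y / C \<le> word_dist G T (base x) (base y)"
    if "x \<in> carrier H" "y \<in> carrier H" for x y
    using C(1) C(2)[of "inv x \<otimes> y"] that
    by (simp add: word_dist_def base_mult base_inv[symmetric] field_simps)
  have pos: "0 \<le> word_dist H S x y / C" for x y using C(1) by (simp add: word_dist_def)
  obtain \<pi> b where act: "affine_isometric_action G \<pi> b"
    and fe: "\<And>x y. x \<in> carrier G \<Longrightarrow> y \<in> carrier G \<Longrightarrow> f (x \<cdot> y) = \<pi> x (f y) + b x"
    using eq by (auto simp: equivariant_def)
  have eqH: "equivariant H (\<lambda>h. f (base h))"
    unfolding equivariant_def affine_isometric_action_def
  proof (intro exI[of _ "\<lambda>h. \<pi> (base h)"] exI[of _ "\<lambda>h. b (base h)"] conjI ballI)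
    show "(\<lambda>h. \<pi> (base h)) \<in> hom H orthogonal_group"
      using act by (auto simp: affine_isometric_action_def hom_def base_mult[symmetric] Pi_def)
    show "b (base (x \<otimes> y)) = \<pi> (base x) (b (base y)) + b (base x)"
      if "x \<in> carrier H" "y \<in> carrier H" for x y
      using act that by (simp add: affine_isometric_action_def base_mult[symmetric])
    show "f (base (x \<otimes> y)) = \<pi> (base x) (f (base y)) + b (base x)"
      if "x \<in> carrier H" "y \<in> carrier H" for x y
      using fe that by (simp add: base_mult[symmetric])
  qed
  obtain \<rho> where \<rho>: "mono_on {0..} \<rho>" "\<rho> ` {0..} \<subseteq> {0..}" "filterlim \<rho> at_top at_top"
    and low: "\<And>x y. x \<in> carrier G \<Longrightarrow> y \<in> carrier G \<Longrightarrow> \<rho> (word_dist G T x y) \<le> norm (f x - f y)"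
    using lip unfolding lipschitz_uniform_embedding_def uniform_embedding_with_def by blast
  obtain L where L: "L > 0" "\<And>x y. x \<in> carrier H \<Longrightarrow> y \<in> carrier H \<Longrightarrow>
      norm (f (base x) - f (base y)) \<le> L * word_dist H S x y"
    using left_invariant_lipschitz[OF H.is_group S equivariant_imp_left_invariant[OF eqH]] by blast
  have "uniform_embedding_with H S (\<lambda>h. f (base h)) (\<lambda>t. \<rho> (t / C)) (\<lambda>t. L * t)"
    unfolding uniform_embedding_with_def
  proof (intro conjI ballI)
    show "mono_on {0..} (\<lambda>t. \<rho> (t / C))"
      using \<rho>(1) C(1) by (auto simp: mono_on_def divide_right_mono)
    show "mono_on {0..} ((*) L)" using L(1) by (auto simp: mono_on_def)
    show "(\<lambda>t. \<rho> (t / C)) ` {0..} \<subseteq> {0..}" using \<rho>(2) C(1) by (auto simp: image_subset_iff)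
    show "(*) L ` {0..} \<subseteq> {0..}" using L(1) by auto
    have "filterlim (\<lambda>t. t / C) at_top at_top" using C(1) by real_asymp
    from filterlim_compose[OF \<rho>(3) this] show "filterlim (\<lambda>t. \<rho> (t / C)) at_top at_top" .
    fix x y assume x: "x \<in> carrier H" and y: "y \<in> carrier H"
    have "\<rho> (word_dist H S x y / C) \<le> \<rho> (word_dist G T (base x) (base y))"
      using \<rho>(1) dist[OF x y] pos[of x y] by (auto simp: mono_on_def intro: order_trans)
    also have "\<dots> \<le> norm (f (base x) - f (base y))" using low x y by simp
    finally show "\<rho> (word_dist H S x y / C) \<le> norm (f (base x) - f (base y))" .
    show "norm (f (base x) - f (base y)) \<le> L * word_dist H S x y" by (rule L(2)[OF x y])
  qed
  then have "lipschitz_uniform_embedding H S (\<lambda>h. f (base h))"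
    using L(1) unfolding lipschitz_uniform_embedding_def by blast
  then have "compression H S (\<lambda>h. f (base h)) \<le> equivariant_compression H S"
    by (rule compression_le_equivariant_compression[OF H.is_group S eqH])
  moreover have "compression G T f \<le> compression H S (\<lambda>h. f (base h))"
  proof (rule compression_le_compression)
    fix \<epsilon> :: real assume \<epsilon>: "0 \<le> \<epsilon>" and "compression_exponent G T f \<epsilon>"
    then obtain B D where BD: "B > 0" "D \<ge> 0" and lowG: "\<And>x y. x \<in> carrier G \<Longrightarrow> y \<in> carrier G \<Longrightarrow>
        norm (f x - f y) \<ge> (1 / B) * word_dist G T x y powr \<epsilon> - D"
      unfolding compression_exponent_def by blast
    have "1 / (B * C powr \<epsilon>) * word_dist H S x y powr \<epsilon> - D \<le> norm (f (base x) - f (base y))"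
      if x: "x \<in> carrier H" and y: "y \<in> carrier H" for x y
    proof -
      have "1 / (B * C powr \<epsilon>) * word_dist H S x y powr \<epsilon> = (1 / B) * (word_dist H S x y / C) powr \<epsilon>"
        using C(1) by (simp add: powr_divide word_dist_def)
      also have "\<dots> \<le> (1 / B) * word_dist G T (base x) (base y) powr \<epsilon>"
        using BD(1) \<epsilon> dist[OF x y] pos by (intro mult_left_mono powr_mono2) auto
      finally show ?thesis using lowG[of "base x" "base y"] x y by simp
    qed
    then show "compression_exponent H S (\<lambda>h. f (base h)) \<epsilon>"
      unfolding compression_exponent_def using BD C(1)
      by (intro exI[of _ "B * C powr \<epsilon>"] conjI exI[of _ D] ballI) auto
  qed
  ultimately show "compression G T f \<le> equivariant_compression H S" by simp
qed

text \<open>If both associated subgroups are proper, then \<open>t\<close> and \<open>a t b\<inverse>\<close> with \<open>a\<close> and \<open>b\<close> outside them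
  are free generators: the four steps \<open>t\<close>, \<open>t\<inverse>\<close>, \<open>a t b\<inverse>\<close> and \<open>b t\<inverse> a\<inverse>\<close> leave the vertex \<open>H\<close> of the
  Bass-Serre tree through different edges, so at most one of them shortens a given element.\<close>

theorem equivariant_compression_le_half:
  assumes a: "a \<in> carrier H" "a \<notin> assoc True" and b: "b \<in> carrier H" "b \<notin> assoc False"
  shows "equivariant_compression G T \<le> 1 / 2"
proof (rule ccontr)
  assume "\<not> equivariant_compression G T \<le> 1 / 2"
  then obtain \<epsilon> where \<epsilon>: "1 / 2 < \<epsilon>" "\<epsilon> < equivariant_compression G T"
    using dense[of "1 / 2" "equivariant_compression G T"] by auto
  then obtain f :: "'a hnn_letter list set \<Rightarrow> ell2"
    where f: "equivariant G f" "compression_exponent G T f \<epsilon>"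
    using exponent_below_equivariant_compression[of \<epsilon> G T] by auto
  obtain C where C: "C > 0" "\<And>x. x \<in> carrier G \<Longrightarrow> real (stable_length x) \<le> C * real (lenG x)"
    using stable_length_dominated by blast
  define step where "step c e d = base c \<cdot> stable e \<cdot> base d" for c e d
  define us where "us = [step \<one> True \<one>, step \<one> False \<one>, step a True (inv b), step b False (inv a)]"
  have us: "set us \<subseteq> carrier G" using a b by (auto simp: us_def step_def)
  have inv_step: "inv\<^bsub>G\<^esub> step c e d = step (inv d) (\<not> e) (inv c)"
    if "c \<in> carrier H" "d \<in> carrier H" for c e d
    using that by (simp add: step_def G.inv_mult_group stable_inv base_inv G.m_assoc)
  have sym: "mset (map (\<lambda>x. inv\<^bsub>G\<^esub> x) us) = mset us"
    using a b by (simp add: us_def inv_step)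
  have drift: "(\<Sum>u\<leftarrow>us. real (stable_length (g \<cdot> u))) \<ge>
      real (length us) * (real (stable_length g) + 1 / 2)" if g: "g \<in> carrier G" for g
  proof -
    obtain e\<^sub>0 k where k: "k \<in> carrier H" and move: "\<And>e c. c \<in> carrier H \<Longrightarrow>
        stable_length (g \<cdot> base c \<cdot> stable e) = stable_length g + 1 \<or>
        (e = e\<^sub>0 \<and> k \<otimes> c \<in> assoc e \<and>
         stable_length (g \<cdot> base c \<cdot> stable e) + 1 = stable_length g)"
      using stable_length_step[OF g] by metis
    define m where "m c e = real (stable_length (g \<cdot> base c \<cdot> stable e)) - real (stable_length g)"
      for c e
    have m: "m c e = 1 \<or> (e = e\<^sub>0 \<and> k \<otimes> c \<in> assoc e \<and> m c e = - 1)" if "c \<in> carrier H" for c e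
      using move[OF that, of e] by (auto simp: m_def)
    have eq: "real (stable_length (g \<cdot> step c e d)) = real (stable_length g) + m c e"
      if "c \<in> carrier H" "d \<in> carrier H" for c e d
      using stable_length_mult_base[of "g \<cdot> base c \<cdot> stable e" d] that g
      by (simp add: step_def m_def G.m_assoc)
    have one_bad: "\<not> (k \<otimes> \<one> \<in> assoc e \<and> k \<otimes> c \<in> assoc e)" if "c \<in> carrier H" "c \<notin> assoc e" for c e
      using assoc_mult_cancel_left[of c k e] that k by auto
    have "m \<one> True + m \<one> False + m a True + m b False \<ge> 2"
      using m[of \<one> True] m[of \<one> False] m[of a True] m[of b False] a b
        one_bad[OF a] one_bad[OF b] by auto
    then show ?thesis using a b by (simp add: us_def eq)
  qed
  have "\<epsilon> \<le> 1 / 2"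
    by (rule positive_drift_exponent_le_half[OF group_G us sym _ drift _ _ C(2) C(1)
          equivariant_imp_left_invariant[OF f(1)] f(2)])
       (auto simp: us_def)
  then show False using \<epsilon>(1) by simp
qed

end

section \<open>The lower bound for the compression of an HNN extension\<close>

lemma powr_add_le:
  fixes a b :: real
  assumes "0 \<le> a" "0 \<le> b" "0 < p" "p \<le> 1"
  shows "(a + b) powr p \<le> a powr p + b powr p"
proof -
  have part: "x * (a + b) powr (p - 1) \<le> x powr p" if "0 \<le> x" "x \<le> a + b" for x
  proof (cases "x = 0")
    case False
    then have "(a + b) powr (p - 1) \<le> x powr (p - 1)"
      using that assms(4) by (intro powr_mono2') auto
    then have "x * (a + b) powr (p - 1) \<le> x * x powr (p - 1)"
      using that by (intro mult_left_mono) auto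
    then show ?thesis using that False by (simp add: powr_diff)
  qed simp
  show ?thesis
  proof (cases "a + b = 0")
    case True
    then show ?thesis using assms by simp
  next
    case False
    then have "(a + b) powr p = (a + b) * (a + b) powr (p - 1)"
      using assms by (simp add: powr_diff)
    then show ?thesis using part[of a] part[of b] assms by (simp add: distrib_right)
  qed
qed

lemma powr_sum_list_le:
  fixes \<phi> :: "'c \<Rightarrow> real"
  assumes "\<And>x. 0 \<le> \<phi> x" "0 < p" "p \<le> 1"
  shows "(\<Sum>x\<leftarrow>xs. \<phi> x) powr p \<le> (\<Sum>x\<leftarrow>xs. \<phi> x powr p)"
proof (induction xs)
  case (Cons x xs)
  have "0 \<le> (\<Sum>x\<leftarrow>xs. \<phi> x)" using assms(1) by (intro sum_list_nonneg) auto
  then have "(\<phi> x + (\<Sum>x\<leftarrow>xs. \<phi> x)) powr p \<le> \<phi> x powr p + (\<Sum>x\<leftarrow>xs. \<phi> x) powr p"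
    using assms by (intro powr_add_le) auto
  then show ?case using Cons by simp
qed simp

context finite_hnn_extension
begin

lemma lenG_elem_le:
  obtains C where "C > 0" "\<And>h l. reduced h l \<Longrightarrow>
    real (lenG (elem h l)) \<le> C * (real (length l) + (\<Sum>x\<leftarrow>h # map snd l. real (lenH x)))"
proof -
  have "\<exists>C. \<forall>y\<in>carrier H. real (lenG (base (y \<otimes> x))) \<le> real (lenG (base y)) + C"
    if x: "x \<in> carrier H" for x
    using word_length_mult_le[OF group_G T base_closed base_closed[OF x]] x
    by (intro exI[of _ "real (lenG (base x))"]) (simp add: base_mult flip: of_nat_add)
  from word_length_dominates[OF H.is_group S this]
  obtain C where C: "C > 0" "\<And>x. x \<in> carrier H \<Longrightarrow>
      real (lenG (base x)) \<le> real (lenG (base \<one>)) + C * real (lenH x)" by blast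
  have base_le: "real (lenG (base x)) \<le> C * real (lenH x)" if "x \<in> carrier H" for x
    using C(2)[OF that] word_length_one[OF group_G T] by (simp add: base_one)
  define D where "D = C + real (lenG (stable True)) + real (lenG (stable False))"
  have D: "D > 0" "C \<le> D" "real (lenG (stable e)) \<le> D" for e
    using C(1) by (cases e; simp add: D_def)+
  have base_le': "real (lenG (base x)) \<le> D * real (lenH x)" if "x \<in> carrier H" for x
    using base_le[OF that] mult_right_mono[OF D(2), of "real (lenH x)"] by simp
  have "real (lenG (elem h l)) \<le> D * (real (length l) + (\<Sum>x\<leftarrow>h # map snd l. real (lenH x)))"
    if "reduced h l" for h l
    using that
  proof (induction h l rule: elem.induct)
    case (1 h)
    then show ?case using base_le' by simp
  next
    case (2 h e k l)
    then have h: "h \<in> carrier H" and red: "reduced k l" by (auto simp: reduced_Cons)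
    note cl = elem_closed[OF red]
    have "lenG (elem h ((e, k) # l)) \<le> lenG (base h) + (lenG (stable e) + lenG (elem k l))"
      using word_length_mult_le[OF group_G T base_closed[OF h], of "stable e \<cdot> elem k l"]
        word_length_mult_le[OF group_G T stable_closed[of e] cl] cl by simp
    then have "real (lenG (elem h ((e, k) # l))) \<le>
        real (lenG (base h)) + (real (lenG (stable e)) + real (lenG (elem k l)))"
      by (simp flip: of_nat_add)
    then show ?case
      using base_le'[OF h] D(3)[of e] 2(1)[OF red] by (simp add: algebra_simps)
  qed
  then show ?thesis using that[OF D(1)] by blast
qed

text \<open>The edges of the Bass-Serre tree at the vertex \<open>H\<close> are represented by orthonormal vectors, and the
  absence of an edge by \<open>0\<close>, so that different values have distance at least \<open>1\<close>.\<close>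

definition edge_set :: "(bool \<times> 'a set) set" where
  "edge_set = (\<lambda>(e, h). (e, h <# assoc e)) ` (UNIV \<times> carrier H)"

definition edge_vector :: "(bool \<times> 'a set) option \<Rightarrow> ell2" where
  "edge_vector z = (case z of None \<Rightarrow> 0 | Some w \<Rightarrow> unit_vector (to_nat_on edge_set w))"

lemma countable_edge_set: "countable edge_set"
  unfolding edge_set_def
  using countable_finitely_generated[OF H.is_group S] by (intro countable_image countable_SIGMA) auto

lemma edge_mem: "g \<in> carrier G \<Longrightarrow> edge g = Some w \<Longrightarrow> w \<in> edge_set"
  using syllable_closed by (auto simp: edge_def edge_set_def split: list.splits)

lemma edge_vector_dist:
  assumes "x \<in> carrier G" "y \<in> carrier G"
  shows "(norm (edge_vector (edge x) - edge_vector (edge y)))\<^sup>2 =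
    (if edge x = edge y then 0 else if edge x = None \<or> edge y = None then 1 else 2)"
proof -
  have inj: "to_nat_on edge_set v = to_nat_on edge_set w \<longleftrightarrow> v = w"
    if "v \<in> edge_set" "w \<in> edge_set" for v w
    using countable_edge_set that by (rule to_nat_on_inj)
  show ?thesis
    using edge_mem[OF assms(1)] edge_mem[OF assms(2)]
    by (cases "edge x"; cases "edge y")
       (auto simp: edge_vector_def power2_norm_eq_inner inner_unit_vector inner_diff_left
         inner_diff_right inj)
qed

lemma edge_vector_separated:
  assumes "x \<in> carrier G" "y \<in> carrier G" "edge x \<noteq> edge y"
  shows "1 \<le> (norm (edge_vector (edge x) - edge_vector (edge y)))\<^sup>2"
  unfolding edge_vector_dist[OF assms(1,2)] using assms(3) by (simp split: if_split)

lemma edge_base_mult_eq_iff: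
  assumes h: "h \<in> carrier H" and x: "x \<in> carrier G" and y: "y \<in> carrier G"
  shows "edge (base h \<cdot> x) = edge (base h \<cdot> y) \<longleftrightarrow> edge x = edge y"
proof
  assume "edge (base h \<cdot> x) = edge (base h \<cdot> y)"
  then have "edge (base (inv h) \<cdot> (base h \<cdot> x)) = edge (base (inv h) \<cdot> (base h \<cdot> y))"
    using edge_base_mult[of "inv h"] h x y by simp
  then show "edge x = edge y" using h x y by (simp add: base_mult base_one flip: G.m_assoc)
qed (simp add: edge_base_mult h x y)

lemma edge_base_mult_None: "h \<in> carrier H \<Longrightarrow> x \<in> carrier G \<Longrightarrow>
    edge (base h \<cdot> x) = None \<longleftrightarrow> edge x = None"
  by (simp add: edge_base_mult)

text \<open>The first syllable, seen in Hilbert space through \<open>f\<close>, together with the first edge define a map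
  with \<open>H\<close>-invariant distances. Inducing it to \<open>G\<close> collects, along the path to an element in the Bass-Serre tree,
  the displacements of all syllables and one unit for each edge.\<close>

lemma induced_displacement:
  fixes f :: "'a \<Rightarrow> ell2"
  assumes f: "left_invariant H f" and fK: "\<And>h k. h \<in> carrier H \<Longrightarrow> k \<in> K \<Longrightarrow> f (h \<otimes> k) = f h"
  obtains B :: "'a hnn_letter list set \<Rightarrow> ell2" where "left_invariant G B"
    "\<And>h l. reduced h l \<Longrightarrow>
      real (length l) + (\<Sum>x\<leftarrow>h # map snd l. (norm (f x - f \<one>))\<^sup>2) \<le> (norm (B (elem h l) - B \<one>\<^bsub>G\<^esub>))\<^sup>2"
proof -
  define \<beta> where "\<beta> g = copy 0 (f (syllable g)) + copy 1 (edge_vector (edge g))" for g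
  have \<beta>_dist: "(norm (\<beta> x - \<beta> y))\<^sup>2 = (norm (f (syllable x) - f (syllable y)))\<^sup>2 +
      (norm (edge_vector (edge x) - edge_vector (edge y)))\<^sup>2" for x y
  proof -
    have "\<beta> x - \<beta> y = copy 0 (f (syllable x) - f (syllable y)) +
        copy 1 (edge_vector (edge x) - edge_vector (edge y))"
      by (simp add: \<beta>_def linear_diff[OF linear_copy])
    then show ?thesis by (simp add: norm_copy_add)
  qed
  have f_assoc: "f (h \<otimes> a) = f h" if "h \<in> carrier H" "a \<in> assoc e" for h a e
    using fK K(3) that by blast
  have \<beta>_eq: "\<beta> x = \<beta> y" if xy: "x \<in> carrier G" "y \<in> carrier G" "edge x = edge y" "edge y \<noteq> None" for x y
  proof -
    obtain e a where "a \<in> assoc e" "syllable x = syllable y \<otimes> a"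
      using edge_eq_imp_syllable[of y x] xy by auto
    then show ?thesis using f_assoc[OF syllable_closed[OF xy(2)]] xy(3) by (simp add: \<beta>_def)
  qed
  have \<beta>_base: "norm (\<beta> (base h \<cdot> x) - \<beta> (base h \<cdot> y)) = norm (\<beta> x - \<beta> y)"
    if h: "h \<in> carrier H" and x: "x \<in> carrier G" and y: "y \<in> carrier G" for h x y
  proof -
    have "(norm (\<beta> (base h \<cdot> x) - \<beta> (base h \<cdot> y)))\<^sup>2 = (norm (\<beta> x - \<beta> y))\<^sup>2"
      unfolding \<beta>_dist edge_vector_dist[OF x y]
        edge_vector_dist[OF G.m_closed[OF base_closed[OF h] x] G.m_closed[OF base_closed[OF h] y]]
      using left_invariantD[OF f h syllable_closed[OF x] syllable_closed[OF y]]
      by (simp add: syllable_base_mult edge_base_mult_eq_iff edge_base_mult_None h x y)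
    then show ?thesis by simp
  qed
  have fin: "\<exists>R. finite R \<and> R \<subseteq> carrier G \<and> (\<forall>g\<in>carrier G.
      \<beta> (inv\<^bsub>G\<^esub> g \<cdot> x) \<noteq> \<beta> (inv\<^bsub>G\<^esub> g) \<longrightarrow> (\<exists>r\<in>R. inv\<^bsub>G\<^esub> r \<cdot> g \<in> base ` carrier H))"
    if "x \<in> carrier G" for x
    using that
  proof (induction x rule: G_induct)
    case one
    show ?case by (intro exI[of _ "{}"]) simp
  next
    case (base x h)
    then have h: "h \<in> carrier H" by blast
    from base obtain R where R: "finite R" "R \<subseteq> carrier G" "\<And>g. g \<in> carrier G \<Longrightarrow>
        \<beta> (inv\<^bsub>G\<^esub> g \<cdot> x) \<noteq> \<beta> (inv\<^bsub>G\<^esub> g) \<Longrightarrow> \<exists>r\<in>R. inv\<^bsub>G\<^esub> r \<cdot> g \<in> base ` carrier H"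
      by blast
    have "\<exists>r\<in>insert x R. inv\<^bsub>G\<^esub> r \<cdot> g \<in> base ` carrier H"
      if g: "g \<in> carrier G" and ne: "\<beta> (inv\<^bsub>G\<^esub> g \<cdot> (x \<cdot> base h)) \<noteq> \<beta> (inv\<^bsub>G\<^esub> g)" for g
    proof (cases "\<beta> (inv\<^bsub>G\<^esub> g \<cdot> x) = \<beta> (inv\<^bsub>G\<^esub> g)")
      case True
      define y where "y = inv\<^bsub>G\<^esub> g \<cdot> x"
      have y: "y \<in> carrier G" using g base by (simp add: y_def)
      have "\<beta> (y \<cdot> base h) \<noteq> \<beta> y" using ne True g base by (simp add: y_def G.m_assoc)
      then have "edge y = None"
        using \<beta>_eq[OF G.m_closed[OF y base_closed[OF h]] y] edge_mult_base[OF y h]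
        by blast
      then have "y \<in> base ` carrier H" using edge_None_iff[OF y] by simp
      then obtain k where "k \<in> carrier H" "y = base k" by blast
      then have "inv\<^bsub>G\<^esub> y \<in> base ` carrier H" by (simp flip: base_inv)
      then show ?thesis using g base by (simp add: y_def G.inv_mult_group)
    next
      case False
      then show ?thesis using R(3)[OF g] by blast
    qed
    then show ?case using R(1,2) base by (intro exI[of _ "insert x R"]) auto
  next
    case (stable x e)
    then obtain R where R: "finite R" "R \<subseteq> carrier G" "\<And>g. g \<in> carrier G \<Longrightarrow>
        \<beta> (inv\<^bsub>G\<^esub> g \<cdot> x) \<noteq> \<beta> (inv\<^bsub>G\<^esub> g) \<Longrightarrow> \<exists>r\<in>R. inv\<^bsub>G\<^esub> r \<cdot> g \<in> base ` carrier H"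
      by blast
    let ?x' = "x \<cdot> stable e"
    have "\<exists>r\<in>insert x (insert ?x' R). inv\<^bsub>G\<^esub> r \<cdot> g \<in> base ` carrier H"
      if g: "g \<in> carrier G" and ne: "\<beta> (inv\<^bsub>G\<^esub> g \<cdot> ?x') \<noteq> \<beta> (inv\<^bsub>G\<^esub> g)" for g
    proof (cases "\<beta> (inv\<^bsub>G\<^esub> g \<cdot> x) = \<beta> (inv\<^bsub>G\<^esub> g)")
      case True
      define y where "y = inv\<^bsub>G\<^esub> g \<cdot> x"
      have y: "y \<in> carrier G" using g stable by (simp add: y_def)
      have y': "y \<cdot> stable e = inv\<^bsub>G\<^esub> g \<cdot> ?x'" using g stable by (simp add: y_def G.m_assoc)
      have "\<beta> (y \<cdot> stable e) \<noteq> \<beta> y" using ne True y' by (simp add: y_def)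
      then have "edge y = None \<or> edge (y \<cdot> stable e) = None"
        using \<beta>_eq[OF G.m_closed[OF y stable_closed] y] edge_mult_stable[OF y] by blast
      then have "\<exists>r\<in>{x, ?x'}. inv\<^bsub>G\<^esub> g \<cdot> r \<in> base ` carrier H"
        using edge_None_iff[OF y] edge_None_iff[OF G.m_closed[OF y stable_closed[of e]]] y'
        by (auto simp: y_def)
      then obtain r k where r: "r \<in> {x, ?x'}" and k: "k \<in> carrier H" "inv\<^bsub>G\<^esub> g \<cdot> r = base k"
        by blast
      have rG: "r \<in> carrier G" using r stable by auto
      have "inv\<^bsub>G\<^esub> r \<cdot> g = inv\<^bsub>G\<^esub> (inv\<^bsub>G\<^esub> g \<cdot> r)" using g rG by (simp add: G.inv_mult_group)
      also have "\<dots> = base (inv k)" using k by (simp add: base_inv)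
      finally show ?thesis using r k(1) by blast
    next
      case False
      then show ?thesis using R(3)[OF g] by blast
    qed
    then show ?case using R(1,2) stable by (intro exI[of _ "insert x (insert ?x' R)"]) auto
  qed
  have "group_hom H G base"
    using base_hom H.is_group group_G by (simp add: group_hom_def group_hom_axioms_def)
  then have L: "subgroup (base ` carrier H) G"
    by (intro group_hom.subgroup_img_is_subgroup) (auto intro: H.subgroup_self)
  have L_inv: "norm (\<beta> (z \<cdot> x) - \<beta> (z \<cdot> y)) = norm (\<beta> x - \<beta> y)"
    if "z \<in> base ` carrier H" "x \<in> carrier G" "y \<in> carrier G" for z x y
    using that \<beta>_base by blast
  obtain B :: "'a hnn_letter list set \<Rightarrow> ell2" where B: "left_invariant G B"
    "\<And>x y (I :: nat set) p. x \<in> carrier G \<Longrightarrow> y \<in> carrier G \<Longrightarrow> finite I \<Longrightarrow> p ` I \<subseteq> carrier G \<Longrightarrow>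
       (\<And>i j. i \<in> I \<Longrightarrow> j \<in> I \<Longrightarrow> i \<noteq> j \<Longrightarrow> inv\<^bsub>G\<^esub> p i \<cdot> p j \<notin> base ` carrier H) \<Longrightarrow>
       (\<Sum>i\<in>I. (norm (\<beta> (inv\<^bsub>G\<^esub> p i \<cdot> x) - \<beta> (inv\<^bsub>G\<^esub> p i \<cdot> y)))\<^sup>2) \<le> (norm (B x - B y))\<^sup>2"
    by (rule induced_left_invariant[of G "base ` carrier H" \<beta>, OF group_G
        countable_finitely_generated[OF group_G T] L L_inv fin]) blast+
  have "real (length l) + (\<Sum>x\<leftarrow>h # map snd l. (norm (f x - f \<one>))\<^sup>2) \<le> (norm (B (elem h l) - B \<one>\<^bsub>G\<^esub>))\<^sup>2"
    if red: "reduced h l" for h l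
  proof -
    let ?g = "elem h l" and ?n = "length l" and ?p = "station h l"
    have g: "?g \<in> carrier G" by (rule elem_closed[OF red])
    note p = station_closed[OF red]
    have syl: "(h # map snd l) ! i = last_syllable h (take i l)" if "i \<le> ?n" for i
      using that by (cases i) (auto simp: last_syllable_def take_Suc_conv_app_nth)
    have term_ge: "(if l = [] then 0 else 1) + (norm (f ((h # map snd l) ! i) - f \<one>))\<^sup>2 \<le>
        (norm (\<beta> (inv\<^bsub>G\<^esub> ?p i \<cdot> ?g) - \<beta> (inv\<^bsub>G\<^esub> ?p i \<cdot> \<one>\<^bsub>G\<^esub>)))\<^sup>2" if i: "i \<le> ?n" for i
    proof -
      let ?s = "last_syllable h (take i l)"
      have red': "reduced ?s (drop i l)" by (rule reduced_take_drop(2)[OF red])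
      note s = reduced_closed[OF red']
      obtain a m where "nf (elem ?s (drop i l)) = (?s \<otimes> a, m)"
        "if drop i l = [] then a = \<one> else a \<in> assoc (fst (hd (drop i l)))"
        using nf_elem[OF red'] by blast
      then have f1: "f (syllable (inv\<^bsub>G\<^esub> ?p i \<cdot> ?g)) = f ?s"
        using s f_assoc[OF s] unfolding station_to_elem[OF red] syllable_def by (auto split: if_splits)
      obtain e b where "b \<in> assoc e" "syllable (inv\<^bsub>G\<^esub> ?p i) = b"
        using edge_inv_station(2)[OF red i] by blast
      then have f2: "f (syllable (inv\<^bsub>G\<^esub> ?p i)) = f \<one>"
        using f_assoc[OF H.one_closed, of b e] assoc_closed[of b e] by simp
      have "(if l = [] then 0 else 1) \<le>
          (norm (edge_vector (edge (inv\<^bsub>G\<^esub> ?p i \<cdot> ?g)) - edge_vector (edge (inv\<^bsub>G\<^esub> ?p i))))\<^sup>2"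
        using edge_vector_separated[OF G.m_closed[OF G.inv_closed[OF p] g] G.inv_closed[OF p]]
          station_edges_differ[OF red i] by fastforce
      then show ?thesis using p by (simp add: \<beta>_dist f1 f2 syl[OF i])
    qed
    have dis: "inv\<^bsub>G\<^esub> ?p i \<cdot> ?p j \<notin> base ` carrier H" if ij: "i \<in> {..?n}" "j \<in> {..?n}" "i \<noteq> j" for i j
    proof (cases "i < j")
      case True
      then show ?thesis using station_vertices_distinct[OF red True] ij by simp
    next
      case False
      then have "inv\<^bsub>G\<^esub> ?p j \<cdot> ?p i \<notin> base ` carrier H"
        using station_vertices_distinct[OF red, of j i] ij by simp
      moreover have "inv\<^bsub>G\<^esub> ?p j \<cdot> ?p i = inv\<^bsub>G\<^esub> (inv\<^bsub>G\<^esub> ?p i \<cdot> ?p j)"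
        using p by (simp add: G.inv_mult_group)
      ultimately show ?thesis using subgroup.m_inv_closed[OF L] by metis
    qed
    have "real ?n \<le> (\<Sum>i\<le>?n. if l = [] then 0 else 1)" by simp
    moreover have "(\<Sum>x\<leftarrow>h # map snd l. (norm (f x - f \<one>))\<^sup>2) =
        (\<Sum>i\<le>?n. (norm (f ((h # map snd l) ! i) - f \<one>))\<^sup>2)"
      unfolding sum_list_sum_nth[of "map _ _"]
      by (rule sum.cong) (auto simp del: list.map simp: atLeast0LessThan lessThan_Suc_atMost)
    ultimately have "real ?n + (\<Sum>x\<leftarrow>h # map snd l. (norm (f x - f \<one>))\<^sup>2) \<le>
        (\<Sum>i\<le>?n. (if l = [] then 0 else 1) + (norm (f ((h # map snd l) ! i) - f \<one>))\<^sup>2)"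
      by (simp only: sum.distrib)
    also have "\<dots> \<le> (\<Sum>i\<le>?n. (norm (\<beta> (inv\<^bsub>G\<^esub> ?p i \<cdot> ?g) - \<beta> (inv\<^bsub>G\<^esub> ?p i \<cdot> \<one>\<^bsub>G\<^esub>)))\<^sup>2)"
      by (intro sum_mono term_ge) simp
    also have "\<dots> \<le> (norm (B ?g - B \<one>\<^bsub>G\<^esub>))\<^sup>2"
      using p dis by (intro B(2)[OF g]) auto
    finally show ?thesis .
  qed
  then show ?thesis using that B(1) by blast
qed

text \<open>Stable letters enter the squared displacement linearly and syllables with the power \<open>2 * \<epsilon>\<close> of
  their length. For \<open>2 * \<epsilon> \<le> 1\<close> this power is subadditive, so that the squared displacement is bounded
  below by that power of the total length; this is where the exponent one half comes from.\<close>

theorem base_exponent_le_equivariant_compression: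
  assumes \<epsilon>: "0 < \<epsilon>" "\<epsilon> \<le> 1 / 2" "\<epsilon> < equivariant_compression H S"
  shows "\<epsilon> \<le> equivariant_compression G T"
proof -
  obtain f\<^sub>0 :: "'a \<Rightarrow> ell2" where "equivariant H f\<^sub>0" "compression_exponent H S f\<^sub>0 \<epsilon>"
    using exponent_below_equivariant_compression[of \<epsilon> H S] \<epsilon> by auto
  then obtain f :: "'a \<Rightarrow> ell2" where f: "left_invariant H f" "compression_exponent H S f \<epsilon>"
    and fK: "\<And>h k. h \<in> carrier H \<Longrightarrow> k \<in> K \<Longrightarrow> f (h \<otimes> k) = f h"
    using equivariant_average[OF H.is_group _ K(1,2)] by blast
  obtain A where A: "A > 0" "\<And>x. x \<in> carrier H \<Longrightarrow>
      real (lenH x) powr (2 * \<epsilon>) \<le> A * ((norm (f x - f \<one>))\<^sup>2 + 1)"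
    using f(2) unfolding compression_exponent_squared[OF H.is_group f(1)] by blast
  obtain B :: "'a hnn_letter list set \<Rightarrow> ell2" where B: "left_invariant G B"
    and B_ge: "\<And>h l. reduced h l \<Longrightarrow>
      real (length l) + (\<Sum>x\<leftarrow>h # map snd l. (norm (f x - f \<one>))\<^sup>2) \<le> (norm (B (elem h l) - B \<one>\<^bsub>G\<^esub>))\<^sup>2"
    using induced_displacement[OF f(1) fK] by blast
  obtain C where C: "C > 0" "\<And>h l. reduced h l \<Longrightarrow>
      real (lenG (elem h l)) \<le> C * (real (length l) + (\<Sum>x\<leftarrow>h # map snd l. real (lenH x)))"
    using lenG_elem_le by blast
  define p where "p = 2 * \<epsilon>"
  have p: "0 < p" "p \<le> 1" using \<epsilon> by (simp_all add: p_def)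
  define Z where "Z = C powr p * (1 + 2 * A)"
  have "real (lenG g) powr p \<le> Z * ((norm (B g - B \<one>\<^bsub>G\<^esub>))\<^sup>2 + 1)" if gG: "g \<in> carrier G" for g
  proof -
    obtain h l where red: "reduced h l" and g: "elem h l = g" using elem_surj[OF gG] .
    let ?n = "real (length l)" and ?xs = "h # map snd l"
    define N where "N = (\<Sum>x\<leftarrow>?xs. (norm (f x - f \<one>))\<^sup>2)"
    have N: "N \<ge> 0" unfolding N_def by (intro sum_list_nonneg) auto
    have xs: "set ?xs \<subseteq> carrier H" using red by (auto simp: reduced_def)
    have s0: "0 \<le> (\<Sum>x\<leftarrow>?xs. real (lenH x))" by (intro sum_list_nonneg) auto
    have "?n powr p \<le> ?n"
      using powr_mono[of p 1 ?n] p by (cases l) auto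
    moreover have "(\<Sum>x\<leftarrow>?xs. real (lenH x)) powr p \<le> A * (N + ?n + 1)"
    proof -
      have "(\<Sum>x\<leftarrow>?xs. real (lenH x)) powr p \<le> (\<Sum>x\<leftarrow>?xs. real (lenH x) powr p)"
        by (rule powr_sum_list_le) (use p in auto)
      also have "\<dots> \<le> (\<Sum>x\<leftarrow>?xs. A * ((norm (f x - f \<one>))\<^sup>2 + 1))"
        using xs A(2) unfolding p_def by (intro sum_list_mono) blast
      also have "\<dots> = A * (N + ?n + 1)"
        unfolding sum_list_const_mult sum_list_addf sum_list_real_const N_def by simp
      finally show ?thesis .
    qed
    ultimately have "(?n + (\<Sum>x\<leftarrow>?xs. real (lenH x))) powr p \<le> ?n + A * (N + ?n + 1)"
      using powr_add_le[OF _ s0 p, of ?n] by simp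
    also have "\<dots> \<le> (1 + 2 * A) * (?n + N + 1)"
      using A(1) N by (simp add: algebra_simps)
    finally have sum_le: "(?n + (\<Sum>x\<leftarrow>?xs. real (lenH x))) powr p \<le> (1 + 2 * A) * (?n + N + 1)" .
    have "real (lenG g) powr p \<le> (C * (?n + (\<Sum>x\<leftarrow>?xs. real (lenH x)))) powr p"
      using C(2)[OF red] g p by (intro powr_mono2) auto
    also have "\<dots> = C powr p * (?n + (\<Sum>x\<leftarrow>?xs. real (lenH x))) powr p"
      using C(1) s0 by (simp add: powr_mult)
    also have "\<dots> \<le> C powr p * ((1 + 2 * A) * (?n + N + 1))"
      using sum_le by (intro mult_left_mono) auto
    also have "\<dots> \<le> Z * ((norm (B g - B \<one>\<^bsub>G\<^esub>))\<^sup>2 + 1)"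
      unfolding Z_def mult.assoc
      using B_ge[OF red] A(1) g by (intro mult_left_mono) (auto simp: N_def)
    finally show ?thesis .
  qed
  moreover have "Z > 0" unfolding Z_def using C(1) A(1) by (intro mult_pos_pos) auto
  ultimately have "compression_exponent G T B \<epsilon>"
    unfolding compression_exponent_squared[OF group_G B] p_def by blast
  then show ?thesis
    using exponent_le_equivariant_compression[OF group_G T B] \<epsilon> by simp
qed


section \<open>The case of full associated subgroups\<close>

text \<open>The exponent sum of the stable letter. It is read off from the normal form, on which the letters
  act explicitly, so that its behaviour under left multiplication is immediate.\<close>

definition exponent_sum :: "'a hnn_letter list set \<Rightarrow> real" where
  "exponent_sum g = (\<Sum>p\<leftarrow>snd (nf g). if fst p then 1 else - 1)"

lemma exponent_sum_base: "g \<in> carrier G \<Longrightarrow> h \<in> carrier H \<Longrightarrow>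
    exponent_sum (base h \<cdot> g) = exponent_sum g"
  by (simp add: exponent_sum_def nf_base)

lemma exponent_sum_stable: "g \<in> carrier G \<Longrightarrow>
    exponent_sum (stable e \<cdot> g) = exponent_sum g + (if e then 1 else - 1)"
  by (cases "snd (nf g)")
     (auto simp: exponent_sum_def nf_stable stable_act_def Let_def split: prod.splits)

lemma exponent_sum_left_invariant: "left_invariant G exponent_sum"
  unfolding left_invariant_def
proof (intro ballI)
  fix g x y assume "g \<in> carrier G" and x: "x \<in> carrier G" and y: "y \<in> carrier G"
  from this(1) have "exponent_sum (g \<cdot> x) - exponent_sum (g \<cdot> y) = exponent_sum x - exponent_sum y"
    using x y
  proof (induction g arbitrary: x y rule: G_induct)
    case (base g h)
    then show ?case by (simp add: G.m_assoc exponent_sum_base)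
  next
    case (stable g e)
    then show ?case by (simp add: G.m_assoc exponent_sum_stable)
  qed simp
  then show "norm (exponent_sum (g \<cdot> x) - exponent_sum (g \<cdot> y)) =
      norm (exponent_sum x - exponent_sum y)" by simp
qed

text \<open>If the associated subgroups are the whole of \<open>H\<close>, every syllable of a normal form except the
  first is trivial, so its stable letters all have the same exponent.\<close>

lemma abs_exponent_sum:
  assumes "\<And>e. assoc e = carrier H" "g \<in> carrier G"
  shows "\<bar>exponent_sum g\<bar> = real (stable_length g)"
proof -
  have same: "\<exists>e. \<forall>p\<in>set l. fst p = e"
    if "\<forall>p\<in>set l. snd p = \<one>" "successively (\<lambda>(e, s) (e', s'). s = \<one> \<longrightarrow> e' = e) l" for l
    using that
  proof (induction l)
    case (Cons p l)
    then obtain e where e: "\<forall>q\<in>set l. fst q = e" by (auto simp: successively_Cons)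
    show ?case
    proof (cases l)
      case (Cons q m)
      then have "fst p = e" using Cons.prems e by (cases p; cases q) (auto simp: successively_Cons)
      then show ?thesis using e by auto
    qed auto
  qed simp
  have "\<forall>p\<in>set (snd (nf g)). snd p = \<one>"
    using nf_normal[OF assms(2)] assms(1) by (auto simp: normal_def rep_def split: prod.splits)
  moreover have "successively (\<lambda>(e, s) (e', s'). s = \<one> \<longrightarrow> e' = e) (snd (nf g))"
    using nf_normal[OF assms(2)] by (auto simp: normal_def split: prod.splits)
  ultimately obtain e where e: "\<forall>p\<in>set (snd (nf g)). fst p = e" using same by metis
  then have "exponent_sum g = (\<Sum>p\<leftarrow>snd (nf g). if e then 1 else - 1)"
    unfolding exponent_sum_def by (intro arg_cong[where f = sum_list] map_cong) auto
  then show ?thesis by (simp add: stable_length_def sum_list_real_const)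
qed

text \<open>Now \<open>H\<close> is finite, and the exponent sum is a quasi-isometry from \<open>G\<close> to the integers.\<close>

theorem equivariant_compression_eq_one:
  assumes full: "\<And>e. assoc e = carrier H"
  shows "equivariant_compression G T = 1"
proof -
  obtain C where C: "C > 0" "\<And>h l. reduced h l \<Longrightarrow>
      real (lenG (elem h l)) \<le> C * (real (length l) + (\<Sum>x\<leftarrow>h # map snd l. real (lenH x)))"
    using lenG_elem_le by blast
  have fin: "finite (carrier H)" using K(2) K(3)[of True] unfolding full by (rule rev_finite_subset)
  define W where "W = (\<Sum>x\<in>carrier H. real (lenH x))"
  have W: "real (lenH x) \<le> W" if "x \<in> carrier H" for x
    using member_le_sum[of x "carrier H" "\<lambda>x. real (lenH x)"] that fin by (simp add: W_def)
  have W0: "W \<ge> 0" unfolding W_def by (intro sum_nonneg) simp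
  define D where "D = C * (1 + W)"
  have D: "D > 0" using C(1) W0 by (simp add: D_def)
  have "real (lenG g) powr (2 * 1) \<le> (2 * D\<^sup>2) * ((norm (exponent_sum g - exponent_sum \<one>\<^bsub>G\<^esub>))\<^sup>2 + 1)"
    if g: "g \<in> carrier G" for g
  proof -
    obtain h l where red: "reduced h l" and hl: "elem h l = g" using elem_surj[OF g] .
    let ?n = "real (length l)"
    have n: "?n = norm (exponent_sum g - exponent_sum \<one>\<^bsub>G\<^esub>)"
      using abs_exponent_sum[OF full g] stable_length_elem[OF red] hl
      by (simp add: exponent_sum_def[of "\<one>\<^bsub>G\<^esub>"] nf_one)
    have "(\<Sum>x\<leftarrow>h # map snd l. real (lenH x)) \<le> (\<Sum>x\<leftarrow>h # map snd l. W)"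
      using red W by (intro sum_list_mono) (auto simp: reduced_def)
    also have "\<dots> = W * (?n + 1)" unfolding sum_list_real_const by (simp add: mult.commute)
    finally have "?n + (\<Sum>x\<leftarrow>h # map snd l. real (lenH x)) \<le> (1 + W) * (?n + 1)"
      by (simp add: algebra_simps)
    then have "C * (?n + (\<Sum>x\<leftarrow>h # map snd l. real (lenH x))) \<le> C * ((1 + W) * (?n + 1))"
      using C(1) by (intro mult_left_mono) auto
    then have "real (lenG g) \<le> D * (?n + 1)" using C(2)[OF red] hl by (simp add: D_def mult.assoc)
    then have "(real (lenG g))\<^sup>2 \<le> (D * (?n + 1))\<^sup>2" by (intro power_mono) auto
    also have "\<dots> \<le> D\<^sup>2 * (2 * (?n\<^sup>2 + 1))"
      unfolding power_mult_distrib using sum_squares_bound[of ?n 1]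
      by (intro mult_left_mono) (auto simp: power2_sum)
    finally show ?thesis unfolding n by (cases "lenG g = 0") (simp_all add: powr_numeral algebra_simps)
  qed
  moreover have "2 * D\<^sup>2 > 0" using D by simp
  ultimately have "compression_exponent G T exponent_sum 1"
    unfolding compression_exponent_squared[OF group_G exponent_sum_left_invariant] by blast
  then have "1 \<le> equivariant_compression G T"
    by (intro exponent_le_equivariant_compression[OF group_G T exponent_sum_left_invariant]) auto
  then show ?thesis using equivariant_compression_bounds(2)[of G T] by simp
qed

end

section \<open>The equivariant compression of an HNN extension\<close>

theorem theorem1p5:
  fixes H :: "('a, 'b) monoid_scheme"
    and S F :: "'a set"
    and \<theta> :: "'a \<Rightarrow> 'a"
    and T :: "'a hnn_letter list set set"
    and \<alpha>\<^sub>1 \<alpha> :: real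
  assumes "group H"
    and "finite_symmetric_generating_set H S"
    and "\<alpha>\<^sub>1 = equivariant_compression H S"
    and "subgroup F H" and "finite F"
    and "\<theta> \<in> hom (H\<lparr>carrier := F\<rparr>) H" and "inj_on \<theta> F"
    and "finite (generate H (\<theta> ` F \<union> F))"
    and "finite_symmetric_generating_set (HNN H F \<theta>) T"
    and "\<alpha> = equivariant_compression (HNN H F \<theta>) T"
  shows "(F = carrier H \<longrightarrow> \<alpha> = 1) \<and> (F \<noteq> carrier H \<longrightarrow> \<alpha> = min \<alpha>\<^sub>1 (1 / 2))"
proof -
  interpret H: group H by fact
  have FH: "F \<subseteq> carrier H" using assms(4) by (rule subgroup.subset)
  have \<theta>H: "\<theta> ` F \<subseteq> carrier H" using assms(6) by (auto simp: hom_def)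
  interpret hnn: hnn_extension H F \<theta>
    by (intro hnn_extension.intro hnn_extension_axioms.intro) (rule assms)+
  interpret finite_hnn_extension H F \<theta> S T "generate H (\<theta> ` F \<union> F)"
  proof (intro finite_hnn_extension.intro finite_hnn_extension_axioms.intro)
    show "subgroup (generate H (\<theta> ` F \<union> F)) H"
      using FH \<theta>H by (intro H.generate_is_subgroup) auto
    show "hnn.assoc e \<subseteq> generate H (\<theta> ` F \<union> F)" for e
      using generate.incl[of _ "\<theta> ` F \<union> F" H] by (auto simp: hnn.assoc_def)
  qed (rule hnn.hnn_extension_axioms assms)+
  \<comment> \<open>The two associated subgroups have the same finite order, so they are proper simultaneously.\<close>
  have proper: "\<theta> ` F = carrier H \<longleftrightarrow> F = carrier H"
  proof
    assume eq: "\<theta> ` F = carrier H"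
    then have "finite (carrier H)" using assms(5) by (metis finite_imageI)
    moreover have "card F = card (carrier H)" using card_image[OF assms(7)] eq by simp
    ultimately show "F = carrier H" using FH card_subset_eq by metis
  next
    assume eq: "F = carrier H"
    have "card (\<theta> ` F) = card (carrier H)" using card_image[OF assms(7)] eq by simp
    then show "\<theta> ` F = carrier H" using \<theta>H assms(5) eq card_subset_eq by metis
  qed
  show ?thesis
  proof (intro conjI impI)
    assume "F = carrier H"
    then have "hnn.assoc e = carrier H" for e
      unfolding hnn.assoc_def using proper by simp
    then show "\<alpha> = 1" unfolding assms(10) by (rule equivariant_compression_eq_one)
  next
    assume "F \<noteq> carrier H"
    then obtain a b where "a \<in> carrier H" "a \<notin> F" "b \<in> carrier H" "b \<notin> \<theta> ` F"
      using proper FH \<theta>H by blast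
    then have half: "\<alpha> \<le> 1 / 2"
      unfolding assms(10) by (intro equivariant_compression_le_half[of a b]) (auto simp: hnn.assoc_def)
    have base: "\<alpha> \<le> \<alpha>\<^sub>1"
      unfolding assms(3,10) by (rule equivariant_compression_le_base)
    have "min \<alpha>\<^sub>1 (1 / 2) \<le> \<alpha>"
    proof (rule ccontr)
      assume "\<not> min \<alpha>\<^sub>1 (1 / 2) \<le> \<alpha>"
      then obtain \<epsilon> where \<epsilon>: "\<alpha> < \<epsilon>" "\<epsilon> < min \<alpha>\<^sub>1 (1 / 2)"
        using dense[of \<alpha> "min \<alpha>\<^sub>1 (1 / 2)"] by (metis not_le)
      have "0 < \<epsilon>" using \<epsilon>(1) equivariant_compression_bounds(1) assms(10) le_less_trans by metis
      then have "\<epsilon> \<le> \<alpha>"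
        using \<epsilon>(2) unfolding assms(3,10) by (intro base_exponent_le_equivariant_compression) auto
      then show False using \<epsilon>(1) by simp
    qed
    then show "\<alpha> = min \<alpha>\<^sub>1 (1 / 2)" using half base by simp
  qed
qed

end
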